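(* Let $(\mathscr{C},\mathbf{W})$ satisfy conditions (BF), let $\underline{f}^m:=(A^m,w^m,f^m):A\to B$ for $m=1,2$ be morphisms in $\mathscr{C}[\mathbf{W}^{-1}]$ and let $\Gamma:\underline{f}^1\Rightarrow\underline{f}^2$ be any 2-morphism. Then the following facts are equivalent: (i) $\Gamma$ is invertible in $\mathscr{C}[\mathbf{W}^{-1}]$; (ii) $\Gamma$ has a representative $(A^3,v^1,v^2,\alpha,\beta)$ such that $\beta$ is invertible in $\mathscr{C}$; (iii) given any representative $(A^3,v^1,v^2,\alpha,\beta)$ for $\Gamma$, there are an object $A^4$ and a morphism $u:A^4\to A^3$ in $\mathbf{W}$ such that $\beta\circ u$ is invertible in $\mathscr{C}$; (iv) given any representative $(A^3,v^1,v^2,\alpha,\beta)$ for $\Gamma$, there are an object $A^4$ and a morphism $u:A^4\to A^3$ such that $v^1\circ u$ belongs to $\mathbf{W}$ and such that $\beta\circ u$ is invertible in $\mathscr{C}$.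
   Context: Conventions. $\mathscr{C}$ is a bicategory and $\mathbf{W}$ a class of 1-morphisms in it. $\circ$ denotes composition of 1-morphisms and whiskering; $\bullet$ denotes vertical composition of 2-morphisms of $\mathscr{C}$ ($\beta\bullet\alpha$ means first $\alpha$, then $\beta$); $i_f$ is the identity 2-morphism of $f$. Associators and unitors of $\mathscr{C}$ are omitted from the notation, as if $\mathscr{C}$ were a 2-category (by coherence they can be inserted unambiguously); the statement is meant for arbitrary bicategories. Conditions (BF): (BF1) every $\mathrm{id}_A$ is in $\mathbf{W}$. (BF2) $\mathbf{W}$ is closed under composition. (BF3) For every $w:A\to B$ in $\mathbf{W}$ and every $f:C\to B$ there are an object $D$, $w':D\to C$ in $\mathbf{W}$, $f':D\to A$ and an invertible 2-morphism $f\circ w'\Rightarrow w\circ f'$. (BF4a) For every $w:B\to A$ in $\mathbf{W}$, $f^1,f^2:C\to B$ and $\alpha:w\circ f^1\Rightarrow w\circ f^2$ there are an object $D$, $v:D\to C$ in $\mathbf{W}$ and $\beta:f^1\circ v\Rightarrow f^2\circ v$ with $\alpha\circ v=w\circ\beta$. (BF4b) If $\alpha$ in (BF4a) is invertible, so is $\beta$. (BF4c) If $(D',v',\beta')$ is another triple with the same properties as $(D,v,\beta)$ in (BF4a), there are an object $E$, $u:E\to D$, $u':E\to D'$ and an invertible $\zeta:v\circ u\Rightarrow v'\circ u'$ with $v\circ u\in\mathbf{W}$ and $(\beta'\circ u')\bullet(f^1\circ\zeta)=(f^2\circ\zeta)\bullet(\beta\circ u)$. (BF5) If $w:A\to B$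 is in $\mathbf{W}$ and there is an invertible $v\Rightarrow w$, then $v\in\mathbf{W}$. Bicategory of fractions $\mathscr{C}[\mathbf{W}^{-1}]$ (Pronk). Objects: those of $\mathscr{C}$. A morphism $A\to B$ is a triple $(A',w,f)$ with $w:A'\to A$ in $\mathbf{W}$, $f:A'\to B$. A 2-morphism from $(A^1,w^1,f^1)$ to $(A^2,w^2,f^2)$ (both $A\to B$) is an equivalence class $[A^3,v^1,v^2,\alpha,\beta]$ of data (its representatives) with $v^m:A^3\to A^m$ ($m=1,2$), $w^1\circ v^1\in\mathbf{W}$, $\alpha:w^1\circ v^1\Rightarrow w^2\circ v^2$ invertible and $\beta:f^1\circ v^1\Rightarrow f^2\circ v^2$. Data $(A^3,v^1,v^2,\alpha,\beta)$ and $(A'^3,v'^1,v'^2,\alpha',\beta')$ are equivalent iff there are an object $A^4$, morphisms $z:A^4\to A^3$, $z':A^4\to A'^3$ and invertible $\sigma^1:v'^1\circ z'\Rightarrow v^1\circ z$, $\sigma^2:v^2\circ z\Rightarrow v'^2\circ z'$ with $w^1\circ v^1\circ z\in\mathbf{W}$, $(w^2\circ\sigma^2)\bullet(\alpha\circ z)\bullet(w^1\circ\sigma^1)=\alpha'\circ z'$ and $(f^2\circ\sigma^2)\bullet(\beta\circ z)\bullet(f^1\circ\sigma^1)=\beta'\circ z'$. Vertical composition: for $\Gamma^1=[A^4,u^1,u^2,\alpha^1,\beta^1]:(A^1,w^1,f^1)\Rightarrow(A^2,w^2,f^2)$ and $\Gamma^2=[A^5,u^3,u^4,\alpha^2,\beta^2]:(A^2,w^2,f^2)\Rightarrow(A^3,w^3,f^3)$,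 take $t^1:C\to A^4$ in $\mathbf{W}$, $t^2:C\to A^5$ and an invertible $\rho:u^2\circ t^1\Rightarrow u^3\circ t^2$; then $\Gamma^2\circ\Gamma^1$ is the class of $(C,u^1\circ t^1,u^4\circ t^2,(\alpha^2\circ t^2)\bullet(w^2\circ\rho)\bullet(\alpha^1\circ t^1),(\beta^2\circ t^2)\bullet(f^2\circ\rho)\bullet(\beta^1\circ t^1))$, which does not depend on the auxiliary data $(C,t^1,t^2,\rho)$ nor on the representatives. The identity of $(A',w,f)$ is $[A',\mathrm{id}_{A'},\mathrm{id}_{A'},i_w,i_f]$. "Invertible in $\mathscr{C}[\mathbf{W}^{-1}]$" means invertible for vertical composition. *)

theory Defs
  imports Main
begin

text \<open>
  A bicategory is given by sets of objects, 1-morphisms and 2-morphisms (cells) inside three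
  types; all operations are meaningful only on suitably composable arguments.  The operation
  \<open>hcomp\<close> is the horizontal composition of 2-morphisms, whiskering is derived from it.
  Composition is written in the order \<open>g \<odot> f\<close> (first \<open>f\<close>) and \<open>\<beta> \<bullet> \<alpha>\<close> (first \<open>\<alpha>\<close>).
\<close>

record ('o, 'm, 't) bicat =
  Obj :: "'o set"
  Mor :: "'m set"
  src :: "'m \<Rightarrow> 'o"
  tgt :: "'m \<Rightarrow> 'o"
  Cell :: "'t set"
  dom2 :: "'t \<Rightarrow> 'm"
  cod2 :: "'t \<Rightarrow> 'm"
  id1 :: "'o \<Rightarrow> 'm"
  comp1 :: "'m \<Rightarrow> 'm \<Rightarrow> 'm" (infixl "\<odot>\<index>" 75)
  id2 :: "'m \<Rightarrow> 't"
  vcomp :: "'t \<Rightarrow> 't \<Rightarrow> 't" (infixl "\<bullet>\<index>" 65)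
  hcomp :: "'t \<Rightarrow> 't \<Rightarrow> 't" (infixl "\<star>\<index>" 70)
  assoc :: "'m \<Rightarrow> 'm \<Rightarrow> 'm \<Rightarrow> 't"
  lunit :: "'m \<Rightarrow> 't"
  runit :: "'m \<Rightarrow> 't"

context
  fixes C :: "('o, 'm, 't) bicat" (structure)
begin

definition hom :: "'o \<Rightarrow> 'o \<Rightarrow> 'm set" where
  "hom A B = {f \<in> Mor C. src C f = A \<and> tgt C f = B}"

definition cells :: "'m \<Rightarrow> 'm \<Rightarrow> 't set" where
  "cells f g = {\<alpha> \<in> Cell C. dom2 C \<alpha> = f \<and> cod2 C \<alpha> = g}"

definition inverse2 :: "'t \<Rightarrow> 't \<Rightarrow> bool" where
  "inverse2 \<alpha> \<beta> \<longleftrightarrow> \<alpha> \<in> Cell C \<and> \<beta> \<in> cells (cod2 C \<alpha>) (dom2 C \<alpha>) \<and>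
     \<beta> \<bullet> \<alpha> = id2 C (dom2 C \<alpha>) \<and> \<alpha> \<bullet> \<beta> = id2 C (cod2 C \<alpha>)"

definition invertible2 :: "'t \<Rightarrow> bool" where
  "invertible2 \<alpha> \<longleftrightarrow> (\<exists>\<beta>. inverse2 \<alpha> \<beta>)"

definition inv2 :: "'t \<Rightarrow> 't" where
  "inv2 \<alpha> = (THE \<beta>. inverse2 \<alpha> \<beta>)"

definition icells :: "'m \<Rightarrow> 'm \<Rightarrow> 't set" where
  "icells f g = {\<alpha> \<in> cells f g. invertible2 \<alpha>}"

end

definition lwhisker :: "('o, 'm, 't) bicat \<Rightarrow> 'm \<Rightarrow> 't \<Rightarrow> 't" (infixr "\<triangleright>\<index>" 72) where
  "g \<triangleright>\<^bsub>C\<^esub> \<beta> = id2 C g \<star>\<^bsub>C\<^esub> \<beta>"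

definition rwhisker :: "('o, 'm, 't) bicat \<Rightarrow> 't \<Rightarrow> 'm \<Rightarrow> 't" (infixl "\<triangleleft>\<index>" 72) where
  "\<alpha> \<triangleleft>\<^bsub>C\<^esub> f = \<alpha> \<star>\<^bsub>C\<^esub> id2 C f"

locale bicategory =
  fixes C :: "('o, 'm, 't) bicat" (structure)
  assumes src_tgt: "f \<in> Mor C \<Longrightarrow> src C f \<in> Obj C \<and> tgt C f \<in> Obj C"
    and dom_cod: "\<alpha> \<in> Cell C \<Longrightarrow> dom2 C \<alpha> \<in> Mor C \<and> cod2 C \<alpha> \<in> Mor C \<and>
      src C (dom2 C \<alpha>) = src C (cod2 C \<alpha>) \<and> tgt C (dom2 C \<alpha>) = tgt C (cod2 C \<alpha>)"
    and id1_hom: "A \<in> Obj C \<Longrightarrow> id1 C A \<in> hom C A A"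
    and comp1_hom: "f \<in> hom C A B \<Longrightarrow> g \<in> hom C B D \<Longrightarrow> g \<odot> f \<in> hom C A D"
    and id2_cells: "f \<in> Mor C \<Longrightarrow> id2 C f \<in> cells C f f"
    and vcomp_cells: "\<alpha> \<in> cells C f g \<Longrightarrow> \<beta> \<in> cells C g h \<Longrightarrow> \<beta> \<bullet> \<alpha> \<in> cells C f h"
    and vcomp_id_left: "\<alpha> \<in> cells C f g \<Longrightarrow> id2 C g \<bullet> \<alpha> = \<alpha>"
    and vcomp_id_right: "\<alpha> \<in> cells C f g \<Longrightarrow> \<alpha> \<bullet> id2 C f = \<alpha>"
    and vcomp_assoc: "\<alpha> \<in> cells C f g \<Longrightarrow> \<beta> \<in> cells C g h \<Longrightarrow> \<gamma> \<in> cells C h k \<Longrightarrow>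
      (\<gamma> \<bullet> \<beta>) \<bullet> \<alpha> = \<gamma> \<bullet> (\<beta> \<bullet> \<alpha>)"
    and hcomp_cells: "\<alpha> \<in> cells C f f' \<Longrightarrow> \<beta> \<in> cells C g g' \<Longrightarrow> tgt C f = src C g \<Longrightarrow>
      \<beta> \<star> \<alpha> \<in> cells C (g \<odot> f) (g' \<odot> f')"
    and hcomp_id: "f \<in> hom C A B \<Longrightarrow> g \<in> hom C B D \<Longrightarrow>
      id2 C g \<star> id2 C f = id2 C (g \<odot> f)"
    and interchange: "\<alpha> \<in> cells C f f' \<Longrightarrow> \<alpha>' \<in> cells C f' f'' \<Longrightarrow>
      \<beta> \<in> cells C g g' \<Longrightarrow> \<beta>' \<in> cells C g' g'' \<Longrightarrow> tgt C f = src C g \<Longrightarrow>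
      (\<beta>' \<bullet> \<beta>) \<star> (\<alpha>' \<bullet> \<alpha>) = (\<beta>' \<star> \<alpha>') \<bullet> (\<beta> \<star> \<alpha>)"
    and assoc_icells: "f \<in> hom C A B \<Longrightarrow> g \<in> hom C B D \<Longrightarrow> h \<in> hom C D E \<Longrightarrow>
      assoc C h g f \<in> icells C ((h \<odot> g) \<odot> f) (h \<odot> (g \<odot> f))"
    and assoc_natural: "\<alpha> \<in> cells C f f' \<Longrightarrow> \<beta> \<in> cells C g g' \<Longrightarrow> \<gamma> \<in> cells C h h' \<Longrightarrow>
      tgt C f = src C g \<Longrightarrow> tgt C g = src C h \<Longrightarrow>
      assoc C h' g' f' \<bullet> ((\<gamma> \<star> \<beta>) \<star> \<alpha>) = (\<gamma> \<star> (\<beta> \<star> \<alpha>)) \<bullet> assoc C h g f"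
    and lunit_icells: "f \<in> hom C A B \<Longrightarrow> lunit C f \<in> icells C (id1 C B \<odot> f) f"
    and lunit_natural: "\<alpha> \<in> cells C f f' \<Longrightarrow>
      lunit C f' \<bullet> (id2 C (id1 C (tgt C f)) \<star> \<alpha>) = \<alpha> \<bullet> lunit C f"
    and runit_icells: "f \<in> hom C A B \<Longrightarrow> runit C f \<in> icells C (f \<odot> id1 C A) f"
    and runit_natural: "\<alpha> \<in> cells C f f' \<Longrightarrow>
      runit C f' \<bullet> (\<alpha> \<star> id2 C (id1 C (src C f))) = \<alpha> \<bullet> runit C f"
    and triangle: "f \<in> hom C A B \<Longrightarrow> g \<in> hom C B D \<Longrightarrow>
      (g \<triangleright> lunit C f) \<bullet> assoc C g (id1 C B) f = runit C g \<triangleleft> f"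
    and pentagon: "f \<in> hom C A B \<Longrightarrow> g \<in> hom C B D \<Longrightarrow> h \<in> hom C D E \<Longrightarrow> k \<in> hom C E F \<Longrightarrow>
      assoc C k h (g \<odot> f) \<bullet> assoc C (k \<odot> h) g f =
      (k \<triangleright> assoc C h g f) \<bullet> (assoc C k (h \<odot> g) f \<bullet> (assoc C k h g \<triangleleft> f))"

text \<open>
  For \<open>\<gamma> : g1 \<odot> v1 \<Rightarrow> g2 \<odot> v2\<close>, the cell \<open>awhisker C g1 v1 g2 v2 \<gamma> z\<close> is \<open>\<gamma> \<triangleleft> z\<close> with the
  associators inserted that turn it into a cell \<open>g1 \<odot> (v1 \<odot> z) \<Rightarrow> g2 \<odot> (v2 \<odot> z)\<close>.
  With it, all cells in the formulas below are bracketed to the right.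
\<close>

definition awhisker ::
  "('o, 'm, 't) bicat \<Rightarrow> 'm \<Rightarrow> 'm \<Rightarrow> 'm \<Rightarrow> 'm \<Rightarrow> 't \<Rightarrow> 'm \<Rightarrow> 't" where
  "awhisker C g1 v1 g2 v2 \<gamma> z =
     assoc C g2 v2 z \<bullet>\<^bsub>C\<^esub> ((\<gamma> \<triangleleft>\<^bsub>C\<^esub> z) \<bullet>\<^bsub>C\<^esub> inv2 C (assoc C g1 v1 z))"

text \<open>
  The triples \<open>(D, v, \<beta>)\<close> of condition (BF4a) for given \<open>w : B \<rightarrow> A\<close>, \<open>f1, f2 : X \<rightarrow> B\<close> and
  \<open>\<alpha> : w \<odot> f1 \<Rightarrow> w \<odot> f2\<close>.
\<close>

definition bf4_triples ::
  "('o, 'm, 't) bicat \<Rightarrow> 'm set \<Rightarrow> 'o \<Rightarrow> 'm \<Rightarrow> 'm \<Rightarrow> 'm \<Rightarrow> 't \<Rightarrow> ('o \<times> 'm \<times> 't) set" where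
  "bf4_triples C W X w f1 f2 \<alpha> = {(D, v, \<beta>).
     D \<in> Obj C \<and> v \<in> hom C D X \<and> v \<in> W \<and>
     \<beta> \<in> cells C (f1 \<odot>\<^bsub>C\<^esub> v) (f2 \<odot>\<^bsub>C\<^esub> v) \<and>
     awhisker C w f1 w f2 \<alpha> v = w \<triangleright>\<^bsub>C\<^esub> \<beta>}"

text \<open>
  (BF4b) is read as: for invertible \<open>\<alpha>\<close> the triple of (BF4a) can be chosen with invertible
  \<open>\<beta>\<close>.  (BF4c) concerns any two triples as in (BF4a).
\<close>

locale bf_bicategory = bicategory C
  for C :: "('o, 'm, 't) bicat" (structure) +
  fixes W :: "'m set"
  assumes W_Mor: "W \<subseteq> Mor C"
    and BF1: "A \<in> Obj C \<Longrightarrow> id1 C A \<in> W"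
    and BF2: "v \<in> hom C A B \<Longrightarrow> w \<in> hom C B D \<Longrightarrow> v \<in> W \<Longrightarrow> w \<in> W \<Longrightarrow> w \<odot> v \<in> W"
    and BF3: "w \<in> hom C A B \<Longrightarrow> w \<in> W \<Longrightarrow> f \<in> hom C X B \<Longrightarrow>
      \<exists>D\<in>Obj C. \<exists>w'\<in>hom C D X. \<exists>f'\<in>hom C D A.
        w' \<in> W \<and> icells C (f \<odot> w') (w \<odot> f') \<noteq> {}"
    and BF4a: "w \<in> hom C B A \<Longrightarrow> w \<in> W \<Longrightarrow> f1 \<in> hom C X B \<Longrightarrow> f2 \<in> hom C X B \<Longrightarrow>
      \<alpha> \<in> cells C (w \<odot> f1) (w \<odot> f2) \<Longrightarrow>
      \<exists>D v \<beta>. (D, v, \<beta>) \<in> bf4_triples C W X w f1 f2 \<alpha>"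
    and BF4b: "w \<in> hom C B A \<Longrightarrow> w \<in> W \<Longrightarrow> f1 \<in> hom C X B \<Longrightarrow> f2 \<in> hom C X B \<Longrightarrow>
      \<alpha> \<in> icells C (w \<odot> f1) (w \<odot> f2) \<Longrightarrow>
      \<exists>D v \<beta>. (D, v, \<beta>) \<in> bf4_triples C W X w f1 f2 \<alpha> \<and> invertible2 C \<beta>"
    and BF4c: "w \<in> hom C B A \<Longrightarrow> w \<in> W \<Longrightarrow> f1 \<in> hom C X B \<Longrightarrow> f2 \<in> hom C X B \<Longrightarrow>
      \<alpha> \<in> cells C (w \<odot> f1) (w \<odot> f2) \<Longrightarrow>
      (D, v, \<beta>) \<in> bf4_triples C W X w f1 f2 \<alpha> \<Longrightarrow>
      (D', v', \<beta>') \<in> bf4_triples C W X w f1 f2 \<alpha> \<Longrightarrow>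
      \<exists>E\<in>Obj C. \<exists>u\<in>hom C E D. \<exists>u'\<in>hom C E D'. \<exists>\<zeta>\<in>icells C (v \<odot> u) (v' \<odot> u').
        v \<odot> u \<in> W \<and>
        awhisker C f1 v' f2 v' \<beta>' u' \<bullet> (f1 \<triangleright> \<zeta>) =
        (f2 \<triangleright> \<zeta>) \<bullet> awhisker C f1 v f2 v \<beta> u"
    and BF5: "w \<in> W \<Longrightarrow> \<alpha> \<in> icells C v w \<Longrightarrow> v \<in> W"

type_synonym ('o, 'm) fmor = "'o \<times> 'm \<times> 'm"
type_synonym ('o, 'm, 't) fdata = "'o \<times> 'm \<times> 'm \<times> 't \<times> 't"

context
  fixes C :: "('o, 'm, 't) bicat" (structure) and W :: "'m set"
begin

definition frac_hom :: "'o \<Rightarrow> 'o \<Rightarrow> ('o, 'm) fmor set" where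
  "frac_hom A B = {(A', w, f). A' \<in> Obj C \<and> w \<in> hom C A' A \<and> w \<in> W \<and> f \<in> hom C A' B}"

fun frac_data :: "('o, 'm) fmor \<Rightarrow> ('o, 'm) fmor \<Rightarrow> ('o, 'm, 't) fdata set" where
  "frac_data (A1, w1, f1) (A2, w2, f2) = {(A3, v1, v2, \<alpha>, \<beta>).
     A3 \<in> Obj C \<and> v1 \<in> hom C A3 A1 \<and> v2 \<in> hom C A3 A2 \<and> w1 \<odot> v1 \<in> W \<and>
     \<alpha> \<in> icells C (w1 \<odot> v1) (w2 \<odot> v2) \<and> \<beta> \<in> cells C (f1 \<odot> v1) (f2 \<odot> v2)}"

fun frac_rel :: "('o, 'm) fmor \<Rightarrow> ('o, 'm) fmor \<Rightarrow> ('o, 'm, 't) fdata rel" where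
  "frac_rel (A1, w1, f1) (A2, w2, f2) =
     {((A3, v1, v2, \<alpha>, \<beta>), (A3', v1', v2', \<alpha>', \<beta>')).
       (A3, v1, v2, \<alpha>, \<beta>) \<in> frac_data (A1, w1, f1) (A2, w2, f2) \<and>
       (A3', v1', v2', \<alpha>', \<beta>') \<in> frac_data (A1, w1, f1) (A2, w2, f2) \<and>
       (\<exists>A4\<in>Obj C. \<exists>z\<in>hom C A4 A3. \<exists>z'\<in>hom C A4 A3'.
        \<exists>\<sigma>1\<in>icells C (v1' \<odot> z') (v1 \<odot> z). \<exists>\<sigma>2\<in>icells C (v2 \<odot> z) (v2' \<odot> z').
          (w1 \<odot> v1) \<odot> z \<in> W \<and>
          (w2 \<triangleright> \<sigma>2) \<bullet> (awhisker C w1 v1 w2 v2 \<alpha> z \<bullet> (w1 \<triangleright> \<sigma>1)) =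
            awhisker C w1 v1' w2 v2' \<alpha>' z' \<and>
          (f2 \<triangleright> \<sigma>2) \<bullet> (awhisker C f1 v1 f2 v2 \<beta> z \<bullet> (f1 \<triangleright> \<sigma>1)) =
            awhisker C f1 v1' f2 v2' \<beta>' z')}"

definition frac_class ::
  "('o, 'm) fmor \<Rightarrow> ('o, 'm) fmor \<Rightarrow> ('o, 'm, 't) fdata \<Rightarrow> ('o, 'm, 't) fdata set" where
  "frac_class F G d = frac_rel F G `` {d}"

definition frac_cells ::
  "('o, 'm) fmor \<Rightarrow> ('o, 'm) fmor \<Rightarrow> ('o, 'm, 't) fdata set set" where
  "frac_cells F G = frac_data F G // frac_rel F G"

text \<open>All composites of two representatives, for all choices of the auxiliary \<open>(X, t1, t2, \<rho>)\<close>.\<close>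

fun frac_composites :: "('o, 'm) fmor \<Rightarrow> ('o, 'm) fmor \<Rightarrow> ('o, 'm) fmor \<Rightarrow>
    ('o, 'm, 't) fdata \<Rightarrow> ('o, 'm, 't) fdata \<Rightarrow> ('o, 'm, 't) fdata set" where
  "frac_composites (A1, w1, f1) (A2, w2, f2) (A3, w3, f3)
     (A5, u3, u4, \<alpha>2, \<beta>2) (A4, u1, u2, \<alpha>1, \<beta>1) =
     {(X, u1 \<odot> t1, u4 \<odot> t2,
        awhisker C w2 u3 w3 u4 \<alpha>2 t2 \<bullet> ((w2 \<triangleright> \<rho>) \<bullet> awhisker C w1 u1 w2 u2 \<alpha>1 t1),
        awhisker C f2 u3 f3 u4 \<beta>2 t2 \<bullet> ((f2 \<triangleright> \<rho>) \<bullet> awhisker C f1 u1 f2 u2 \<beta>1 t1))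
      | X t1 t2 \<rho>. X \<in> Obj C \<and> t1 \<in> hom C X A4 \<and> t1 \<in> W \<and> t2 \<in> hom C X A5 \<and>
          \<rho> \<in> icells C (u2 \<odot> t1) (u3 \<odot> t2)}"

text \<open>
  The vertical composite \<open>\<Gamma>2 \<circ> \<Gamma>1\<close> of \<open>\<Gamma>1 : F \<Rightarrow> G\<close> and \<open>\<Gamma>2 : G \<Rightarrow> H\<close>.  The class of a
  composite does not depend on the choices made, so the union below is over copies of one and the
  same class.
\<close>

definition frac_vcomp :: "('o, 'm) fmor \<Rightarrow> ('o, 'm) fmor \<Rightarrow> ('o, 'm) fmor \<Rightarrow>
    ('o, 'm, 't) fdata set \<Rightarrow> ('o, 'm, 't) fdata set \<Rightarrow> ('o, 'm, 't) fdata set" where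
  "frac_vcomp F G H \<Gamma>2 \<Gamma>1 =
     (\<Union>d1\<in>\<Gamma>1. \<Union>d2\<in>\<Gamma>2. \<Union>e\<in>frac_composites F G H d2 d1. frac_class F H e)"

text \<open>
  The source of \<open>i\<^sub>w\<close> is here \<open>w \<odot> id\<close>: conjugating \<open>i\<^sub>w\<close> by the right unitor gives the
  identity cell of \<open>w \<odot> id\<close>.
\<close>

fun frac_id :: "('o, 'm) fmor \<Rightarrow> ('o, 'm, 't) fdata set" where
  "frac_id (A', w, f) = frac_class (A', w, f) (A', w, f)
     (A', id1 C A', id1 C A', id2 C (w \<odot> id1 C A'), id2 C (f \<odot> id1 C A'))"

definition frac_invertible ::
  "('o, 'm) fmor \<Rightarrow> ('o, 'm) fmor \<Rightarrow> ('o, 'm, 't) fdata set \<Rightarrow> bool" where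
  "frac_invertible F G \<Gamma> \<longleftrightarrow> \<Gamma> \<in> frac_cells F G \<and>
     (\<exists>\<Delta>\<in>frac_cells G F. frac_vcomp F G F \<Delta> \<Gamma> = frac_id F \<and> frac_vcomp G F G \<Gamma> \<Delta> = frac_id G)"

end

end

theory Submission
  imports Defs
begin

text \<open>
  Restrict data \<open>d = (X, x, y, \<alpha>, \<beta>)\<close> along \<open>z : Z \<rightarrow> X\<close> by whiskering; then \<open>d\<close> and \<open>d'\<close> are
  equivalent iff some restrictions \<open>d|z\<close> and \<open>d'|z'\<close>, with denominators in \<open>W\<close>, are isomorphic
  by cells between their legs.  All associators are hidden in these isomorphisms, so that no coherence theorem is needed
  beyond \<open>(d|z)|b \<cong> d|(z \<odot> b)\<close>, \<open>d|z \<cong> d|z'\<close> for \<open>z \<cong> z'\<close>, and compatibility with composition.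

  Conditions (ii)-(iv) all say that \<open>\<beta>\<close> becomes invertible after a restriction.  If \<open>\<Delta>\<close> is inverse to
  \<open>\<Gamma>\<close>, the two composites are identities after restriction, so \<open>\<beta>\<close> has a left inverse after one
  restriction and a right inverse after another, hence an inverse after a common one.  Conversely, if
  \<open>\<beta>\<close> is invertible, \<open>(X, y, x, \<alpha>\<inverse>, \<beta>\<inverse>)\<close> represents the inverse: a composite with \<open>d\<close> restricts to
  one along some \<open>\<kappa> : y \<odot> q \<Rightarrow> y \<odot> p\<close>, and after a further restriction \<open>\<kappa> = y \<triangleright> \<mu>\<close> with
  \<open>\<mu> : q \<Rightarrow> p\<close>, when naturality cancels \<open>\<alpha>\<close> against \<open>\<alpha>\<inverse>\<close> and \<open>\<beta>\<close> against \<open>\<beta>\<inverse>\<close>.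
\<close>

text \<open>(BF) contains no two-out-of-three rule: from \<open>v\<close> and
  \<open>v \<odot> z\<close> in \<open>W\<close> nothing is concluded about \<open>z\<close>. This
  condition is transported along isomorphisms of data, and the stronger demands of (iii) and (iv)
  are met by one more restriction, obtained from an Ore square. Composition of classes is a union
  over all representatives and all auxiliary choices, so an equation with an identity class says
  that every single composite is equivalent to the identity. Independence of the choices is not
  established for arbitrary factors. It suffices that each composite restricts to one built from
  fixed representatives, in which only the connecting cell is uncontrolled. For a datum and its
  inverse, that cell is then brought to a whiskered form by the liftings of (BF4).\<close>

context bicategory
begin

subsection \<open>Cells and whiskering\<close>

lemma hom_Obj: "f \<in> hom C A B \<Longrightarrow> A \<in> Obj C \<and> B \<in> Obj C"
  using src_tgt by (auto simp: hom_def)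

lemma cells_hom:
  assumes "\<sigma> \<in> cells C x y"
  shows "x \<in> hom C X A \<longleftrightarrow> y \<in> hom C X A"
  using assms dom_cod[of \<sigma>] by (auto simp: hom_def cells_def)

lemma cells_Mor:
  assumes "\<sigma> \<in> cells C x y"
  shows "x \<in> Mor C" "y \<in> Mor C"
  using assms dom_cod[of \<sigma>] by (auto simp: cells_def)

lemma inverse2_iff:
  "\<alpha> \<in> cells C f g \<Longrightarrow> inverse2 C \<alpha> \<beta> \<longleftrightarrow>
     \<beta> \<in> cells C g f \<and> \<beta> \<bullet> \<alpha> = id2 C f \<and> \<alpha> \<bullet> \<beta> = id2 C g"
  by (auto simp: inverse2_def cells_def)

text \<open>The usual monoid argument. It justifies the definite description in \<open>inv2\<close>,
  and later merges the left and the right inverse of \<beta> that come from the two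
  composites.\<close>

lemma left_right_inverse:
  assumes "\<alpha> \<in> cells C f g" "\<beta> \<in> cells C g f" "\<beta>' \<in> cells C g f"
    and "\<beta> \<bullet> \<alpha> = id2 C f" "\<alpha> \<bullet> \<beta>' = id2 C g"
  shows "\<beta> = \<beta>'"
proof -
  have "\<beta> = \<beta> \<bullet> (\<alpha> \<bullet> \<beta>')" using assms vcomp_id_right by simp
  also have "\<dots> = (\<beta> \<bullet> \<alpha>) \<bullet> \<beta>'" using vcomp_assoc[OF assms(3,1,2)] by simp
  also have "\<dots> = \<beta>'" using assms vcomp_id_left by simp
  finally show ?thesis .
qed

lemma icellsI:
  assumes "\<alpha> \<in> cells C f g" "\<beta> \<in> cells C g f" "\<beta> \<bullet> \<alpha> = id2 C f" "\<alpha> \<bullet> \<beta> = id2 C g"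
  shows "\<alpha> \<in> icells C f g" and "inv2 C \<alpha> = \<beta>"
proof -
  have inv: "inverse2 C \<alpha> \<beta>" using inverse2_iff[OF assms(1)] assms(2-4) by blast
  then show "\<alpha> \<in> icells C f g" using assms by (auto simp: icells_def invertible2_def)
  show "inv2 C \<alpha> = \<beta>"
    unfolding inv2_def
  proof (rule the_equality)
    show "inverse2 C \<alpha> \<beta>" by (rule inv)
  next
    fix \<gamma> assume "inverse2 C \<alpha> \<gamma>"
    then show "\<gamma> = \<beta>"
      using assms left_right_inverse[of \<alpha> f g \<gamma> \<beta>] inverse2_iff[OF assms(1)] by blast
  qed
qed

lemma icells_cells: "\<alpha> \<in> icells C f g \<Longrightarrow> \<alpha> \<in> cells C f g"
  by (simp add: icells_def)

lemma icells_inv2: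
  assumes "\<alpha> \<in> icells C f g"
  shows "inv2 C \<alpha> \<in> icells C g f" "inv2 C \<alpha> \<bullet> \<alpha> = id2 C f" "\<alpha> \<bullet> inv2 C \<alpha> = id2 C g"
    "inv2 C (inv2 C \<alpha>) = \<alpha>"
proof -
  have a: "\<alpha> \<in> cells C f g" using assms by (rule icells_cells)
  obtain \<beta> where b: "\<beta> \<in> cells C g f" "\<beta> \<bullet> \<alpha> = id2 C f" "\<alpha> \<bullet> \<beta> = id2 C g"
    using assms inverse2_iff[OF a] by (auto simp: icells_def invertible2_def)
  then have eq: "inv2 C \<alpha> = \<beta>" by (rule icellsI(2)[OF a])
  then show "inv2 C \<alpha> \<in> icells C g f" "inv2 C (inv2 C \<alpha>) = \<alpha>"
    using icellsI[OF b(1) a b(3) b(2)] by simp_all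
  show "inv2 C \<alpha> \<bullet> \<alpha> = id2 C f" "\<alpha> \<bullet> inv2 C \<alpha> = id2 C g"
    using eq b by simp_all
qed

lemma inv2_cells: "\<alpha> \<in> icells C f g \<Longrightarrow> inv2 C \<alpha> \<in> cells C g f"
  by (rule icells_cells[OF icells_inv2(1)])

lemma vcomp_inv2_left:
  assumes "\<alpha> \<in> icells C f g" "\<beta> \<in> cells C h f"
  shows "inv2 C \<alpha> \<bullet> (\<alpha> \<bullet> \<beta>) = \<beta>"
  using vcomp_assoc[OF assms(2) icells_cells[OF assms(1)] inv2_cells[OF assms(1)]]
  unfolding icells_inv2(2)[OF assms(1)] vcomp_id_left[OF assms(2)] by (rule sym)

lemma vcomp_inv2_left':
  assumes "\<alpha> \<in> icells C f g" "\<beta> \<in> cells C h g"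
  shows "\<alpha> \<bullet> (inv2 C \<alpha> \<bullet> \<beta>) = \<beta>"
  using vcomp_inv2_left[OF icells_inv2(1)[OF assms(1)] assms(2)] icells_inv2(4)[OF assms(1)] by simp

lemma vcomp_inv2_right:
  assumes "\<alpha> \<in> icells C f g" "\<beta> \<in> cells C g h"
  shows "(\<beta> \<bullet> \<alpha>) \<bullet> inv2 C \<alpha> = \<beta>"
  using vcomp_assoc[OF inv2_cells[OF assms(1)] icells_cells[OF assms(1)] assms(2)]
  unfolding icells_inv2(3)[OF assms(1)] vcomp_id_right[OF assms(2)] .

lemma vcomp_inv2_right':
  assumes "\<alpha> \<in> icells C f g" "\<beta> \<in> cells C f h"
  shows "(\<beta> \<bullet> inv2 C \<alpha>) \<bullet> \<alpha> = \<beta>"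
  using vcomp_inv2_right[OF icells_inv2(1)[OF assms(1)] assms(2)] icells_inv2(4)[OF assms(1)] by simp

lemma vcomp_cancel_right:
  assumes "\<alpha> \<in> icells C f g" "\<beta> \<in> cells C g h" "\<gamma> \<in> cells C g h" "\<beta> \<bullet> \<alpha> = \<gamma> \<bullet> \<alpha>"
  shows "\<beta> = \<gamma>"
  using vcomp_inv2_right[OF assms(1,2)] vcomp_inv2_right[OF assms(1,3)] assms(4) by metis

lemma vcomp_cancel_left:
  assumes "\<alpha> \<in> icells C g h" "\<beta> \<in> cells C f g" "\<gamma> \<in> cells C f g" "\<alpha> \<bullet> \<beta> = \<alpha> \<bullet> \<gamma>"
  shows "\<beta> = \<gamma>"
  using vcomp_inv2_left[OF assms(1,2)] vcomp_inv2_left[OF assms(1,3)] assms(4) by metis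

lemma id2_icells: "f \<in> Mor C \<Longrightarrow> id2 C f \<in> icells C f f"
  by (rule icellsI(1)[OF id2_cells id2_cells]) (auto intro: vcomp_id_left[OF id2_cells])

lemma vcomp_icells:
  assumes "\<alpha> \<in> icells C f g" "\<beta> \<in> icells C g h"
  shows "\<beta> \<bullet> \<alpha> \<in> icells C f h"
proof (rule icellsI(1))
  note a = icells_cells[OF assms(1)] and b = icells_cells[OF assms(2)]
  note a' = inv2_cells[OF assms(1)] and b' = inv2_cells[OF assms(2)]
  show "\<beta> \<bullet> \<alpha> \<in> cells C f h" "inv2 C \<alpha> \<bullet> inv2 C \<beta> \<in> cells C h f"
    by (rule vcomp_cells[OF a b], rule vcomp_cells[OF b' a'])
  show "(inv2 C \<alpha> \<bullet> inv2 C \<beta>) \<bullet> (\<beta> \<bullet> \<alpha>) = id2 C f"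
    using vcomp_assoc[OF vcomp_cells[OF a b] b' a'] vcomp_inv2_left[OF assms(2) a] icells_inv2(2)[OF assms(1)]
    by simp
  show "(\<beta> \<bullet> \<alpha>) \<bullet> (inv2 C \<alpha> \<bullet> inv2 C \<beta>) = id2 C h"
    using vcomp_assoc[OF vcomp_cells[OF b' a'] a b] vcomp_inv2_left'[OF assms(1) b'] icells_inv2(3)[OF assms(2)]
    by simp
qed

lemma lwhisker_cells:
  "\<sigma> \<in> cells C x y \<Longrightarrow> x \<in> hom C X A \<Longrightarrow> g \<in> hom C A B \<Longrightarrow> g \<triangleright> \<sigma> \<in> cells C (g \<odot> x) (g \<odot> y)"
  unfolding lwhisker_def by (rule hcomp_cells) (auto simp: hom_def intro: id2_cells)

lemma rwhisker_cells:
  "\<sigma> \<in> cells C x y \<Longrightarrow> x \<in> hom C X A \<Longrightarrow> z \<in> hom C Z X \<Longrightarrow> \<sigma> \<triangleleft> z \<in> cells C (x \<odot> z) (y \<odot> z)"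
  unfolding rwhisker_def by (rule hcomp_cells) (auto simp: hom_def intro: id2_cells)

lemma lwhisker_id: "x \<in> hom C X A \<Longrightarrow> g \<in> hom C A B \<Longrightarrow> g \<triangleright> id2 C x = id2 C (g \<odot> x)"
  unfolding lwhisker_def by (rule hcomp_id)

lemma rwhisker_id: "x \<in> hom C X A \<Longrightarrow> z \<in> hom C Z X \<Longrightarrow> id2 C x \<triangleleft> z = id2 C (x \<odot> z)"
  unfolding rwhisker_def by (rule hcomp_id)

lemma lwhisker_vcomp:
  assumes "\<sigma> \<in> cells C x y" "\<tau> \<in> cells C y k" "x \<in> hom C X A" "g \<in> hom C A B"
  shows "g \<triangleright> (\<tau> \<bullet> \<sigma>) = (g \<triangleright> \<tau>) \<bullet> (g \<triangleright> \<sigma>)"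
proof -
  have g: "id2 C g \<in> cells C g g" using assms id2_cells by (simp add: hom_def)
  show ?thesis unfolding lwhisker_def
    using interchange[OF assms(1,2) g g] vcomp_id_left[OF g] assms by (simp add: hom_def)
qed

lemma rwhisker_vcomp:
  assumes "\<sigma> \<in> cells C x y" "\<tau> \<in> cells C y k" "x \<in> hom C X A" "z \<in> hom C Z X"
  shows "(\<tau> \<bullet> \<sigma>) \<triangleleft> z = (\<tau> \<triangleleft> z) \<bullet> (\<sigma> \<triangleleft> z)"
proof -
  have z: "id2 C z \<in> cells C z z" using assms id2_cells by (simp add: hom_def)
  show ?thesis unfolding rwhisker_def
    using interchange[OF z z assms(1,2)] vcomp_id_left[OF z] assms by (simp add: hom_def)
qed

text \<open>Both sides equal the horizontal composite \<open>\<sigma> \<star> \<mu>\<close>, by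
  interchange with identities inserted in the two possible orders.\<close>

lemma whisker_exchange:
  assumes "\<sigma> \<in> cells C x y" "\<mu> \<in> cells C z z'" "x \<in> hom C X A" "z \<in> hom C Z X"
  shows "(\<sigma> \<triangleleft> z') \<bullet> (x \<triangleright> \<mu>) = (y \<triangleright> \<mu>) \<bullet> (\<sigma> \<triangleleft> z)"
proof -
  have i: "id2 C x \<in> cells C x x" "id2 C y \<in> cells C y y" "id2 C z \<in> cells C z z"
    "id2 C z' \<in> cells C z' z'"
    using id2_cells cells_Mor[OF assms(1)] cells_Mor[OF assms(2)] by auto
  have t: "tgt C z = src C x" using assms by (simp add: hom_def)
  show ?thesis unfolding rwhisker_def lwhisker_def
    using interchange[OF assms(2) i(4) i(1) assms(1) t] interchange[OF i(3) assms(2) assms(1) i(2) t]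
      vcomp_id_left[OF assms(1)] vcomp_id_right[OF assms(1)]
      vcomp_id_left[OF assms(2)] vcomp_id_right[OF assms(2)] by simp
qed

lemma lwhisker_icells:
  assumes "\<sigma> \<in> icells C x y" "x \<in> hom C X A" "g \<in> hom C A B"
  shows "g \<triangleright> \<sigma> \<in> icells C (g \<odot> x) (g \<odot> y)" "inv2 C (g \<triangleright> \<sigma>) = g \<triangleright> inv2 C \<sigma>"
proof -
  note s = icells_cells[OF assms(1)] and s' = inv2_cells[OF assms(1)]
  have y: "y \<in> hom C X A" using cells_hom[OF s] assms by simp
  note * = lwhisker_cells[OF s assms(2,3)] lwhisker_cells[OF s' y assms(3)]
    lwhisker_vcomp[OF s s' assms(2,3), symmetric, unfolded icells_inv2(2)[OF assms(1)] lwhisker_id[OF assms(2,3)]]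
    lwhisker_vcomp[OF s' s y assms(3), symmetric, unfolded icells_inv2(3)[OF assms(1)] lwhisker_id[OF y assms(3)]]
  show "g \<triangleright> \<sigma> \<in> icells C (g \<odot> x) (g \<odot> y)" "inv2 C (g \<triangleright> \<sigma>) = g \<triangleright> inv2 C \<sigma>"
    using icellsI[OF *] by auto
qed

lemma rwhisker_icells:
  assumes "\<sigma> \<in> icells C x y" "x \<in> hom C X A" "z \<in> hom C Z X"
  shows "\<sigma> \<triangleleft> z \<in> icells C (x \<odot> z) (y \<odot> z)"
proof -
  note s = icells_cells[OF assms(1)] and s' = inv2_cells[OF assms(1)]
  have y: "y \<in> hom C X A" using cells_hom[OF s] assms by simp
  note * = rwhisker_cells[OF s assms(2,3)] rwhisker_cells[OF s' y assms(3)]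
    rwhisker_vcomp[OF s s' assms(2,3), symmetric, unfolded icells_inv2(2)[OF assms(1)] rwhisker_id[OF assms(2,3)]]
    rwhisker_vcomp[OF s' s y assms(3), symmetric, unfolded icells_inv2(3)[OF assms(1)] rwhisker_id[OF y assms(3)]]
  show ?thesis using icellsI(1)[OF *] .
qed

text \<open>Naturality of the associator with identities in all arguments but one. The three cases,
  for the last, the middle and the first argument of \<open>assoc\<close>, are kept apart because
  each serves a different whiskering.\<close>

lemma assoc_lwhisker:
  assumes "x \<in> hom C X A" "g \<in> hom C A B" "z \<in> hom C Z X" "\<mu> \<in> cells C z z'"
  shows "assoc C g x z' \<bullet> ((g \<odot> x) \<triangleright> \<mu>) = (g \<triangleright> (x \<triangleright> \<mu>)) \<bullet> assoc C g x z"
proof -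
  have "id2 C g \<in> cells C g g" "id2 C x \<in> cells C x x"
    using assms id2_cells by (auto simp: hom_def)
  then show ?thesis
    unfolding lwhisker_def using assoc_natural[OF assms(4), of "id2 C x" x x "id2 C g" g g]
      hcomp_id[OF assms(1,2)] assms(1-3) by (simp add: hom_def)
qed

lemma assoc_mid:
  assumes "x \<in> hom C X A" "g \<in> hom C A B" "z \<in> hom C Z X" "\<sigma> \<in> cells C x x'"
  shows "assoc C g x' z \<bullet> ((g \<triangleright> \<sigma>) \<triangleleft> z) = (g \<triangleright> (\<sigma> \<triangleleft> z)) \<bullet> assoc C g x z"
proof -
  have "id2 C g \<in> cells C g g" "id2 C z \<in> cells C z z"
    using assms id2_cells by (auto simp: hom_def)
  then show ?thesis
    unfolding lwhisker_def rwhisker_def 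
    using assoc_natural[OF _ assms(4), of "id2 C z" z z "id2 C g" g g] assms(1-3)
    by (simp add: hom_def)
qed

lemma assoc_rwhisker:
  assumes "z \<in> hom C Z X" "b \<in> hom C Y Z" "x \<in> hom C X A" "\<sigma> \<in> cells C x x'"
  shows "assoc C x' z b \<bullet> ((\<sigma> \<triangleleft> z) \<triangleleft> b) = (\<sigma> \<triangleleft> (z \<odot> b)) \<bullet> assoc C x z b"
proof -
  have "id2 C z \<in> cells C z z" "id2 C b \<in> cells C b b"
    using assms id2_cells by (auto simp: hom_def)
  then show ?thesis
    unfolding rwhisker_def 
    using assoc_natural[OF _ _ assms(4), of "id2 C b" b b "id2 C z" z z] hcomp_id[OF assms(2,1)] assms(1-3)
    by (simp add: hom_def)
qed

section \<open>Whiskering of cells with the associators inserted\<close>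

lemma awhisker_assoc:
  assumes "x1 \<in> hom C X A1" "g1 \<in> hom C A1 B" "x2 \<in> hom C X A2" "g2 \<in> hom C A2 B"
    and "\<theta> \<in> cells C (g1 \<odot> x1) (g2 \<odot> x2)" "z \<in> hom C Z X"
  shows "awhisker C g1 x1 g2 x2 \<theta> z \<in> cells C (g1 \<odot> (x1 \<odot> z)) (g2 \<odot> (x2 \<odot> z))"
    and "awhisker C g1 x1 g2 x2 \<theta> z \<bullet> assoc C g1 x1 z = assoc C g2 x2 z \<bullet> (\<theta> \<triangleleft> z)"
proof -
  note a1 = assoc_icells[OF assms(6,1,2)] and a2 = assoc_icells[OF assms(6,3,4)]
  note t = rwhisker_cells[OF assms(5) comp1_hom[OF assms(1,2)] assms(6)]
  note m = vcomp_cells[OF inv2_cells[OF a1] t]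
  show "awhisker C g1 x1 g2 x2 \<theta> z \<in> cells C (g1 \<odot> (x1 \<odot> z)) (g2 \<odot> (x2 \<odot> z))"
    unfolding awhisker_def using vcomp_cells[OF m icells_cells[OF a2]] .
  show "awhisker C g1 x1 g2 x2 \<theta> z \<bullet> assoc C g1 x1 z = assoc C g2 x2 z \<bullet> (\<theta> \<triangleleft> z)"
    unfolding awhisker_def using vcomp_assoc[OF icells_cells[OF a1] m icells_cells[OF a2]]
      vcomp_inv2_right'[OF a1 t] by simp
qed

text \<open>Since the associator is invertible, the second fact of \<open>awhisker_assoc\<close>
  characterises \<open>awhisker\<close>. Identities can thus be checked on this equation, without
  meeting the inverse associator of the definition.\<close>

lemma awhisker_eqI:
  assumes "x1 \<in> hom C X A1" "g1 \<in> hom C A1 B" "x2 \<in> hom C X A2" "g2 \<in> hom C A2 B"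
    and "\<theta> \<in> cells C (g1 \<odot> x1) (g2 \<odot> x2)" "z \<in> hom C Z X"
    and "\<phi> \<in> cells C (g1 \<odot> (x1 \<odot> z)) (g2 \<odot> (x2 \<odot> z))"
    and "\<phi> \<bullet> assoc C g1 x1 z = assoc C g2 x2 z \<bullet> (\<theta> \<triangleleft> z)"
  shows "awhisker C g1 x1 g2 x2 \<theta> z = \<phi>"
  using vcomp_cancel_right[OF assoc_icells[OF assms(6,1,2)]] awhisker_assoc[OF assms(1-6)] assms(7,8)
  by metis

text \<open>This is \<open>whisker_exchange\<close> for \<theta> and \<mu>, carried to the
  right-bracketed form by naturality of the associator in its last argument.\<close>

lemma awhisker_natural:
  assumes "x1 \<in> hom C X A1" "g1 \<in> hom C A1 B" "x2 \<in> hom C X A2" "g2 \<in> hom C A2 B"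
    and "\<theta> \<in> cells C (g1 \<odot> x1) (g2 \<odot> x2)" "z \<in> hom C Z X" "\<mu> \<in> cells C z z'"
  shows "awhisker C g1 x1 g2 x2 \<theta> z' \<bullet> (g1 \<triangleright> (x1 \<triangleright> \<mu>)) =
    (g2 \<triangleright> (x2 \<triangleright> \<mu>)) \<bullet> awhisker C g1 x1 g2 x2 \<theta> z"
proof -
  have z': "z' \<in> hom C Z X" using cells_hom[OF assms(7)] assms(6) by simp
  note gx1 = comp1_hom[OF assms(1,2)] and gx2 = comp1_hom[OF assms(3,4)]
  note w = awhisker_assoc[OF assms(1-6)] and w' = awhisker_assoc[OF assms(1-5) z']
  note a1 = icells_cells[OF assoc_icells[OF assms(6,1,2)]]
    and a1' = icells_cells[OF assoc_icells[OF z' assms(1,2)]]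
    and a2 = icells_cells[OF assoc_icells[OF assms(6,3,4)]]
    and a2' = icells_cells[OF assoc_icells[OF z' assms(3,4)]]
  note l1 = lwhisker_cells[OF lwhisker_cells[OF assms(7,6,1)] comp1_hom[OF assms(6,1)] assms(2)]
  note l2 = lwhisker_cells[OF lwhisker_cells[OF assms(7,6,3)] comp1_hom[OF assms(6,3)] assms(4)]
  note m1 = lwhisker_cells[OF assms(7,6) gx1] and m2 = lwhisker_cells[OF assms(7,6) gx2]
  note t = rwhisker_cells[OF assms(5) gx1 assms(6)] and t' = rwhisker_cells[OF assms(5) gx1 z']
  let ?w = "awhisker C g1 x1 g2 x2 \<theta> z" and ?w' = "awhisker C g1 x1 g2 x2 \<theta> z'"
  have "(?w' \<bullet> (g1 \<triangleright> (x1 \<triangleright> \<mu>))) \<bullet> assoc C g1 x1 z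
      = ?w' \<bullet> (assoc C g1 x1 z' \<bullet> ((g1 \<odot> x1) \<triangleright> \<mu>))"
    using vcomp_assoc[OF a1 l1 w'(1)] assoc_lwhisker[OF assms(1,2,6,7)] by simp
  also have "\<dots> = assoc C g2 x2 z' \<bullet> ((\<theta> \<triangleleft> z') \<bullet> ((g1 \<odot> x1) \<triangleright> \<mu>))"
    using vcomp_assoc[OF m1 a1' w'(1)] vcomp_assoc[OF m1 t' a2'] w'(2) by simp
  also have "\<dots> = (assoc C g2 x2 z' \<bullet> ((g2 \<odot> x2) \<triangleright> \<mu>)) \<bullet> (\<theta> \<triangleleft> z)"
    using vcomp_assoc[OF t m2 a2'] whisker_exchange[OF assms(5,7) gx1 assms(6)] by simp
  also have "\<dots> = ((g2 \<triangleright> (x2 \<triangleright> \<mu>)) \<bullet> ?w) \<bullet> assoc C g1 x1 z"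
    using vcomp_assoc[OF t a2 l2] vcomp_assoc[OF a1 w(1) l2] assoc_lwhisker[OF assms(3,4,6,7)] w(2) by simp
  finally show ?thesis
    by (rule vcomp_cancel_right[OF assoc_icells[OF assms(6,1,2)] vcomp_cells[OF l1 w'(1)] vcomp_cells[OF w(1) l2]])
qed

text \<open>Functoriality in the cell: both factors carry the associator of the common middle term,
  once inverted and once not, and these cancel.\<close>

lemma awhisker_vcomp:
  assumes "x1 \<in> hom C X A1" "g1 \<in> hom C A1 B" "x2 \<in> hom C X A2" "g2 \<in> hom C A2 B"
    and "x3 \<in> hom C X A3" "g3 \<in> hom C A3 B" "z \<in> hom C Z X"
    and "\<theta> \<in> cells C (g1 \<odot> x1) (g2 \<odot> x2)" "\<theta>' \<in> cells C (g2 \<odot> x2) (g3 \<odot> x3)"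
  shows "awhisker C g1 x1 g3 x3 (\<theta>' \<bullet> \<theta>) z =
    awhisker C g2 x2 g3 x3 \<theta>' z \<bullet> awhisker C g1 x1 g2 x2 \<theta> z"
proof (rule awhisker_eqI[OF assms(1,2,5,6) vcomp_cells[OF assms(8,9)] assms(7)])
  note w = awhisker_assoc[OF assms(1-4,8,7)] and w' = awhisker_assoc[OF assms(3-6,9,7)]
  note gx1 = comp1_hom[OF assms(1,2)] and gx2 = comp1_hom[OF assms(3,4)]
  note a1 = icells_cells[OF assoc_icells[OF assms(7,1,2)]]
    and a2 = icells_cells[OF assoc_icells[OF assms(7,3,4)]]
    and a3 = icells_cells[OF assoc_icells[OF assms(7,5,6)]]
  note t = rwhisker_cells[OF assms(8) gx1 assms(7)] and t' = rwhisker_cells[OF assms(9) gx2 assms(7)]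
  show "awhisker C g2 x2 g3 x3 \<theta>' z \<bullet> awhisker C g1 x1 g2 x2 \<theta> z \<in>
      cells C (g1 \<odot> (x1 \<odot> z)) (g3 \<odot> (x3 \<odot> z))"
    using vcomp_cells[OF w(1) w'(1)] .
  show "awhisker C g2 x2 g3 x3 \<theta>' z \<bullet> awhisker C g1 x1 g2 x2 \<theta> z \<bullet> assoc C g1 x1 z =
      assoc C g3 x3 z \<bullet> ((\<theta>' \<bullet> \<theta>) \<triangleleft> z)"
    using vcomp_assoc[OF a1 w(1) w'(1)] w(2) vcomp_assoc[OF t a2 w'(1)] w'(2) vcomp_assoc[OF t t' a3]
      rwhisker_vcomp[OF assms(8,9) gx1 assms(7)] by simp
qed

text \<open>Naturality of the associator in its middle argument. It shows that restriction acts on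
  cells between legs by plain whiskering, under the 1-morphism \<open>g\<close>.\<close>

lemma awhisker_lwhisker:
  assumes "x \<in> hom C X A" "g \<in> hom C A B" "\<sigma> \<in> cells C x y" "z \<in> hom C Z X"
  shows "awhisker C g x g y (g \<triangleright> \<sigma>) z = g \<triangleright> (\<sigma> \<triangleleft> z)"
proof -
  have y: "y \<in> hom C X A" using cells_hom[OF assms(3)] assms(1) by simp
  show ?thesis
    using awhisker_eqI[OF assms(1,2) y assms(2) lwhisker_cells[OF assms(3,1,2)] assms(4)
        lwhisker_cells[OF rwhisker_cells[OF assms(3,1,4)] comp1_hom[OF assms(4,1)] assms(2)]]
      assoc_mid[OF assms(1,2,4,3)] by simp
qed

lemma awhisker_id:
  assumes "x \<in> hom C X A" "g \<in> hom C A B" "z \<in> hom C Z X"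
  shows "awhisker C g x g x (id2 C (g \<odot> x)) z = id2 C (g \<odot> (x \<odot> z))"
  using awhisker_lwhisker[OF assms(1,2) id2_cells assms(3)] assms
    lwhisker_id[OF assms(1,2)] rwhisker_id[OF assms(1,3)] lwhisker_id[OF comp1_hom[OF assms(3,1)] assms(2)]
  by (simp add: hom_def)

text \<open>Whiskering by \<open>z\<close> and then by \<open>b\<close> agrees with whiskering by
  \<open>z \<odot> b\<close> up to the associators of the legs, by one pentagon on each side of
  \<theta>. This is the coherence behind iterated restriction of data.\<close>

lemma awhisker_comp1:
  assumes "x1 \<in> hom C X A1" "g1 \<in> hom C A1 B" "x2 \<in> hom C X A2" "g2 \<in> hom C A2 B"
    and "\<theta> \<in> cells C (g1 \<odot> x1) (g2 \<odot> x2)" "z \<in> hom C Z X" "b \<in> hom C Y Z"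
  shows "awhisker C g1 x1 g2 x2 \<theta> (z \<odot> b) \<bullet> (g1 \<triangleright> assoc C x1 z b) =
    (g2 \<triangleright> assoc C x2 z b) \<bullet>
      awhisker C g1 (x1 \<odot> z) g2 (x2 \<odot> z) (awhisker C g1 x1 g2 x2 \<theta> z) b"
proof -
  note zb = comp1_hom[OF assms(7,6)] and xz1 = comp1_hom[OF assms(6,1)] and xz2 = comp1_hom[OF assms(6,3)]
    and gx1 = comp1_hom[OF assms(1,2)] and gx2 = comp1_hom[OF assms(3,4)]
  note w = awhisker_assoc[OF assms(1-6)] and w' = awhisker_assoc[OF assms(1-5) zb]
  note w'' = awhisker_assoc[OF xz1 assms(2) xz2 assms(4) w(1) assms(7)]
  let ?w = "awhisker C g1 x1 g2 x2 \<theta> z" and ?w' = "awhisker C g1 x1 g2 x2 \<theta> (z \<odot> b)"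
  let ?w'' = "awhisker C g1 (x1 \<odot> z) g2 (x2 \<odot> z) ?w b"
  let ?p1 = "g1 \<triangleright> assoc C x1 z b" and ?p2 = "g2 \<triangleright> assoc C x2 z b"
  let ?q1 = "assoc C g1 (x1 \<odot> z) b" and ?q2 = "assoc C g2 (x2 \<odot> z) b"
  let ?r1 = "assoc C g1 x1 z \<triangleleft> b" and ?r2 = "assoc C g2 x2 z \<triangleleft> b"
  let ?s1 = "assoc C g1 x1 (z \<odot> b)" and ?s2 = "assoc C g2 x2 (z \<odot> b)"
  let ?t1 = "assoc C (g1 \<odot> x1) z b" and ?t2 = "assoc C (g2 \<odot> x2) z b"
  note p1 = icells_cells[OF lwhisker_icells(1)[OF assoc_icells[OF assms(7,6,1)] comp1_hom[OF assms(7) xz1] assms(2)]]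
    and p2 = icells_cells[OF lwhisker_icells(1)[OF assoc_icells[OF assms(7,6,3)] comp1_hom[OF assms(7) xz2] assms(4)]]
  note q1i = assoc_icells[OF assms(7) xz1 assms(2)]
  note q1 = icells_cells[OF q1i]
    and q2 = icells_cells[OF assoc_icells[OF assms(7) xz2 assms(4)]]
  note r1i = rwhisker_icells[OF assoc_icells[OF assms(6,1,2)] comp1_hom[OF assms(6) gx1] assms(7)]
  note r1 = icells_cells[OF r1i]
    and r2 = icells_cells[OF rwhisker_icells[OF assoc_icells[OF assms(6,3,4)] comp1_hom[OF assms(6) gx2] assms(7)]]
  note s1 = icells_cells[OF assoc_icells[OF zb assms(1,2)]]
    and s2 = icells_cells[OF assoc_icells[OF zb assms(3,4)]]
  note t1 = icells_cells[OF assoc_icells[OF assms(7,6) gx1]]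
    and t2 = icells_cells[OF assoc_icells[OF assms(7,6) gx2]]
  note e = rwhisker_cells[OF assms(5) gx1 zb]
  note f = rwhisker_cells[OF rwhisker_cells[OF assms(5) gx1 assms(6)] comp1_hom[OF assms(6) gx1] assms(7)]
  note h = rwhisker_cells[OF w(1) comp1_hom[OF xz1 assms(2)] assms(7)]
  \<comment> \<open>The equation of \<open>awhisker_assoc\<close> for \<open>z\<close>, whiskered by
    \<open>b\<close>.\<close>
  have r_eq: "(?w \<triangleleft> b) \<bullet> ?r1 = ?r2 \<bullet> ((\<theta> \<triangleleft> z) \<triangleleft> b)"
    using rwhisker_vcomp[OF icells_cells[OF assoc_icells[OF assms(6,1,2)]] w(1) comp1_hom[OF assms(6) gx1] assms(7)]
      rwhisker_vcomp[OF rwhisker_cells[OF assms(5) gx1 assms(6)] icells_cells[OF assoc_icells[OF assms(6,3,4)]]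
        comp1_hom[OF assms(6) gx1] assms(7)] w(2) by simp
  \<comment> \<open>Composing with the invertible cell \<open>?q1 \<bullet> ?r1\<close> completes
    \<open>?p1\<close> to one side of the pentagon. The other side,
    \<open>?s1 \<bullet> ?t1\<close>, can be moved past \<theta> by naturality.\<close>
  have "(?w' \<bullet> ?p1) \<bullet> (?q1 \<bullet> ?r1) = ?w' \<bullet> (?s1 \<bullet> ?t1)"
    using vcomp_assoc[OF vcomp_cells[OF r1 q1] p1 w'(1)] pentagon[OF assms(7,6,1,2)] by simp
  also have "\<dots> = ?s2 \<bullet> ((\<theta> \<triangleleft> (z \<odot> b)) \<bullet> ?t1)"
    using vcomp_assoc[OF t1 s1 w'(1)] vcomp_assoc[OF t1 e s2] w'(2) by simp
  also have "\<dots> = (?s2 \<bullet> ?t2) \<bullet> ((\<theta> \<triangleleft> z) \<triangleleft> b)"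
    using vcomp_assoc[OF f t2 s2] assoc_rwhisker[OF assms(6,7) gx1 assms(5)] by simp
  also have "\<dots> = ?p2 \<bullet> (?q2 \<bullet> (?r2 \<bullet> ((\<theta> \<triangleleft> z) \<triangleleft> b)))"
    using vcomp_assoc[OF f vcomp_cells[OF r2 q2] p2] vcomp_assoc[OF f r2 q2] pentagon[OF assms(7,6,3,4)] by simp
  also have "\<dots> = ?p2 \<bullet> ((?q2 \<bullet> (?w \<triangleleft> b)) \<bullet> ?r1)"
    using vcomp_assoc[OF r1 h q2] r_eq by simp
  also have "\<dots> = (?p2 \<bullet> ?w'') \<bullet> (?q1 \<bullet> ?r1)"
    using vcomp_assoc[OF r1 q1 w''(1)] vcomp_assoc[OF vcomp_cells[OF r1 q1] w''(1) p2] w''(2) by simp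
  finally show ?thesis
    by (rule vcomp_cancel_right[OF vcomp_icells[OF r1i q1i] vcomp_cells[OF p1 w'(1)] vcomp_cells[OF w''(1) p2]])
qed

subsection \<open>Data up to isomorphism\<close>

text \<open>The pair \<open>(\<tau>1, \<tau>2)\<close> is a morphism from \<theta> to \<theta>' in
  the comma category of the functors \<open>g1 \<odot> _\<close> and \<open>g2 \<odot> _\<close> on
  1-morphisms out of a fixed object. The same lemmas then serve \<alpha>, with
  \<open>(w1, w2)\<close>, and \<beta>, with \<open>(f1, f2)\<close>.\<close>

definition square :: "'m \<Rightarrow> 'm \<Rightarrow> 't \<Rightarrow> 't \<Rightarrow> 't \<Rightarrow> 't \<Rightarrow> bool" where
  "square g1 g2 \<tau>1 \<tau>2 \<theta> \<theta>' \<longleftrightarrow> \<theta>' \<bullet> (g1 \<triangleright> \<tau>1) = (g2 \<triangleright> \<tau>2) \<bullet> \<theta>"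

lemma square_id:
  assumes "x1 \<in> hom C X A1" "g1 \<in> hom C A1 B" "x2 \<in> hom C X A2" "g2 \<in> hom C A2 B"
    and "\<theta> \<in> cells C (g1 \<odot> x1) (g2 \<odot> x2)"
  shows "square g1 g2 (id2 C x1) (id2 C x2) \<theta> \<theta>"
  unfolding square_def lwhisker_id[OF assms(1,2)] lwhisker_id[OF assms(3,4)]
  using vcomp_id_left[OF assms(5)] vcomp_id_right[OF assms(5)] by simp

lemma square_comp:
  assumes "x1 \<in> hom C X A1" "g1 \<in> hom C A1 B" "x2 \<in> hom C X A2" "g2 \<in> hom C A2 B"
    and "\<tau>1 \<in> cells C x1 y1" "\<tau>2 \<in> cells C x2 y2" "\<tau>1' \<in> cells C y1 k1" "\<tau>2' \<in> cells C y2 k2"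
    and "\<theta> \<in> cells C (g1 \<odot> x1) (g2 \<odot> x2)" "\<theta>' \<in> cells C (g1 \<odot> y1) (g2 \<odot> y2)"
    and "\<theta>'' \<in> cells C (g1 \<odot> k1) (g2 \<odot> k2)"
    and "square g1 g2 \<tau>1 \<tau>2 \<theta> \<theta>'" "square g1 g2 \<tau>1' \<tau>2' \<theta>' \<theta>''"
  shows "square g1 g2 (\<tau>1' \<bullet> \<tau>1) (\<tau>2' \<bullet> \<tau>2) \<theta> \<theta>''"
proof -
  have y1: "y1 \<in> hom C X A1" and y2: "y2 \<in> hom C X A2"
    using cells_hom[OF assms(5)] cells_hom[OF assms(6)] assms(1,3) by auto
  note t1 = lwhisker_cells[OF assms(5,1,2)] and t2 = lwhisker_cells[OF assms(6,3,4)]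
    and t1' = lwhisker_cells[OF assms(7) y1 assms(2)] and t2' = lwhisker_cells[OF assms(8) y2 assms(4)]
  show ?thesis
    using assms(12,13) unfolding square_def
      lwhisker_vcomp[OF assms(5,7,1,2)] lwhisker_vcomp[OF assms(6,8,3,4)]
    using vcomp_assoc[OF t1 t1' assms(11)] vcomp_assoc[OF t1 assms(10) t2'] vcomp_assoc[OF assms(9) t2 t2']
    by simp
qed

lemma square_inv:
  assumes "x1 \<in> hom C X A1" "g1 \<in> hom C A1 B" "x2 \<in> hom C X A2" "g2 \<in> hom C A2 B"
    and "\<tau>1 \<in> icells C x1 y1" "\<tau>2 \<in> icells C x2 y2"
    and "\<theta> \<in> cells C (g1 \<odot> x1) (g2 \<odot> x2)" "\<theta>' \<in> cells C (g1 \<odot> y1) (g2 \<odot> y2)"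
    and "square g1 g2 \<tau>1 \<tau>2 \<theta> \<theta>'"
  shows "square g1 g2 (inv2 C \<tau>1) (inv2 C \<tau>2) \<theta>' \<theta>"
proof -
  note l1 = lwhisker_icells[OF assms(5,1,2)] and l2 = lwhisker_icells[OF assms(6,3,4)]
  note i1 = inv2_cells[OF l1(1)] and i2 = inv2_cells[OF l2(1)]
  have "\<theta> \<bullet> inv2 C (g1 \<triangleright> \<tau>1) = (inv2 C (g2 \<triangleright> \<tau>2) \<bullet> ((g2 \<triangleright> \<tau>2) \<bullet> \<theta>)) \<bullet> inv2 C (g1 \<triangleright> \<tau>1)"
    using vcomp_inv2_left[OF l2(1) assms(7)] by simp
  also have "\<dots> = (inv2 C (g2 \<triangleright> \<tau>2) \<bullet> (\<theta>' \<bullet> (g1 \<triangleright> \<tau>1))) \<bullet> inv2 C (g1 \<triangleright> \<tau>1)"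
    using assms(9) by (simp add: square_def)
  also have "\<dots> = inv2 C (g2 \<triangleright> \<tau>2) \<bullet> ((\<theta>' \<bullet> (g1 \<triangleright> \<tau>1)) \<bullet> inv2 C (g1 \<triangleright> \<tau>1))"
    by (rule vcomp_assoc[OF i1 vcomp_cells[OF icells_cells[OF l1(1)] assms(8)] i2])
  also have "\<dots> = inv2 C (g2 \<triangleright> \<tau>2) \<bullet> \<theta>'"
    using vcomp_inv2_right[OF l1(1) assms(8)] by simp
  finally show ?thesis unfolding square_def l1(2) l2(2) .
qed

text \<open>\<open>awhisker\<close> is applied to both sides of the square: it respects vertical
  composition and turns \<open>g \<triangleright> \<tau>\<close> into
  \<open>g \<triangleright> (\<tau> \<triangleleft> z)\<close>.\<close>

lemma square_restrict:
  assumes "x1 \<in> hom C X A1" "g1 \<in> hom C A1 B" "x2 \<in> hom C X A2" "g2 \<in> hom C A2 B"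
    and "\<tau>1 \<in> cells C x1 y1" "\<tau>2 \<in> cells C x2 y2"
    and "\<theta> \<in> cells C (g1 \<odot> x1) (g2 \<odot> x2)" "\<theta>' \<in> cells C (g1 \<odot> y1) (g2 \<odot> y2)"
    and "square g1 g2 \<tau>1 \<tau>2 \<theta> \<theta>'" "z \<in> hom C Z X"
  shows "square g1 g2 (\<tau>1 \<triangleleft> z) (\<tau>2 \<triangleleft> z) (awhisker C g1 x1 g2 x2 \<theta> z) (awhisker C g1 y1 g2 y2 \<theta>' z)"
proof -
  have y1: "y1 \<in> hom C X A1" and y2: "y2 \<in> hom C X A2"
    using cells_hom[OF assms(5)] cells_hom[OF assms(6)] assms(1,3) by auto
  note l1 = lwhisker_cells[OF assms(5,1,2)] and l2 = lwhisker_cells[OF assms(6,3,4)]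
  show ?thesis
    using assms(9) unfolding square_def
      awhisker_lwhisker[OF assms(1,2,5,10), symmetric] awhisker_lwhisker[OF assms(3,4,6,10), symmetric]
      awhisker_vcomp[OF assms(1,2) y1 assms(2) y2 assms(4,10) l1 assms(8), symmetric]
      awhisker_vcomp[OF assms(1-4) y2 assms(4,10,7) l2, symmetric] by simp
qed

text \<open>Two squares are pasted along their common side
  \<open>g2 \<triangleright> \<tau>2\<close>.\<close>

lemma square_vcomp:
  assumes "x1 \<in> hom C X A1" "g1 \<in> hom C A1 B" "x2 \<in> hom C X A2" "g2 \<in> hom C A2 B"
    and "x3 \<in> hom C X A3" "g3 \<in> hom C A3 B"
    and "\<tau>1 \<in> cells C x1 y1" "\<tau>2 \<in> cells C x2 y2" "\<tau>3 \<in> cells C x3 y3"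
    and "\<theta> \<in> cells C (g1 \<odot> x1) (g2 \<odot> x2)" "\<theta>' \<in> cells C (g1 \<odot> y1) (g2 \<odot> y2)"
    and "\<phi> \<in> cells C (g2 \<odot> x2) (g3 \<odot> x3)" "\<phi>' \<in> cells C (g2 \<odot> y2) (g3 \<odot> y3)"
    and "square g1 g2 \<tau>1 \<tau>2 \<theta> \<theta>'" "square g2 g3 \<tau>2 \<tau>3 \<phi> \<phi>'"
  shows "square g1 g3 \<tau>1 \<tau>3 (\<phi> \<bullet> \<theta>) (\<phi>' \<bullet> \<theta>')"
proof -
  note t1 = lwhisker_cells[OF assms(7,1,2)] and t2 = lwhisker_cells[OF assms(8,3,4)]
    and t3 = lwhisker_cells[OF assms(9,5,6)]
  show ?thesis
    using assms(14,15) unfolding square_def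
    using vcomp_assoc[OF t1 assms(11,13)] vcomp_assoc[OF assms(10) t2 assms(13)] vcomp_assoc[OF assms(10,12) t3]
    by simp
qed

text \<open>This supplies the middle square when composites are compared: \<sigma> and \<sigma>' are
  then the cells that connect the two data.\<close>

lemma square_lwhisker:
  assumes "x \<in> hom C X A" "g \<in> hom C A B" "\<sigma> \<in> cells C x y" "\<tau> \<in> cells C x x'" "\<tau>' \<in> cells C y y'"
    and "\<sigma>' \<in> cells C x' y'" "\<sigma>' \<bullet> \<tau> = \<tau>' \<bullet> \<sigma>"
  shows "square g g \<tau> \<tau>' (g \<triangleright> \<sigma>) (g \<triangleright> \<sigma>')"
proof -
  have "x' \<in> hom C X A" using cells_hom[OF assms(4)] assms(1) by simp
  then show ?thesis unfolding square_def
    using lwhisker_vcomp[OF assms(4,6,1,2)] lwhisker_vcomp[OF assms(3,5,1,2)] assms(7) by simp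
qed

section \<open>Spans, data between them, and restriction\<close>

fun span :: "'o \<Rightarrow> 'o \<Rightarrow> ('o, 'm) fmor \<Rightarrow> bool" where
  "span A B (A', w, f) \<longleftrightarrow> w \<in> hom C A' A \<and> f \<in> hom C A' B"

text \<open>Data stripped of the condition on \<open>W\<close>. The calculus of restriction and
  isomorphism is thereby available in any bicategory; the denominators are treated separately, as a
  predicate.\<close>

fun pre_data :: "('o, 'm) fmor \<Rightarrow> ('o, 'm) fmor \<Rightarrow> ('o, 'm, 't) fdata set" where
  "pre_data (A1, w1, f1) (A2, w2, f2) = {(X, x, y, \<alpha>, \<beta>). x \<in> hom C X A1 \<and> y \<in> hom C X A2 \<and>
     \<alpha> \<in> icells C (w1 \<odot> x) (w2 \<odot> y) \<and> \<beta> \<in> cells C (f1 \<odot> x) (f2 \<odot> y)}"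

fun restr :: "('o, 'm) fmor \<Rightarrow> ('o, 'm) fmor \<Rightarrow> ('o, 'm, 't) fdata \<Rightarrow> 'm \<Rightarrow> ('o, 'm, 't) fdata" where
  "restr (A1, w1, f1) (A2, w2, f2) (X, x, y, \<alpha>, \<beta>) z =
     (src C z, x \<odot> z, y \<odot> z, awhisker C w1 x w2 y \<alpha> z, awhisker C f1 x f2 y \<beta> z)"

fun data_iso :: "('o, 'm) fmor \<Rightarrow> ('o, 'm) fmor \<Rightarrow> ('o, 'm, 't) fdata \<Rightarrow> ('o, 'm, 't) fdata \<Rightarrow> bool" where
  "data_iso (A1, w1, f1) (A2, w2, f2) (X, x, y, \<alpha>, \<beta>) (X', x', y', \<alpha>', \<beta>') \<longleftrightarrow>
     X = X' \<and> (\<exists>\<tau>1\<in>icells C x x'. \<exists>\<tau>2\<in>icells C y y'.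
       square w1 w2 \<tau>1 \<tau>2 \<alpha> \<alpha>' \<and> square f1 f2 \<tau>1 \<tau>2 \<beta> \<beta>')"

fun invertible_data :: "('o, 'm, 't) fdata \<Rightarrow> bool" where
  "invertible_data (X, x, y, \<alpha>, \<beta>) \<longleftrightarrow> invertible2 C \<beta>"

lemma restr_fst: "z \<in> hom C Z X \<Longrightarrow> fst (restr F G d z) = Z"
  by (cases F; cases G; cases d) (auto simp: hom_def)

lemma awhisker_icells:
  assumes "x1 \<in> hom C X A1" "g1 \<in> hom C A1 B" "x2 \<in> hom C X A2" "g2 \<in> hom C A2 B"
    and "\<theta> \<in> icells C (g1 \<odot> x1) (g2 \<odot> x2)" "z \<in> hom C Z X"
  shows "awhisker C g1 x1 g2 x2 \<theta> z \<in> icells C (g1 \<odot> (x1 \<odot> z)) (g2 \<odot> (x2 \<odot> z))"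
  unfolding awhisker_def
  by (rule vcomp_icells[OF vcomp_icells[OF icells_inv2(1)[OF assoc_icells[OF assms(6,1,2)]]
        rwhisker_icells[OF assms(5) comp1_hom[OF assms(1,2)] assms(6)]] assoc_icells[OF assms(6,3,4)]])

lemma restr_pre_data:
  assumes "span A B F" "span A B G" "d \<in> pre_data F G" "z \<in> hom C Z (fst d)"
  shows "restr F G d z \<in> pre_data F G"
proof -
  obtain A1 w1 f1 A2 w2 f2 X x y \<alpha> \<beta> where
    [simp]: "F = (A1, w1, f1)" "G = (A2, w2, f2)" "d = (X, x, y, \<alpha>, \<beta>)"
    by (cases F; cases G; cases d)
  have "src C z = Z" using assms(4) by (simp add: hom_def)
  then show ?thesis
    using assms awhisker_icells[of x X A1 w1 A y A2 w2 \<alpha> z Z] awhisker_assoc(1)[of x X A1 f1 B y A2 f2 \<beta> z Z]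
      comp1_hom[of z Z X] by simp
qed

lemma invertible_iff: "\<beta> \<in> cells C f g \<Longrightarrow> invertible2 C \<beta> \<longleftrightarrow> \<beta> \<in> icells C f g"
  by (simp add: icells_def)

lemma invertible_restr:
  assumes "span A B F" "span A B G" "d \<in> pre_data F G" "z \<in> hom C Z (fst d)" "invertible_data d"
  shows "invertible_data (restr F G d z)"
proof -
  obtain A1 w1 f1 A2 w2 f2 X x y \<alpha> \<beta> where
    [simp]: "F = (A1, w1, f1)" "G = (A2, w2, f2)" "d = (X, x, y, \<alpha>, \<beta>)"
    by (cases F; cases G; cases d)
  have "\<beta> \<in> icells C (f1 \<odot> x) (f2 \<odot> y)" using assms by (simp add: icells_def)
  then show ?thesis
    using assms awhisker_icells[of x X A1 f1 B y A2 f2 \<beta> z Z] by (simp add: icells_def)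
qed

lemma data_iso_refl:
  assumes "span A B F" "span A B G" "d \<in> pre_data F G"
  shows "data_iso F G d d"
proof -
  obtain A1 w1 f1 A2 w2 f2 X x y \<alpha> \<beta> where
    [simp]: "F = (A1, w1, f1)" "G = (A2, w2, f2)" "d = (X, x, y, \<alpha>, \<beta>)"
    by (cases F; cases G; cases d)
  have h: "w1 \<in> hom C A1 A" "w2 \<in> hom C A2 A" "f1 \<in> hom C A1 B" "f2 \<in> hom C A2 B"
      "x \<in> hom C X A1" "y \<in> hom C X A2" "\<alpha> \<in> cells C (w1 \<odot> x) (w2 \<odot> y)" "\<beta> \<in> cells C (f1 \<odot> x) (f2 \<odot> y)"
    using assms by (auto simp: icells_def)
  then have "id2 C x \<in> icells C x x" "id2 C y \<in> icells C y y"
    using id2_icells by (auto simp: hom_def)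
  then show ?thesis using square_id[OF h(5,1,6,2,7)] square_id[OF h(5,3,6,4,8)] by auto
qed

lemma data_iso_trans:
  assumes "span A B F" "span A B G" "d \<in> pre_data F G" "d' \<in> pre_data F G" "d'' \<in> pre_data F G"
    and "data_iso F G d d'" "data_iso F G d' d''"
  shows "data_iso F G d d''"
proof -
  obtain A1 w1 f1 A2 w2 f2 X x y \<alpha> \<beta> where
    [simp]: "F = (A1, w1, f1)" "G = (A2, w2, f2)" "d = (X, x, y, \<alpha>, \<beta>)"
    by (cases F; cases G; cases d)
  obtain X' x' y' \<alpha>' \<beta>' X'' x'' y'' \<alpha>'' \<beta>'' where
    [simp]: "d' = (X', x', y', \<alpha>', \<beta>')" "d'' = (X'', x'', y'', \<alpha>'', \<beta>'')"
    by (cases d'; cases d'')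
  obtain \<tau>1 \<tau>2 \<tau>1' \<tau>2' where t: "\<tau>1 \<in> icells C x x'" "\<tau>2 \<in> icells C y y'"
      "square w1 w2 \<tau>1 \<tau>2 \<alpha> \<alpha>'" "square f1 f2 \<tau>1 \<tau>2 \<beta> \<beta>'"
      "\<tau>1' \<in> icells C x' x''" "\<tau>2' \<in> icells C y' y''"
      "square w1 w2 \<tau>1' \<tau>2' \<alpha>' \<alpha>''" "square f1 f2 \<tau>1' \<tau>2' \<beta>' \<beta>''"
    using assms(6,7) by auto
  have h: "w1 \<in> hom C A1 A" "w2 \<in> hom C A2 A" "f1 \<in> hom C A1 B" "f2 \<in> hom C A2 B"
      "x \<in> hom C X A1" "y \<in> hom C X A2"
    using assms by auto
  have a: "\<alpha> \<in> cells C (w1 \<odot> x) (w2 \<odot> y)" "\<alpha>' \<in> cells C (w1 \<odot> x') (w2 \<odot> y')"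
      "\<alpha>'' \<in> cells C (w1 \<odot> x'') (w2 \<odot> y'')" "\<beta> \<in> cells C (f1 \<odot> x) (f2 \<odot> y)"
      "\<beta>' \<in> cells C (f1 \<odot> x') (f2 \<odot> y')" "\<beta>'' \<in> cells C (f1 \<odot> x'') (f2 \<odot> y'')"
    using assms by (auto simp: icells_def)
  note t' = icells_cells[OF t(1)] icells_cells[OF t(2)] icells_cells[OF t(5)] icells_cells[OF t(6)]
  show ?thesis
    using assms(6,7) square_comp[OF h(5,1,6,2) t' a(1,2,3) t(3,7)] square_comp[OF h(5,3,6,4) t' a(4,5,6) t(4,8)]
      vcomp_icells[OF t(1,5)] vcomp_icells[OF t(2,6)] by auto
qed

lemma data_iso_sym:
  assumes "span A B F" "span A B G" "d \<in> pre_data F G" "d' \<in> pre_data F G" "data_iso F G d d'"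
  shows "data_iso F G d' d"
proof -
  obtain A1 w1 f1 A2 w2 f2 X x y \<alpha> \<beta> X' x' y' \<alpha>' \<beta>' where
    [simp]: "F = (A1, w1, f1)" "G = (A2, w2, f2)" "d = (X, x, y, \<alpha>, \<beta>)" "d' = (X', x', y', \<alpha>', \<beta>')"
    by (cases F; cases G; cases d; cases d')
  obtain \<tau>1 \<tau>2 where t: "\<tau>1 \<in> icells C x x'" "\<tau>2 \<in> icells C y y'"
      "square w1 w2 \<tau>1 \<tau>2 \<alpha> \<alpha>'" "square f1 f2 \<tau>1 \<tau>2 \<beta> \<beta>'"
    using assms(5) by auto
  have h: "w1 \<in> hom C A1 A" "w2 \<in> hom C A2 A" "f1 \<in> hom C A1 B" "f2 \<in> hom C A2 B"
      "x \<in> hom C X A1" "y \<in> hom C X A2"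
    using assms by auto
  have a: "\<alpha> \<in> cells C (w1 \<odot> x) (w2 \<odot> y)" "\<alpha>' \<in> cells C (w1 \<odot> x') (w2 \<odot> y')"
      "\<beta> \<in> cells C (f1 \<odot> x) (f2 \<odot> y)" "\<beta>' \<in> cells C (f1 \<odot> x') (f2 \<odot> y')"
    using assms by (auto simp: icells_def)
  show ?thesis
    using assms(5) square_inv[OF h(5,1,6,2) t(1,2) a(1,2) t(3)] square_inv[OF h(5,3,6,4) t(1,2) a(3,4) t(4)]
      icells_inv2(1)[OF t(1)] icells_inv2(1)[OF t(2)] by auto
qed

lemma data_iso_restr:
  assumes "span A B F" "span A B G" "d \<in> pre_data F G" "d' \<in> pre_data F G" "data_iso F G d d'"
    and "z \<in> hom C Z (fst d)"
  shows "data_iso F G (restr F G d z) (restr F G d' z)"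
proof -
  obtain A1 w1 f1 A2 w2 f2 X x y \<alpha> \<beta> X' x' y' \<alpha>' \<beta>' where
    [simp]: "F = (A1, w1, f1)" "G = (A2, w2, f2)" "d = (X, x, y, \<alpha>, \<beta>)" "d' = (X', x', y', \<alpha>', \<beta>')"
    by (cases F; cases G; cases d; cases d')
  obtain \<tau>1 \<tau>2 where t: "\<tau>1 \<in> icells C x x'" "\<tau>2 \<in> icells C y y'"
      "square w1 w2 \<tau>1 \<tau>2 \<alpha> \<alpha>'" "square f1 f2 \<tau>1 \<tau>2 \<beta> \<beta>'"
    using assms(5) by auto
  have h: "w1 \<in> hom C A1 A" "w2 \<in> hom C A2 A" "f1 \<in> hom C A1 B" "f2 \<in> hom C A2 B"
      "x \<in> hom C X A1" "y \<in> hom C X A2" "z \<in> hom C Z X"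
    using assms by auto
  have a: "\<alpha> \<in> cells C (w1 \<odot> x) (w2 \<odot> y)" "\<alpha>' \<in> cells C (w1 \<odot> x') (w2 \<odot> y')"
      "\<beta> \<in> cells C (f1 \<odot> x) (f2 \<odot> y)" "\<beta>' \<in> cells C (f1 \<odot> x') (f2 \<odot> y')"
    using assms by (auto simp: icells_def)
  note t' = icells_cells[OF t(1)] icells_cells[OF t(2)]
  show ?thesis
    using square_restrict[OF h(5,1,6,2) t' a(1,2) t(3) h(7)] square_restrict[OF h(5,3,6,4) t' a(3,4) t(4) h(7)]
      rwhisker_icells[OF t(1) h(5,7)] rwhisker_icells[OF t(2) h(6,7)] by auto
qed

lemma data_iso_invertible:
  assumes "span A B F" "span A B G" "d \<in> pre_data F G" "d' \<in> pre_data F G" "data_iso F G d d'"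
    and "invertible_data d"
  shows "invertible_data d'"
proof -
  obtain A1 w1 f1 A2 w2 f2 X x y \<alpha> \<beta> X' x' y' \<alpha>' \<beta>' where
    [simp]: "F = (A1, w1, f1)" "G = (A2, w2, f2)" "d = (X, x, y, \<alpha>, \<beta>)" "d' = (X', x', y', \<alpha>', \<beta>')"
    by (cases F; cases G; cases d; cases d')
  obtain \<tau>1 \<tau>2 where t: "\<tau>1 \<in> icells C x x'" "\<tau>2 \<in> icells C y y'" "square f1 f2 \<tau>1 \<tau>2 \<beta> \<beta>'"
    using assms(5) by auto
  have h: "f1 \<in> hom C A1 B" "f2 \<in> hom C A2 B" "x \<in> hom C X A1" "y \<in> hom C X A2"
      "\<beta> \<in> icells C (f1 \<odot> x) (f2 \<odot> y)" "\<beta>' \<in> cells C (f1 \<odot> x') (f2 \<odot> y')"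
    using assms by (auto simp: icells_def)
  note l1 = lwhisker_icells(1)[OF t(1) h(3,1)] and l2 = lwhisker_icells(1)[OF t(2) h(4,2)]
  have "\<beta>' = ((f2 \<triangleright> \<tau>2) \<bullet> \<beta>) \<bullet> inv2 C (f1 \<triangleright> \<tau>1)"
    using t(3) vcomp_inv2_right[OF l1 h(6)] by (simp add: square_def)
  also have "\<dots> \<in> icells C (f1 \<odot> x') (f2 \<odot> y')"
    by (rule vcomp_icells[OF icells_inv2(1)[OF l1] vcomp_icells[OF h(5) l2]])
  finally show ?thesis by (simp add: icells_def)
qed

text \<open>The comparison on each leg is the associator of that leg with \<open>z\<close> and
  \<open>b\<close>; \<open>awhisker_comp1\<close> provides the two squares.\<close>

lemma data_iso_restr_restr:
  assumes "span A B F" "span A B G" "d \<in> pre_data F G" "z \<in> hom C Z (fst d)" "b \<in> hom C Y Z"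
  shows "data_iso F G (restr F G (restr F G d z) b) (restr F G d (z \<odot> b))"
proof -
  obtain A1 w1 f1 A2 w2 f2 X x y \<alpha> \<beta> where
    [simp]: "F = (A1, w1, f1)" "G = (A2, w2, f2)" "d = (X, x, y, \<alpha>, \<beta>)"
    by (cases F; cases G; cases d)
  have h: "w1 \<in> hom C A1 A" "w2 \<in> hom C A2 A" "f1 \<in> hom C A1 B" "f2 \<in> hom C A2 B"
      "x \<in> hom C X A1" "y \<in> hom C X A2" "z \<in> hom C Z X"
      "\<alpha> \<in> cells C (w1 \<odot> x) (w2 \<odot> y)" "\<beta> \<in> cells C (f1 \<odot> x) (f2 \<odot> y)"
    using assms by (auto simp: icells_def)
  have "src C (z \<odot> b) = src C b" using comp1_hom[OF assms(5) h(7)] assms(5) by (simp add: hom_def)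
  then show ?thesis
    using awhisker_comp1[OF h(5,1,6,2,8,7) assms(5)] awhisker_comp1[OF h(5,3,6,4,9,7) assms(5)]
      assoc_icells[OF assms(5) h(7,5)] assoc_icells[OF assms(5) h(7,6)] by (auto simp: square_def)
qed

text \<open>The comparison on each leg is that leg whiskered with \<mu>;
  \<open>awhisker_natural\<close> provides the two squares.\<close>

lemma data_iso_cong:
  assumes "span A B F" "span A B G" "d \<in> pre_data F G" "z \<in> hom C Z (fst d)" "\<mu> \<in> icells C z z'"
  shows "data_iso F G (restr F G d z) (restr F G d z')"
proof -
  obtain A1 w1 f1 A2 w2 f2 X x y \<alpha> \<beta> where
    [simp]: "F = (A1, w1, f1)" "G = (A2, w2, f2)" "d = (X, x, y, \<alpha>, \<beta>)"
    by (cases F; cases G; cases d)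
  have h: "w1 \<in> hom C A1 A" "w2 \<in> hom C A2 A" "f1 \<in> hom C A1 B" "f2 \<in> hom C A2 B"
      "x \<in> hom C X A1" "y \<in> hom C X A2" "z \<in> hom C Z X"
      "\<alpha> \<in> cells C (w1 \<odot> x) (w2 \<odot> y)" "\<beta> \<in> cells C (f1 \<odot> x) (f2 \<odot> y)"
    using assms by (auto simp: icells_def)
  note m = icells_cells[OF assms(5)]
  have "src C z = src C z'" using cells_hom[OF m, of Z X] h(7) by (simp add: hom_def)
  then show ?thesis
    using awhisker_natural[OF h(5,1,6,2,8,7) m] awhisker_natural[OF h(5,3,6,4,9,7) m]
      lwhisker_icells(1)[OF assms(5) h(7,5)] lwhisker_icells(1)[OF assms(5) h(7,6)]
    by (auto simp: square_def)
qed

subsection \<open>Composition of data\<close>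

abbreviation fst_leg :: "('o, 'm, 't) fdata \<Rightarrow> 'm" where "fst_leg d \<equiv> fst (snd d)"
abbreviation snd_leg :: "('o, 'm, 't) fdata \<Rightarrow> 'm" where "snd_leg d \<equiv> fst (snd (snd d))"

text \<open>Vertical composition for data that already share their apex, where the two middle legs
  are only isomorphic, through \<rho>. A general composite of representatives is this one, applied
  to restrictions along \<open>t1\<close> and \<open>t2\<close>.\<close>

fun compose_data :: "('o, 'm) fmor \<Rightarrow> ('o, 'm, 't) fdata \<Rightarrow> 't \<Rightarrow> ('o, 'm, 't) fdata \<Rightarrow> ('o, 'm, 't) fdata"
  where
  "compose_data (A2, w2, f2) (X', y', k, \<alpha>', \<beta>') \<rho> (X, x, y, \<alpha>, \<beta>) =
     (X, x, k, \<alpha>' \<bullet> ((w2 \<triangleright> \<rho>) \<bullet> \<alpha>), \<beta>' \<bullet> ((f2 \<triangleright> \<rho>) \<bullet> \<beta>))"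

lemma compose_data_pre_data:
  assumes "span A B F" "span A B G" "span A B H" "d1 \<in> pre_data F G" "d2 \<in> pre_data G H"
    and "fst d1 = fst d2" "\<rho> \<in> icells C (snd_leg d1) (fst_leg d2)"
  shows "compose_data G d2 \<rho> d1 \<in> pre_data F H"
proof -
  obtain A1 w1 f1 A2 w2 f2 A3 w3 f3 where
    [simp]: "F = (A1, w1, f1)" "G = (A2, w2, f2)" "H = (A3, w3, f3)"
    by (cases F; cases G; cases H)
  obtain X x y \<alpha> \<beta> X' y' k \<alpha>' \<beta>' where
    [simp]: "d1 = (X, x, y, \<alpha>, \<beta>)" "d2 = (X', y', k, \<alpha>', \<beta>')"
    by (cases d1; cases d2)
  have h: "w2 \<in> hom C A2 A" "f2 \<in> hom C A2 B" "y \<in> hom C X A2" "\<rho> \<in> icells C y y'"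
    "\<alpha> \<in> icells C (w1 \<odot> x) (w2 \<odot> y)" "\<beta> \<in> cells C (f1 \<odot> x) (f2 \<odot> y)"
    "\<alpha>' \<in> icells C (w2 \<odot> y') (w3 \<odot> k)" "\<beta>' \<in> cells C (f2 \<odot> y') (f3 \<odot> k)"
    using assms by auto
  show ?thesis
    using assms(4-6) vcomp_icells[OF vcomp_icells[OF h(5) lwhisker_icells(1)[OF h(4,3,1)]] h(7)]
      vcomp_cells[OF vcomp_cells[OF h(6) icells_cells[OF lwhisker_icells(1)[OF h(4,3,2)]]] h(8)] by auto
qed

text \<open>A strict equality, not only an isomorphism: the associators inserted in the vertical
  factors cancel between neighbours, so no comparison of legs is required.\<close>

lemma restr_compose_data:
  assumes "span A B F" "span A B G" "span A B H" "d1 \<in> pre_data F G" "d2 \<in> pre_data G H"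
    and "fst d1 = fst d2" "\<rho> \<in> icells C (snd_leg d1) (fst_leg d2)" "z \<in> hom C Z (fst d1)"
  shows "restr F H (compose_data G d2 \<rho> d1) z = compose_data G (restr G H d2 z) (\<rho> \<triangleleft> z) (restr F G d1 z)"
proof -
  obtain A1 w1 f1 A2 w2 f2 A3 w3 f3 where
    [simp]: "F = (A1, w1, f1)" "G = (A2, w2, f2)" "H = (A3, w3, f3)"
    by (cases F; cases G; cases H)
  obtain X x y \<alpha> \<beta> X' y' k \<alpha>' \<beta>' where
    [simp]: "d1 = (X, x, y, \<alpha>, \<beta>)" "d2 = (X', y', k, \<alpha>', \<beta>')"
    by (cases d1; cases d2)
  have h: "w1 \<in> hom C A1 A" "f1 \<in> hom C A1 B" "w2 \<in> hom C A2 A" "f2 \<in> hom C A2 B"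
    "w3 \<in> hom C A3 A" "f3 \<in> hom C A3 B"
    "x \<in> hom C X A1" "y \<in> hom C X A2" "y' \<in> hom C X A2" "k \<in> hom C X A3" "z \<in> hom C Z X"
    "\<rho> \<in> cells C y y'"
    "\<alpha> \<in> cells C (w1 \<odot> x) (w2 \<odot> y)" "\<beta> \<in> cells C (f1 \<odot> x) (f2 \<odot> y)"
    "\<alpha>' \<in> cells C (w2 \<odot> y') (w3 \<odot> k)" "\<beta>' \<in> cells C (f2 \<odot> y') (f3 \<odot> k)"
    using assms by (auto simp: icells_def)
  note lw = lwhisker_cells[OF h(12,8,3)] and lf = lwhisker_cells[OF h(12,8,4)]
  show ?thesis
    using awhisker_vcomp[OF h(7,1,9,3,10,5,11) vcomp_cells[OF h(13) lw] h(15)]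
      awhisker_vcomp[OF h(7,1,8,3,9,3,11,13) lw] awhisker_lwhisker[OF h(8,3,12,11)]
      awhisker_vcomp[OF h(7,2,9,4,10,6,11) vcomp_cells[OF h(14) lf] h(16)]
      awhisker_vcomp[OF h(7,2,8,4,9,4,11,14) lf] awhisker_lwhisker[OF h(8,4,12,11)] by simp
qed

text \<open>For \<alpha> and for \<beta> separately, three squares are pasted: one for each datum,
  and between them the one made by the connecting cells.\<close>

lemma compose_data_iso:
  assumes "span A B (A1, w1, f1)" "span A B (A2, w2, f2)" "span A B (A3, w3, f3)"
    and "(X, x, y, \<alpha>, \<beta>) \<in> pre_data (A1, w1, f1) (A2, w2, f2)"
    and "(X, y', k, \<phi>, \<psi>) \<in> pre_data (A2, w2, f2) (A3, w3, f3)"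
    and "(X, x1, y1, \<alpha>1, \<beta>1) \<in> pre_data (A1, w1, f1) (A2, w2, f2)"
    and "(X, y1', k1, \<phi>1, \<psi>1) \<in> pre_data (A2, w2, f2) (A3, w3, f3)"
    and "\<rho> \<in> icells C y y'" "\<rho>1 \<in> icells C y1 y1'"
    and "\<tau>x \<in> icells C x x1" "\<tau>y \<in> icells C y y1" "\<tau>y' \<in> icells C y' y1'" "\<tau>k \<in> icells C k k1"
    and "square w1 w2 \<tau>x \<tau>y \<alpha> \<alpha>1" "square f1 f2 \<tau>x \<tau>y \<beta> \<beta>1"
    and "square w2 w3 \<tau>y' \<tau>k \<phi> \<phi>1" "square f2 f3 \<tau>y' \<tau>k \<psi> \<psi>1"
    and "\<rho>1 \<bullet> \<tau>y = \<tau>y' \<bullet> \<rho>"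
  shows "data_iso (A1, w1, f1) (A3, w3, f3)
    (compose_data (A2, w2, f2) (X, y', k, \<phi>, \<psi>) \<rho> (X, x, y, \<alpha>, \<beta>))
    (compose_data (A2, w2, f2) (X, y1', k1, \<phi>1, \<psi>1) \<rho>1 (X, x1, y1, \<alpha>1, \<beta>1))"
proof -
  have h: "w1 \<in> hom C A1 A" "f1 \<in> hom C A1 B" "w2 \<in> hom C A2 A" "f2 \<in> hom C A2 B"
    "w3 \<in> hom C A3 A" "f3 \<in> hom C A3 B"
    "x \<in> hom C X A1" "y \<in> hom C X A2" "y' \<in> hom C X A2" "k \<in> hom C X A3" "y1 \<in> hom C X A2"
    using assms(1-7) by auto
  have c: "\<alpha> \<in> cells C (w1 \<odot> x) (w2 \<odot> y)" "\<beta> \<in> cells C (f1 \<odot> x) (f2 \<odot> y)"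
    "\<alpha>1 \<in> cells C (w1 \<odot> x1) (w2 \<odot> y1)" "\<beta>1 \<in> cells C (f1 \<odot> x1) (f2 \<odot> y1)"
    "\<phi> \<in> cells C (w2 \<odot> y') (w3 \<odot> k)" "\<psi> \<in> cells C (f2 \<odot> y') (f3 \<odot> k)"
    "\<phi>1 \<in> cells C (w2 \<odot> y1') (w3 \<odot> k1)" "\<psi>1 \<in> cells C (f2 \<odot> y1') (f3 \<odot> k1)"
    using assms(4-7) by (auto simp: icells_def)
  note r = icells_cells[OF assms(8)] and r1 = icells_cells[OF assms(9)]
  note t = icells_cells[OF assms(10)] icells_cells[OF assms(11)] icells_cells[OF assms(12)] icells_cells[OF assms(13)]
  note lw = lwhisker_cells[OF r h(8,3)] and lf = lwhisker_cells[OF r h(8,4)]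
  note lw1 = lwhisker_cells[OF r1 h(11,3)] and lf1 = lwhisker_cells[OF r1 h(11,4)]
  note sw = square_lwhisker[OF h(8,3) r t(2,3) r1 assms(18)] and sf = square_lwhisker[OF h(8,4) r t(2,3) r1 assms(18)]
  note sw' = square_vcomp[OF h(7,1,8,3,9,3) t(1,2,3) c(1,3) lw lw1 assms(14) sw]
  note sf' = square_vcomp[OF h(7,2,8,4,9,4) t(1,2,3) c(2,4) lf lf1 assms(15) sf]
  note sw'' = square_vcomp[OF h(7,1,9,3,10,5) t(1,3,4) vcomp_cells[OF c(1) lw] vcomp_cells[OF c(3) lw1] c(5,7) sw' assms(16)]
  note sf'' = square_vcomp[OF h(7,2,9,4,10,6) t(1,3,4) vcomp_cells[OF c(2) lf] vcomp_cells[OF c(4) lf1] c(6,8) sf' assms(17)]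
  show ?thesis using sw'' sf'' assms(10,13) by auto
qed

lemma compose_data_cong:
  assumes "span A B F" "span A B G" "span A B H" "d1 \<in> pre_data F G" "d2 \<in> pre_data G H"
    and "d1' \<in> pre_data F G" "d2' \<in> pre_data G H" "data_iso F G d1 d1'" "data_iso G H d2 d2'"
    and "fst d1 = fst d2" "\<rho> \<in> icells C (snd_leg d1) (fst_leg d2)"
  obtains \<rho>' where "\<rho>' \<in> icells C (snd_leg d1') (fst_leg d2')"
    "data_iso F H (compose_data G d2 \<rho> d1) (compose_data G d2' \<rho>' d1')"
proof -
  obtain A1 w1 f1 A2 w2 f2 A3 w3 f3 where
    F: "F = (A1, w1, f1)" and G: "G = (A2, w2, f2)" and H: "H = (A3, w3, f3)"
    by (cases F; cases G; cases H)
  obtain X x y \<alpha> \<beta> X' y' k \<phi> \<psi> where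
    d: "d1 = (X, x, y, \<alpha>, \<beta>)" "d2 = (X', y', k, \<phi>, \<psi>)"
    by (cases d1; cases d2)
  obtain X1 x1 y1 \<alpha>1 \<beta>1 X1' y1' k1 \<phi>1 \<psi>1 where
    d': "d1' = (X1, x1, y1, \<alpha>1, \<beta>1)" "d2' = (X1', y1', k1, \<phi>1, \<psi>1)"
    by (cases d1'; cases d2')
  obtain \<tau>x \<tau>y \<tau>y' \<tau>k where t: "\<tau>x \<in> icells C x x1" "\<tau>y \<in> icells C y y1"
    "\<tau>y' \<in> icells C y' y1'" "\<tau>k \<in> icells C k k1"
    "square w1 w2 \<tau>x \<tau>y \<alpha> \<alpha>1" "square f1 f2 \<tau>x \<tau>y \<beta> \<beta>1"
    "square w2 w3 \<tau>y' \<tau>k \<phi> \<phi>1" "square f2 f3 \<tau>y' \<tau>k \<psi> \<psi>1"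
    using assms(8,9) unfolding F G H d d' by auto
  have X: "X' = X" "X1 = X" "X1' = X" using assms(8-10) unfolding F G H d d' by auto
  have r: "\<rho> \<in> icells C y y'" using assms(11) d by simp
  have m: "\<tau>y' \<bullet> \<rho> \<in> icells C y y1'" by (rule vcomp_icells[OF r t(3)])
  \<comment> \<open>The connecting cell is forced: it is \<rho> transported along the comparisons of
    the two middle legs.\<close>
  let ?\<rho> = "(\<tau>y' \<bullet> \<rho>) \<bullet> inv2 C \<tau>y"
  have r1: "?\<rho> \<in> icells C y1 y1'" by (rule vcomp_icells[OF icells_inv2(1)[OF t(2)] m])
  show ?thesis
  proof (rule that[of ?\<rho>])
    show "?\<rho> \<in> icells C (snd_leg d1') (fst_leg d2')" using r1 d' by simp
    show "data_iso F H (compose_data G d2 \<rho> d1) (compose_data G d2' ?\<rho> d1')"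
      unfolding d d' X F G H
      using compose_data_iso[OF assms(1-7)[unfolded F G H d d' X] r r1 t(1-8) vcomp_inv2_right'[OF t(2) icells_cells[OF m]]] .
  qed
qed

text \<open>The last hypothesis says that \<kappa>' is \<open>\<kappa> \<triangleleft> r\<close>
  rebracketed. It is exactly the compatibility of the connecting cells needed when all legs are
  compared by associators.\<close>

lemma compose_data_restr_restr:
  assumes "span A B F" "span A B G" "span A B H" "d1 \<in> pre_data F G" "d2 \<in> pre_data G H"
    and "q \<in> hom C E (fst d1)" "p \<in> hom C E (fst d2)" "r \<in> hom C Y E"
    and "\<kappa> \<in> icells C (snd_leg d1 \<odot> q) (fst_leg d2 \<odot> p)"
    and "\<kappa>' \<in> icells C (snd_leg d1 \<odot> (q \<odot> r)) (fst_leg d2 \<odot> (p \<odot> r))"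
    and "\<kappa>' \<bullet> assoc C (snd_leg d1) q r = assoc C (fst_leg d2) p r \<bullet> (\<kappa> \<triangleleft> r)"
  shows "data_iso F H (restr F H (compose_data G (restr G H d2 p) \<kappa> (restr F G d1 q)) r)
    (compose_data G (restr G H d2 (p \<odot> r)) \<kappa>' (restr F G d1 (q \<odot> r)))"
proof -
  obtain A1 w1 f1 A2 w2 f2 A3 w3 f3 where
    F: "F = (A1, w1, f1)" and G: "G = (A2, w2, f2)" and H: "H = (A3, w3, f3)"
    by (cases F; cases G; cases H)
  obtain X x y \<alpha> \<beta> X' y' k \<phi> \<psi> where
    d: "d1 = (X, x, y, \<alpha>, \<beta>)" "d2 = (X', y', k, \<phi>, \<psi>)"
    by (cases d1; cases d2)
  have h: "w1 \<in> hom C A1 A" "f1 \<in> hom C A1 B" "w2 \<in> hom C A2 A" "f2 \<in> hom C A2 B"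
    "w3 \<in> hom C A3 A" "f3 \<in> hom C A3 B"
    "x \<in> hom C X A1" "y \<in> hom C X A2" "y' \<in> hom C X' A2" "k \<in> hom C X' A3"
    "q \<in> hom C E X" "p \<in> hom C E X'"
    using assms unfolding F G H d by auto
  have c: "\<alpha> \<in> cells C (w1 \<odot> x) (w2 \<odot> y)" "\<beta> \<in> cells C (f1 \<odot> x) (f2 \<odot> y)"
    "\<phi> \<in> cells C (w2 \<odot> y') (w3 \<odot> k)" "\<psi> \<in> cells C (f2 \<odot> y') (f3 \<odot> k)"
    using assms(4,5) unfolding F G H d by (auto simp: icells_def)
  note qr = comp1_hom[OF assms(8) h(11)] and pr = comp1_hom[OF assms(8) h(12)]
  have E: "src C q = E" "src C p = E" "src C (q \<odot> r) = Y" "src C (p \<odot> r) = Y" "src C r = Y"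
    using h(11,12) assms(8) qr pr by (auto simp: hom_def)
  note p1 = restr_pre_data[OF assms(1,2,4,6)] and p2 = restr_pre_data[OF assms(2,3,5,7)]
  have p1r: "restr F G (restr F G d1 q) r \<in> pre_data F G"
    by (rule restr_pre_data[OF assms(1,2) p1, of _ Y]) (use E assms(8) F G d in simp)
  have p2r: "restr G H (restr G H d2 p) r \<in> pre_data G H"
    by (rule restr_pre_data[OF assms(2,3) p2, of _ Y]) (use E assms(8) H G d in simp)
  have p1r': "restr F G d1 (q \<odot> r) \<in> pre_data F G"
    by (rule restr_pre_data[OF assms(1,2,4), of _ Y]) (use qr d in simp)
  have p2r': "restr G H d2 (p \<odot> r) \<in> pre_data G H"
    by (rule restr_pre_data[OF assms(2,3,5), of _ Y]) (use pr d in simp)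
  have eq: "restr F H (compose_data G (restr G H d2 p) \<kappa> (restr F G d1 q)) r =
      compose_data G (restr G H (restr G H d2 p) r) (\<kappa> \<triangleleft> r) (restr F G (restr F G d1 q) r)"
    by (rule restr_compose_data[OF assms(1-3) p1 p2, of _ r Y]) (use assms(8,9) E F G H d in simp_all)
  have kr: "\<kappa> \<triangleleft> r \<in> icells C ((y \<odot> q) \<odot> r) ((y' \<odot> p) \<odot> r)"
    using rwhisker_icells[OF _ comp1_hom[OF h(11,8)] assms(8)] assms(9) d by simp
  have k': "\<kappa>' \<in> icells C (y \<odot> (q \<odot> r)) (y' \<odot> (p \<odot> r))"
    "\<kappa>' \<bullet> assoc C y q r = assoc C y' p r \<bullet> (\<kappa> \<triangleleft> r)"
    using assms(10,11) d by simp_all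
  note a = assoc_icells[OF assms(8) h(11,7)] assoc_icells[OF assms(8) h(11,8)]
    assoc_icells[OF assms(8) h(12,9)] assoc_icells[OF assms(8) h(12,10)]
  show ?thesis
    unfolding eq
    using compose_data_iso[OF assms(1-3)[unfolded F G H]
        p1r[unfolded F G d restr.simps E] p2r[unfolded G H d restr.simps E]
        p1r'[unfolded F G d restr.simps E] p2r'[unfolded G H d restr.simps E] kr k'(1) a _ _ _ _ k'(2)]
      awhisker_comp1[OF h(7,1,8,3) c(1) h(11) assms(8)] awhisker_comp1[OF h(7,2,8,4) c(2) h(11) assms(8)]
      awhisker_comp1[OF h(9,3,10,5) c(3) h(12) assms(8)] awhisker_comp1[OF h(9,4,10,6) c(4) h(12) assms(8)]
    unfolding F G H d restr.simps E by (simp add: square_def)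
qed

section \<open>One-sided inverses of the second cell\<close>

fun linv_data :: "('o, 'm, 't) fdata \<Rightarrow> bool" where
  "linv_data (X, x, y, \<alpha>, \<beta>) \<longleftrightarrow> (\<exists>\<gamma>\<in>cells C (cod2 C \<beta>) (dom2 C \<beta>). \<gamma> \<bullet> \<beta> = id2 C (dom2 C \<beta>))"

fun rinv_data :: "('o, 'm, 't) fdata \<Rightarrow> bool" where
  "rinv_data (X, x, y, \<alpha>, \<beta>) \<longleftrightarrow> (\<exists>\<gamma>\<in>cells C (cod2 C \<beta>) (dom2 C \<beta>). \<beta> \<bullet> \<gamma> = id2 C (cod2 C \<beta>))"

lemma linv_rinv_data:
  assumes "d \<in> pre_data F G" "linv_data d" "rinv_data d"
  shows "invertible_data d"
proof -
  obtain A1 w1 f1 A2 w2 f2 X x y \<alpha> \<beta> where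
    [simp]: "F = (A1, w1, f1)" "G = (A2, w2, f2)" "d = (X, x, y, \<alpha>, \<beta>)"
    by (cases F; cases G; cases d)
  have b: "\<beta> \<in> cells C (f1 \<odot> x) (f2 \<odot> y)" "dom2 C \<beta> = f1 \<odot> x" "cod2 C \<beta> = f2 \<odot> y"
    using assms(1) by (auto simp: cells_def)
  obtain \<gamma> \<delta> where "\<gamma> \<in> cells C (f2 \<odot> y) (f1 \<odot> x)" "\<gamma> \<bullet> \<beta> = id2 C (f1 \<odot> x)"
    "\<delta> \<in> cells C (f2 \<odot> y) (f1 \<odot> x)" "\<beta> \<bullet> \<delta> = id2 C (f2 \<odot> y)"
    using assms(2,3) b by auto
  then show ?thesis
    using icellsI(1)[OF b(1)] left_right_inverse[OF b(1)] by (auto simp: icells_def)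
qed

text \<open>If a composite of three cells is invertible, its first factor has a left inverse and its
  last factor a right inverse, each formed from the remaining factors and the inverse of the
  composite.\<close>

lemma linv_compose:
  assumes "span A B F" "span A B G" "span A B H" "d1 \<in> pre_data F G" "d2 \<in> pre_data G H"
    and "fst d1 = fst d2" "\<rho> \<in> icells C (snd_leg d1) (fst_leg d2)"
    and "invertible_data (compose_data G d2 \<rho> d1)"
  shows "linv_data d1" "rinv_data d2"
proof -
  obtain A1 w1 f1 A2 w2 f2 A3 w3 f3 where
    [simp]: "F = (A1, w1, f1)" "G = (A2, w2, f2)" "H = (A3, w3, f3)"
    by (cases F; cases G; cases H)
  obtain X x y \<alpha> \<beta> X' y' k \<alpha>' \<beta>' where
    [simp]: "d1 = (X, x, y, \<alpha>, \<beta>)" "d2 = (X', y', k, \<alpha>', \<beta>')"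
    by (cases d1; cases d2)
  have h: "w2 \<in> hom C A2 A" "f2 \<in> hom C A2 B" "y \<in> hom C X A2" "\<rho> \<in> cells C y y'"
    "\<beta> \<in> cells C (f1 \<odot> x) (f2 \<odot> y)" "\<beta>' \<in> cells C (f2 \<odot> y') (f3 \<odot> k)"
    using assms by (auto simp: icells_def)
  have dc: "dom2 C \<beta> = f1 \<odot> x" "cod2 C \<beta> = f2 \<odot> y" "dom2 C \<beta>' = f2 \<odot> y'" "cod2 C \<beta>' = f3 \<odot> k"
    using h(5,6) by (auto simp: cells_def)
  note l = lwhisker_cells[OF h(4,3,2)]
  note m = vcomp_cells[OF h(5) l] and m' = vcomp_cells[OF l h(6)]
  let ?e = "\<beta>' \<bullet> ((f2 \<triangleright> \<rho>) \<bullet> \<beta>)"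
  have e: "?e \<in> icells C (f1 \<odot> x) (f3 \<odot> k)"
    using assms(8) vcomp_cells[OF m h(6)] by (simp add: icells_def)
  note i = inv2_cells[OF e]
  have "(inv2 C ?e \<bullet> (\<beta>' \<bullet> (f2 \<triangleright> \<rho>))) \<bullet> \<beta> = inv2 C ?e \<bullet> ?e"
    using vcomp_assoc[OF h(5) m' i] vcomp_assoc[OF h(5) l h(6)] by simp
  then show "linv_data d1" using vcomp_cells[OF m' i] icells_inv2(2)[OF e] dc by auto
  have "\<beta>' \<bullet> (((f2 \<triangleright> \<rho>) \<bullet> \<beta>) \<bullet> inv2 C ?e) = ?e \<bullet> inv2 C ?e"
    using vcomp_assoc[OF i m h(6)] by simp
  then show "rinv_data d2" using vcomp_cells[OF i m] icells_inv2(3)[OF e] dc by auto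
qed

lemma linv_rinv_restr:
  assumes "span A B F" "span A B G" "d \<in> pre_data F G" "z \<in> hom C Z (fst d)"
  shows "linv_data d \<Longrightarrow> linv_data (restr F G d z)" "rinv_data d \<Longrightarrow> rinv_data (restr F G d z)"
proof -
  obtain A1 w1 f1 A2 w2 f2 X x y \<alpha> \<beta> where
    [simp]: "F = (A1, w1, f1)" "G = (A2, w2, f2)" "d = (X, x, y, \<alpha>, \<beta>)"
    by (cases F; cases G; cases d)
  have h: "x \<in> hom C X A1" "f1 \<in> hom C A1 B" "y \<in> hom C X A2" "f2 \<in> hom C A2 B"
    "\<beta> \<in> cells C (f1 \<odot> x) (f2 \<odot> y)" "z \<in> hom C Z X"
    using assms by auto
  note w = awhisker_assoc(1)[OF h]
  have dc: "dom2 C \<beta> = f1 \<odot> x" "cod2 C \<beta> = f2 \<odot> y"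
    "dom2 C (awhisker C f1 x f2 y \<beta> z) = f1 \<odot> (x \<odot> z)" "cod2 C (awhisker C f1 x f2 y \<beta> z) = f2 \<odot> (y \<odot> z)"
    using h(5) w by (auto simp: cells_def)
  {
    assume "linv_data d"
    then obtain \<gamma> where g: "\<gamma> \<in> cells C (f2 \<odot> y) (f1 \<odot> x)" "\<gamma> \<bullet> \<beta> = id2 C (f1 \<odot> x)" using dc by auto
    show "linv_data (restr F G d z)"
      using awhisker_vcomp[OF h(1-4,1,2,6,5) g(1)] awhisker_id[OF h(1,2,6)] g(2) dc
        awhisker_assoc(1)[OF h(3,4,1,2) g(1) h(6)] by auto
  next
    assume "rinv_data d"
    then obtain \<gamma> where g: "\<gamma> \<in> cells C (f2 \<odot> y) (f1 \<odot> x)" "\<beta> \<bullet> \<gamma> = id2 C (f2 \<odot> y)" using dc by auto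
    show "rinv_data (restr F G d z)"
      using awhisker_vcomp[OF h(3,4,1,2,3,4,6) g(1) h(5)] awhisker_id[OF h(3,4,6)] g(2) dc
        awhisker_assoc(1)[OF h(3,4,1,2) g(1) h(6)] by auto
  }
qed

text \<open>A one-sided inverse of \<beta> is conjugated by the comparison cells
  \<open>f1 \<triangleright> \<tau>1\<close> and \<open>f2 \<triangleright> \<tau>2\<close> of the
  square.\<close>

lemma linv_rinv_iso:
  assumes "span A B F" "span A B G" "d \<in> pre_data F G" "d' \<in> pre_data F G" "data_iso F G d d'"
  shows "linv_data d \<Longrightarrow> linv_data d'" "rinv_data d \<Longrightarrow> rinv_data d'"
proof -
  obtain A1 w1 f1 A2 w2 f2 X x y \<alpha> \<beta> X' x' y' \<alpha>' \<beta>' where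
    [simp]: "F = (A1, w1, f1)" "G = (A2, w2, f2)" "d = (X, x, y, \<alpha>, \<beta>)" "d' = (X', x', y', \<alpha>', \<beta>')"
    by (cases F; cases G; cases d; cases d')
  obtain \<tau>1 \<tau>2 where t: "\<tau>1 \<in> icells C x x'" "\<tau>2 \<in> icells C y y'" "square f1 f2 \<tau>1 \<tau>2 \<beta> \<beta>'"
    using assms(5) by auto
  have h: "f1 \<in> hom C A1 B" "f2 \<in> hom C A2 B" "x \<in> hom C X A1" "y \<in> hom C X A2"
      "\<beta> \<in> cells C (f1 \<odot> x) (f2 \<odot> y)" "\<beta>' \<in> cells C (f1 \<odot> x') (f2 \<odot> y')"
    using assms by (auto simp: icells_def)
  have dc: "dom2 C \<beta> = f1 \<odot> x" "cod2 C \<beta> = f2 \<odot> y" "dom2 C \<beta>' = f1 \<odot> x'" "cod2 C \<beta>' = f2 \<odot> y'"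
    using h(5,6) by (auto simp: cells_def)
  let ?p = "f1 \<triangleright> \<tau>1" and ?q = "f2 \<triangleright> \<tau>2"
  note l1 = lwhisker_icells(1)[OF t(1) h(3,1)] and l2 = lwhisker_icells(1)[OF t(2) h(4,2)]
  note c1 = icells_cells[OF l1] and c2 = icells_cells[OF l2]
  note i1 = inv2_cells[OF l1] and i2 = inv2_cells[OF l2]
  have sq: "\<beta>' \<bullet> ?p = ?q \<bullet> \<beta>" using t(3) by (simp add: square_def)
  {
    assume "linv_data d"
    then obtain \<gamma> where g: "\<gamma> \<in> cells C (f2 \<odot> y) (f1 \<odot> x)" "\<gamma> \<bullet> \<beta> = id2 C (f1 \<odot> x)" using dc by auto
    let ?g = "?p \<bullet> (\<gamma> \<bullet> inv2 C ?q)"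
    note gi = vcomp_cells[OF i2 g(1)]
    have g': "?g \<in> cells C (f2 \<odot> y') (f1 \<odot> x')" by (rule vcomp_cells[OF gi c1])
    have "(?g \<bullet> \<beta>') \<bullet> ?p = ?g \<bullet> (?q \<bullet> \<beta>)" using vcomp_assoc[OF c1 h(6) g'] sq by simp
    also have "\<dots> = (?g \<bullet> ?q) \<bullet> \<beta>" using vcomp_assoc[OF h(5) c2 g'] by simp
    also have "?g \<bullet> ?q = ?p \<bullet> \<gamma>"
      using vcomp_assoc[OF c2 gi c1] vcomp_inv2_right'[OF l2 g(1)] by simp
    also have "(?p \<bullet> \<gamma>) \<bullet> \<beta> = ?p" using vcomp_assoc[OF h(5) g(1) c1] g(2) vcomp_id_right[OF c1] by simp
    also have "\<dots> = id2 C (f1 \<odot> x') \<bullet> ?p" using vcomp_id_left[OF c1] by simp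
    finally have "?g \<bullet> \<beta>' = id2 C (f1 \<odot> x')"
      by (rule vcomp_cancel_right[OF l1 vcomp_cells[OF h(6) g'] id2_cells[OF cells_Mor(2)[OF c1]]])
    then show "linv_data d'" using g' dc by auto
  next
    assume "rinv_data d"
    then obtain \<gamma> where g: "\<gamma> \<in> cells C (f2 \<odot> y) (f1 \<odot> x)" "\<beta> \<bullet> \<gamma> = id2 C (f2 \<odot> y)" using dc by auto
    let ?g = "?p \<bullet> (\<gamma> \<bullet> inv2 C ?q)"
    note gi = vcomp_cells[OF i2 g(1)]
    have g': "?g \<in> cells C (f2 \<odot> y') (f1 \<odot> x')" by (rule vcomp_cells[OF gi c1])
    have "\<beta>' \<bullet> ?g = (?q \<bullet> \<beta>) \<bullet> (\<gamma> \<bullet> inv2 C ?q)" using vcomp_assoc[OF gi c1 h(6)] sq by simp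
    also have "\<dots> = ?q \<bullet> ((\<beta> \<bullet> \<gamma>) \<bullet> inv2 C ?q)"
      using vcomp_assoc[OF gi h(5) c2] vcomp_assoc[OF i2 g(1) h(5)] by simp
    also have "\<dots> = id2 C (f2 \<odot> y')" using g(2) vcomp_id_left[OF i2] icells_inv2(3)[OF l2] by simp
    finally show "rinv_data d'" using g' dc by auto
  }
qed

text \<open>In the equivalence of representatives the cell on the first legs runs against the
  direction of a comparison of data. Inverting it turns the threefold composite of that definition
  into a commuting square.\<close>

lemma square_inv2_iff:
  assumes "x1 \<in> hom C X A1" "g1 \<in> hom C A1 B" "x2 \<in> hom C X A2" "g2 \<in> hom C A2 B"
    and "\<theta> \<in> cells C (g1 \<odot> x1) (g2 \<odot> x2)" "\<theta>' \<in> cells C (g1 \<odot> y1) (g2 \<odot> y2)"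
    and "\<sigma>1 \<in> icells C y1 x1" "\<sigma>2 \<in> icells C x2 y2"
  shows "square g1 g2 (inv2 C \<sigma>1) \<sigma>2 \<theta> \<theta>' \<longleftrightarrow> (g2 \<triangleright> \<sigma>2) \<bullet> (\<theta> \<bullet> (g1 \<triangleright> \<sigma>1)) = \<theta>'"
proof -
  have y1: "y1 \<in> hom C X A1" using cells_hom[OF icells_cells[OF assms(7)]] assms(1) by simp
  note l1 = lwhisker_icells[OF assms(7) y1 assms(2)] and l2 = lwhisker_icells(1)[OF assms(8,3,4)]
  note c1 = icells_cells[OF l1(1)] and c2 = icells_cells[OF l2]
  note m = vcomp_cells[OF assms(5) c2]
  have a: "(g2 \<triangleright> \<sigma>2) \<bullet> (\<theta> \<bullet> (g1 \<triangleright> \<sigma>1)) = ((g2 \<triangleright> \<sigma>2) \<bullet> \<theta>) \<bullet> (g1 \<triangleright> \<sigma>1)"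
    using vcomp_assoc[OF c1 assms(5) c2] by simp
  show ?thesis
    unfolding square_def a l1(2)[symmetric]
    using vcomp_inv2_right[OF l1(1) m] vcomp_inv2_right'[OF l1(1) assms(6)] by metis
qed

end

context bf_bicategory
begin

subsection \<open>Restriction along morphisms of the class W\<close>

lemma W_iso: "\<sigma> \<in> icells C v w \<Longrightarrow> v \<in> W \<longleftrightarrow> w \<in> W"
  using BF5[of w \<sigma> v] BF5[OF _ icells_inv2(1), of v \<sigma> w] by auto

text \<open>(BF3) is applied to \<open>v \<odot> z\<close>; (BF4b) then strips \<open>v\<close> from the resulting square.\<close>

lemma ore_square:
  assumes "v \<in> hom C B A" "v \<in> W" "z \<in> hom C Z B" "v \<odot> z \<in> W" "t \<in> hom C X B"
  obtains E a b \<mu> where "a \<in> hom C E X" "a \<in> W" "b \<in> hom C E Z" "\<mu> \<in> icells C (t \<odot> a) (z \<odot> b)"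
proof -
  obtain D w' f' \<phi> where D: "w' \<in> hom C D X" "f' \<in> hom C D Z" "w' \<in> W"
      "\<phi> \<in> icells C ((v \<odot> t) \<odot> w') ((v \<odot> z) \<odot> f')"
    using BF3[OF comp1_hom[OF assms(3,1)] assms(4) comp1_hom[OF assms(5,1)]] by blast
  have "assoc C v z f' \<bullet> (\<phi> \<bullet> inv2 C (assoc C v t w')) \<in> icells C (v \<odot> (t \<odot> w')) (v \<odot> (z \<odot> f'))"
    by (rule vcomp_icells[OF vcomp_icells[OF icells_inv2(1)[OF assoc_icells[OF D(1) assms(5,1)]] D(4)]
          assoc_icells[OF D(2) assms(3,1)]])
  from BF4b[OF assms(1,2) comp1_hom[OF D(1) assms(5)] comp1_hom[OF D(2) assms(3)] this]
  obtain E u \<beta> where u: "u \<in> hom C E D" "u \<in> W" and b: "\<beta> \<in> icells C ((t \<odot> w') \<odot> u) ((z \<odot> f') \<odot> u)"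
    unfolding bf4_triples_def icells_def by blast
  show ?thesis
  proof (rule that)
    show "w' \<odot> u \<in> hom C E X" "f' \<odot> u \<in> hom C E Z" using comp1_hom u(1) D(1,2) by blast+
    show "w' \<odot> u \<in> W" by (rule BF2[OF u(1) D(1) u(2) D(3)])
    show "assoc C z f' u \<bullet> (\<beta> \<bullet> inv2 C (assoc C t w' u)) \<in> icells C (t \<odot> (w' \<odot> u)) (z \<odot> (f' \<odot> u))"
      by (rule vcomp_icells[OF vcomp_icells[OF icells_inv2(1)[OF assoc_icells[OF u(1) D(1) assms(5)]] b]
            assoc_icells[OF u(1) D(2) assms(3)]])
  qed
qed

text \<open>The substitute for two-out-of-three: \<open>z\<close> itself may lie outside
  \<open>W\<close>, but an Ore square against the identity makes some \<open>z \<odot> b\<close>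
  isomorphic to \<open>id \<odot> a\<close> with \<open>a\<close> in \<open>W\<close>, and (BF5)
  applies.\<close>

lemma W_shrink:
  assumes "v \<in> hom C B A" "v \<in> W" "z \<in> hom C Z B" "v \<odot> z \<in> W"
  obtains E b where "b \<in> hom C E Z" "z \<odot> b \<in> W"
proof -
  have B: "B \<in> Obj C" using hom_Obj assms(1) by blast
  obtain E a b \<mu> where *: "a \<in> hom C E B" "a \<in> W" "b \<in> hom C E Z" "\<mu> \<in> icells C (id1 C B \<odot> a) (z \<odot> b)"
    by (rule ore_square[OF assms id1_hom[OF B]])
  show ?thesis
    using that[OF *(3)] W_iso[OF *(4)] BF2[OF *(1) id1_hom[OF B] *(2) BF1[OF B]] by blast
qed

text \<open>Whiskering with an element of \<open>W\<close> is faithful up to restriction. Both cells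
  are (BF4a) lifts of the same cell \<open>w \<triangleright> \<beta>\<close>, so the comparison of
  (BF4c) applies to them.\<close>

lemma whisker_cancel:
  assumes "w \<in> hom C B A" "w \<in> W" "f \<in> hom C X B" "\<beta> \<in> cells C f g" "\<beta>' \<in> cells C f g"
    and "w \<triangleright> \<beta> = w \<triangleright> \<beta>'"
  obtains Y t where "t \<in> hom C Y X" "t \<in> W" "\<beta> \<triangleleft> t = \<beta>' \<triangleleft> t"
proof -
  have X: "X \<in> Obj C" using hom_Obj assms(3) by blast
  have g: "g \<in> hom C X B" using cells_hom[OF assms(4)] assms(3) by simp
  let ?i = "id1 C X"
  note i = id1_hom[OF X]
  \<comment> \<open>The lifts are taken along the identity of \<open>X\<close>, which is in
    \<open>W\<close>; for this \<beta> and \<beta>' have to be whiskered with that identity.\<close>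
  have tr: "(X, ?i, \<gamma> \<triangleleft> ?i) \<in> bf4_triples C W X w f g (w \<triangleright> \<beta>)" if "\<gamma> \<in> cells C f g" "w \<triangleright> \<gamma> = w \<triangleright> \<beta>" for \<gamma>
    using X i BF1[OF X] rwhisker_cells[OF that(1) assms(3) i] awhisker_lwhisker[OF assms(3,1) that(1) i] that(2)
    by (simp add: bf4_triples_def)
  obtain E u u' \<zeta> where u: "u \<in> hom C E X" "u' \<in> hom C E X" "\<zeta> \<in> icells C (?i \<odot> u) (?i \<odot> u')" "?i \<odot> u \<in> W"
      "awhisker C f ?i g ?i (\<beta>' \<triangleleft> ?i) u' \<bullet> (f \<triangleright> \<zeta>) = (g \<triangleright> \<zeta>) \<bullet> awhisker C f ?i g ?i (\<beta> \<triangleleft> ?i) u"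
    using BF4c[OF assms(1-3) g lwhisker_cells[OF assms(4,3,1)] tr[OF assms(4) refl]
        tr[OF assms(5) assms(6)[symmetric]]] by blast
  have aw: "awhisker C f ?i g ?i (\<gamma> \<triangleleft> ?i) k = \<gamma> \<triangleleft> (?i \<odot> k)" if "\<gamma> \<in> cells C f g" "k \<in> hom C E X" for \<gamma> k
    by (rule awhisker_eqI[OF i assms(3) i g rwhisker_cells[OF that(1) assms(3) i] that(2)
          rwhisker_cells[OF that(1) assms(3) comp1_hom[OF that(2) i]]])
      (rule assoc_rwhisker[OF i that(2) assms(3) that(1), symmetric])
  have iu: "?i \<odot> u \<in> hom C E X" using comp1_hom[OF u(1) i] .
  \<comment> \<open>(BF4c) compares \<beta> over \<open>u\<close> with \<beta>' over
    \<open>u'\<close>. The exchange law moves \<zeta> to the other side of \<beta>', after which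
    both cells are whiskered by \<open>?i \<odot> u\<close> and \<zeta> cancels.\<close>
  have "(g \<triangleright> \<zeta>) \<bullet> (\<beta> \<triangleleft> (?i \<odot> u)) = (g \<triangleright> \<zeta>) \<bullet> (\<beta>' \<triangleleft> (?i \<odot> u))"
    using u(5) whisker_exchange[OF assms(5) icells_cells[OF u(3)] assms(3) iu]
    unfolding aw[OF assms(4) u(1)] aw[OF assms(5) u(2)] by simp
  then have "\<beta> \<triangleleft> (?i \<odot> u) = \<beta>' \<triangleleft> (?i \<odot> u)"
    by (rule vcomp_cancel_left[OF lwhisker_icells(1)[OF u(3) iu g]
          rwhisker_cells[OF assms(4,3) iu] rwhisker_cells[OF assms(5,3) iu]])
  then show ?thesis using that iu u(4) by blast
qed

section \<open>Equivalence of representatives in terms of restrictions\<close>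

fun in_W :: "('o, 'm) fmor \<Rightarrow> ('o, 'm, 't) fdata \<Rightarrow> bool" where
  "in_W (A', w, f) d \<longleftrightarrow> w \<odot> fst_leg d \<in> W"

lemma frac_hom_span: "F \<in> frac_hom C W A B \<Longrightarrow> span A B F"
  by (auto simp: frac_hom_def)

lemma frac_data_iff: "d \<in> frac_data C W F G \<longleftrightarrow> d \<in> pre_data F G \<and> in_W F d"
  using hom_Obj by (cases F; cases G; cases d) auto

lemma in_W_iso:
  assumes "span A B F" "span A B G" "d \<in> pre_data F G" "d' \<in> pre_data F G" "data_iso F G d d'"
  shows "in_W F d \<longleftrightarrow> in_W F d'"
proof -
  obtain A1 w1 f1 A2 w2 f2 X x y \<alpha> \<beta> X' x' y' \<alpha>' \<beta>' where
    [simp]: "F = (A1, w1, f1)" "G = (A2, w2, f2)" "d = (X, x, y, \<alpha>, \<beta>)" "d' = (X', x', y', \<alpha>', \<beta>')"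
    by (cases F; cases G; cases d; cases d')
  obtain \<tau>1 where "\<tau>1 \<in> icells C x x'" using assms(5) by auto
  then show ?thesis using W_iso[OF lwhisker_icells(1)[of \<tau>1 x x' X A1 w1 A]] assms(1,3) by simp
qed

text \<open>As \<alpha> is invertible, (BF5) lets the denominator be read on either leg. This
  symmetry is what allows the two spans to be exchanged.\<close>

lemma in_W_snd_leg:
  assumes "d \<in> pre_data F G"
  shows "in_W F d \<longleftrightarrow> fst (snd G) \<odot> snd_leg d \<in> W"
  using assms W_iso by (cases F; cases G; cases d) auto

lemma in_W_restr_iff:
  assumes "span A B F" "span A B G" "d \<in> pre_data F G" "z \<in> hom C Z (fst d)"
  shows "in_W F (restr F G d z) \<longleftrightarrow> (fst (snd F) \<odot> fst_leg d) \<odot> z \<in> W"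
proof -
  obtain A1 w1 f1 A2 w2 f2 X x y \<alpha> \<beta> where
    [simp]: "F = (A1, w1, f1)" "G = (A2, w2, f2)" "d = (X, x, y, \<alpha>, \<beta>)"
    by (cases F; cases G; cases d)
  show ?thesis using W_iso[OF assoc_icells[of z Z X x A1 w1 A]] assms by simp
qed

lemma in_W_restr:
  assumes "span A B F" "span A B G" "d \<in> pre_data F G" "z \<in> hom C Z (fst d)" "z \<in> W" "in_W F d"
  shows "in_W F (restr F G d z)"
proof -
  obtain A1 w1 f1 A2 w2 f2 X x y \<alpha> \<beta> where
    [simp]: "F = (A1, w1, f1)" "G = (A2, w2, f2)" "d = (X, x, y, \<alpha>, \<beta>)"
    by (cases F; cases G; cases d)
  show ?thesis
    unfolding in_W_restr_iff[OF assms(1-4)] using assms comp1_hom[of x X A1 w1 A] BF2[of z Z X "w1 \<odot> x" A] by simp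
qed

text \<open>The comparison on the first legs is the inverse of \<open>\<sigma>1\<close>, and the two
  required equations become squares. An associator accounts for the bracketing of the
  denominator.\<close>

lemma frac_rel_iff:
  assumes "span A B F" "span A B G"
  shows "(d, d') \<in> frac_rel C W F G \<longleftrightarrow> d \<in> frac_data C W F G \<and> d' \<in> frac_data C W F G \<and>
    (\<exists>Z z z'. z \<in> hom C Z (fst d) \<and> z' \<in> hom C Z (fst d') \<and> in_W F (restr F G d z) \<and>
      data_iso F G (restr F G d z) (restr F G d' z'))"
    (is "?L \<longleftrightarrow> ?D \<and> ?D' \<and> ?R")
proof -
  obtain A1 w1 f1 A2 w2 f2 X x y \<alpha> \<beta> X' x' y' \<alpha>' \<beta>' where
    s [simp]: "F = (A1, w1, f1)" "G = (A2, w2, f2)" "d = (X, x, y, \<alpha>, \<beta>)" "d' = (X', x', y', \<alpha>', \<beta>')"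
    by (cases F; cases G; cases d; cases d')
  have h: "w1 \<in> hom C A1 A" "w2 \<in> hom C A2 A" "f1 \<in> hom C A1 B" "f2 \<in> hom C A2 B"
    using assms by auto
  {
    assume D: "?D" "?D'"
    then have hd: "x \<in> hom C X A1" "y \<in> hom C X A2" "\<alpha> \<in> cells C (w1 \<odot> x) (w2 \<odot> y)" "\<beta> \<in> cells C (f1 \<odot> x) (f2 \<odot> y)"
        "x' \<in> hom C X' A1" "y' \<in> hom C X' A2" "\<alpha>' \<in> cells C (w1 \<odot> x') (w2 \<odot> y')" "\<beta>' \<in> cells C (f1 \<odot> x') (f2 \<odot> y')"
      by (auto simp: icells_def)
    have sq: "(square w1 w2 (inv2 C \<sigma>1) \<sigma>2 (awhisker C w1 x w2 y \<alpha> z) (awhisker C w1 x' w2 y' \<alpha>' z') \<longleftrightarrow>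
          (w2 \<triangleright> \<sigma>2) \<bullet> (awhisker C w1 x w2 y \<alpha> z \<bullet> (w1 \<triangleright> \<sigma>1)) = awhisker C w1 x' w2 y' \<alpha>' z') \<and>
        (square f1 f2 (inv2 C \<sigma>1) \<sigma>2 (awhisker C f1 x f2 y \<beta> z) (awhisker C f1 x' f2 y' \<beta>' z') \<longleftrightarrow>
          (f2 \<triangleright> \<sigma>2) \<bullet> (awhisker C f1 x f2 y \<beta> z \<bullet> (f1 \<triangleright> \<sigma>1)) = awhisker C f1 x' f2 y' \<beta>' z')"
      if "z \<in> hom C Z X" "z' \<in> hom C Z X'" "\<sigma>1 \<in> icells C (x' \<odot> z') (x \<odot> z)" "\<sigma>2 \<in> icells C (y \<odot> z) (y' \<odot> z')"
      for Z z z' \<sigma>1 \<sigma>2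
      using square_inv2_iff[OF comp1_hom[OF that(1) hd(1)] h(1) comp1_hom[OF that(1) hd(2)] h(2)
          awhisker_assoc(1)[OF hd(1) h(1) hd(2) h(2) hd(3) that(1)]
          awhisker_assoc(1)[OF hd(5) h(1) hd(6) h(2) hd(7) that(2)] that(3,4)]
        square_inv2_iff[OF comp1_hom[OF that(1) hd(1)] h(3) comp1_hom[OF that(1) hd(2)] h(4)
          awhisker_assoc(1)[OF hd(1) h(3) hd(2) h(4) hd(4) that(1)]
          awhisker_assoc(1)[OF hd(5) h(3) hd(6) h(4) hd(8) that(2)] that(3,4)] by simp
    have "?L \<longleftrightarrow> ?R"
    proof
      assume ?L
      then obtain Z z z' \<sigma>1 \<sigma>2 where z: "z \<in> hom C Z X" "z' \<in> hom C Z X'" "\<sigma>1 \<in> icells C (x' \<odot> z') (x \<odot> z)"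
          "\<sigma>2 \<in> icells C (y \<odot> z) (y' \<odot> z')" "(w1 \<odot> x) \<odot> z \<in> W"
          "(w2 \<triangleright> \<sigma>2) \<bullet> (awhisker C w1 x w2 y \<alpha> z \<bullet> (w1 \<triangleright> \<sigma>1)) = awhisker C w1 x' w2 y' \<alpha>' z'"
          "(f2 \<triangleright> \<sigma>2) \<bullet> (awhisker C f1 x f2 y \<beta> z \<bullet> (f1 \<triangleright> \<sigma>1)) = awhisker C f1 x' f2 y' \<beta>' z'"
        by auto
      have "src C z = src C z'" using z(1,2) by (simp add: hom_def)
      then have "data_iso F G (restr F G d z) (restr F G d' z')"
        using sq[OF z(1-4)] z(6,7) icells_inv2(1)[OF z(3)] z(4) by auto
      moreover have "in_W F (restr F G d z)"
        using W_iso[OF assoc_icells[OF z(1) hd(1) h(1)]] z(5) by simp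
      ultimately have "z \<in> hom C Z (fst d) \<and> z' \<in> hom C Z (fst d') \<and> in_W F (restr F G d z) \<and>
          data_iso F G (restr F G d z) (restr F G d' z')" using z(1,2) by simp
      then show ?R by blast
    next
      assume ?R
      then obtain Z z z' \<tau>1 \<tau>2 where z: "z \<in> hom C Z X" "z' \<in> hom C Z X'" "\<tau>1 \<in> icells C (x \<odot> z) (x' \<odot> z')"
          "\<tau>2 \<in> icells C (y \<odot> z) (y' \<odot> z')" "w1 \<odot> (x \<odot> z) \<in> W"
          "square w1 w2 \<tau>1 \<tau>2 (awhisker C w1 x w2 y \<alpha> z) (awhisker C w1 x' w2 y' \<alpha>' z')"
          "square f1 f2 \<tau>1 \<tau>2 (awhisker C f1 x f2 y \<beta> z) (awhisker C f1 x' f2 y' \<beta>' z')"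
        by auto
      have "(w1 \<odot> x) \<odot> z \<in> W" using W_iso[OF assoc_icells[OF z(1) hd(1) h(1)]] z(5) by simp
      then show ?L
        using sq[OF z(1,2) icells_inv2(1)[OF z(3)] z(4)] icells_inv2(4)[OF z(3)] icells_inv2(1)[OF z(3)] z hom_Obj[OF z(1)] D
        by (simp, blast)
    qed
  }
  moreover have "?L \<Longrightarrow> ?D \<and> ?D'" by auto
  ultimately show ?thesis by blast
qed

lemma data_iso_restr_comp:
  assumes "span A B F" "span A B G" "d \<in> pre_data F G" "d' \<in> pre_data F G"
    and "z \<in> hom C Z (fst d)" "z' \<in> hom C Z (fst d')" "data_iso F G (restr F G d z) (restr F G d' z')"
    and "b \<in> hom C Y Z"
  shows "data_iso F G (restr F G d (z \<odot> b)) (restr F G d' (z' \<odot> b))"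
proof -
  note s = assms(1,2)
  have b: "b \<in> hom C Y (fst (restr F G d z))" "b \<in> hom C Y (fst (restr F G d' z'))"
    using restr_fst assms(5,6,8) by simp_all
  note p = restr_pre_data[OF s assms(3,5)] and p' = restr_pre_data[OF s assms(4,6)]
  note q = restr_pre_data[OF s p b(1)] and q' = restr_pre_data[OF s p' b(2)]
  note r = restr_pre_data[OF s assms(3) comp1_hom[OF assms(8,5)]]
    and r' = restr_pre_data[OF s assms(4) comp1_hom[OF assms(8,6)]]
  have "data_iso F G (restr F G d (z \<odot> b)) (restr F G (restr F G d z) b)"
    by (rule data_iso_sym[OF s q r data_iso_restr_restr[OF s assms(3,5,8)]])
  from data_iso_trans[OF s r q q' this data_iso_restr[OF s p p' assms(7) b(1)]]
  show ?thesis by (rule data_iso_trans[OF s r q' r' _ data_iso_restr_restr[OF s assms(4,6,8)]])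
qed

lemma in_W_restr_comp:
  assumes "span A B F" "span A B G" "d \<in> pre_data F G" "z \<in> hom C Z (fst d)" "in_W F (restr F G d z)"
    and "a \<in> hom C Y Z" "a \<in> W"
  shows "in_W F (restr F G d (z \<odot> a))"
proof -
  note s = assms(1,2)
  have a: "a \<in> hom C Y (fst (restr F G d z))" using restr_fst assms(4,6) by simp
  note p = restr_pre_data[OF s assms(3,4)]
  show ?thesis
    using in_W_iso[OF s restr_pre_data[OF s p a] restr_pre_data[OF s assms(3) comp1_hom[OF assms(6,4)]]
        data_iso_restr_restr[OF s assms(3,4,6)]] in_W_restr[OF s p a assms(7,5)] by simp
qed

text \<open>The Ore square for \<open>v = w \<odot> x\<close>, the denominator of \<open>d\<close>:
  any morphism into its apex factors through an admissible restriction, up to isomorphism, after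
  composition with an element of \<open>W\<close>.\<close>

lemma ore_data:
  assumes "span A B F" "span A B G" "d \<in> frac_data C W F G" "z \<in> hom C Z (fst d)" "in_W F (restr F G d z)"
    and "t \<in> hom C X (fst d)"
  obtains E a b \<mu> where "a \<in> hom C E X" "a \<in> W" "b \<in> hom C E Z" "\<mu> \<in> icells C (t \<odot> a) (z \<odot> b)"
proof -
  have d: "d \<in> pre_data F G" "in_W F d" using assms(3) by (auto simp: frac_data_iff)
  have z: "(fst (snd F) \<odot> fst_leg d) \<odot> z \<in> W" using in_W_restr_iff[OF assms(1,2) d(1) assms(4)] assms(5) by simp
  have v: "fst (snd F) \<odot> fst_leg d \<in> hom C (fst d) A" "fst (snd F) \<odot> fst_leg d \<in> W"
    using assms(1) d comp1_hom by (cases F; cases G; cases d; auto)+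
  show ?thesis by (rule ore_square[OF v assms(4) z assms(6) that])
qed

lemma frac_rel_refl:
  assumes "span A B F" "span A B G" "d \<in> frac_data C W F G"
  shows "(d, d) \<in> frac_rel C W F G"
proof -
  have d: "d \<in> pre_data F G" "in_W F d" using assms(3) by (auto simp: frac_data_iff)
  have X: "fst d \<in> Obj C" using d(1) hom_Obj by (cases F; cases G; cases d) auto
  note i = id1_hom[OF X]
  show ?thesis
    unfolding frac_rel_iff[OF assms(1,2)]
    using assms(3) i in_W_restr[OF assms(1,2) d(1) i BF1[OF X] d(2)]
      data_iso_refl[OF assms(1,2) restr_pre_data[OF assms(1,2) d(1) i]] by blast
qed

lemma frac_rel_sym:
  assumes "span A B F" "span A B G" "(d, d') \<in> frac_rel C W F G"
  shows "(d', d) \<in> frac_rel C W F G"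
proof -
  note s = assms(1,2)
  obtain Z z z' where z: "d \<in> frac_data C W F G" "d' \<in> frac_data C W F G" "z \<in> hom C Z (fst d)"
      "z' \<in> hom C Z (fst d')" "in_W F (restr F G d z)" "data_iso F G (restr F G d z) (restr F G d' z')"
    using assms(3) unfolding frac_rel_iff[OF s] by blast
  have "d \<in> pre_data F G" "d' \<in> pre_data F G" using z(1,2) by (auto simp: frac_data_iff)
  then have p: "restr F G d z \<in> pre_data F G" "restr F G d' z' \<in> pre_data F G"
    using restr_pre_data[OF s] z(3,4) by blast+
  show ?thesis
    unfolding frac_rel_iff[OF s] using z data_iso_sym[OF s p z(6)] in_W_iso[OF s p z(6)] by blast
qed

lemma frac_rel_trans:
  assumes "span A B F" "span A B G" "(d, d') \<in> frac_rel C W F G" "(d', d'') \<in> frac_rel C W F G"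
  shows "(d, d'') \<in> frac_rel C W F G"
proof -
  note s = assms(1,2)
  obtain Z z z' where z: "d \<in> frac_data C W F G" "d' \<in> frac_data C W F G" "z \<in> hom C Z (fst d)"
      "z' \<in> hom C Z (fst d')" "in_W F (restr F G d z)" "data_iso F G (restr F G d z) (restr F G d' z')"
    using assms(3) unfolding frac_rel_iff[OF s] by blast
  obtain Y y y' where y: "d'' \<in> frac_data C W F G" "y \<in> hom C Y (fst d')"
      "y' \<in> hom C Y (fst d'')" "in_W F (restr F G d' y)" "data_iso F G (restr F G d' y) (restr F G d'' y')"
    using assms(4) unfolding frac_rel_iff[OF s] by blast
  have p: "d \<in> pre_data F G" "d' \<in> pre_data F G" "d'' \<in> pre_data F G"
    using z(1,2) y(1) by (auto simp: frac_data_iff)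
  have w: "in_W F (restr F G d' z')"
    using in_W_iso[OF s restr_pre_data[OF s p(1) z(3)] restr_pre_data[OF s p(2) z(4)] z(6)] z(5) by simp
  \<comment> \<open>The two restrictions \<open>y\<close> and \<open>z'\<close> of the middle datum
    are made to agree. Having \<open>a\<close> in \<open>W\<close> keeps the denominator of
    \<open>y \<odot> a\<close> in \<open>W\<close>, and the isomorphisms pass this on to
    \<open>z \<odot> b\<close>.\<close>
  obtain E a b \<mu> where e: "a \<in> hom C E Y" "a \<in> W" "b \<in> hom C E Z" "\<mu> \<in> icells C (y \<odot> a) (z' \<odot> b)"
    by (rule ore_data[OF s z(2) z(4) w y(2)])
  note ya = comp1_hom[OF e(1) y(2)] and y'a = comp1_hom[OF e(1) y(3)]
    and zb = comp1_hom[OF e(3) z(3)] and z'b = comp1_hom[OF e(3) z(4)]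
  note q = restr_pre_data[OF s p(1) zb] restr_pre_data[OF s p(2) z'b] restr_pre_data[OF s p(2) ya]
    restr_pre_data[OF s p(3) y'a]
  note i1 = data_iso_restr_comp[OF s p(1,2) z(3,4,6) e(3)]
    and i2 = data_iso_sym[OF s q(3,2) data_iso_cong[OF s p(2) ya e(4)]]
    and i3 = data_iso_restr_comp[OF s p(2,3) y(2,3,5) e(1)]
  note i12 = data_iso_trans[OF s q(1,2,3) i1 i2]
  have "in_W F (restr F G d (z \<odot> b))"
    using in_W_iso[OF s q(1,3) i12] in_W_restr_comp[OF s p(2) y(2,4) e(1,2)] by simp
  then show ?thesis
    unfolding frac_rel_iff[OF s] using z(1) y(1) zb y'a data_iso_trans[OF s q(1,3,4) i12 i3] by blast
qed

lemma frac_class_eq: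
  assumes "span A B F" "span A B G" "(d, d') \<in> frac_rel C W F G"
  shows "frac_class C W F G d = frac_class C W F G d'"
  unfolding frac_class_def using frac_rel_trans[OF assms(1,2)] frac_rel_sym[OF assms(1,2)] assms(3) by blast

text \<open>The restriction of \<open>d\<close> along \<open>u \<odot> id\<close> is isomorphic to
  the restriction of \<open>d|u\<close> along the identity.\<close>

lemma frac_rel_restr:
  assumes "span A B F" "span A B G" "d \<in> frac_data C W F G" "u \<in> hom C U (fst d)" "in_W F (restr F G d u)"
  shows "(d, restr F G d u) \<in> frac_rel C W F G"
proof -
  note s = assms(1,2)
  have d: "d \<in> pre_data F G" "in_W F d" using assms(3) by (auto simp: frac_data_iff)
  have U: "U \<in> Obj C" using assms(4) hom_Obj by blast
  note i = id1_hom[OF U]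
  note p = restr_pre_data[OF s d(1) assms(4)]
  have i': "id1 C U \<in> hom C U (fst (restr F G d u))" using i restr_fst[OF assms(4)] by simp
  note iu = comp1_hom[OF i assms(4)]
  show ?thesis
    unfolding frac_rel_iff[OF s]
    using assms(3,5) p iu i' in_W_restr_comp[OF s d(1) assms(4,5) i BF1[OF U]]
      data_iso_sym[OF s restr_pre_data[OF s p i'] restr_pre_data[OF s d(1) iu] data_iso_restr_restr[OF s d(1) assms(4) i]]
    by (auto simp: frac_data_iff)
qed

text \<open>The notion through which the four conditions are compared. Its demand on
  \<open>z\<close> is implied both by \<open>z\<close> in \<open>W\<close> and by
  \<open>x \<odot> z\<close> in \<open>W\<close>, and it can be carried from one representative to
  another.\<close>

definition locally_invertible :: "('o, 'm) fmor \<Rightarrow> ('o, 'm) fmor \<Rightarrow> ('o, 'm, 't) fdata \<Rightarrow> bool" where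
  "locally_invertible F G d \<longleftrightarrow> (\<exists>Z. \<exists>z\<in>hom C Z (fst d). in_W F (restr F G d z) \<and> invertible_data (restr F G d z))"

text \<open>The restriction \<open>z\<close> witnessing the equivalence and the restriction
  \<open>u\<close> making \<beta> invertible are unrelated. An Ore square refines both, and
  invertibility is then carried over to \<open>d'\<close>.\<close>

lemma locally_invertible_rel:
  assumes "span A B F" "span A B G" "(d, d') \<in> frac_rel C W F G" "locally_invertible F G d"
  shows "locally_invertible F G d'"
proof -
  note s = assms(1,2)
  obtain Z z z' where z: "d \<in> frac_data C W F G" "d' \<in> frac_data C W F G" "z \<in> hom C Z (fst d)"
      "z' \<in> hom C Z (fst d')" "in_W F (restr F G d z)" "data_iso F G (restr F G d z) (restr F G d' z')"
    using assms(3) unfolding frac_rel_iff[OF s] by blast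
  obtain U u where u: "u \<in> hom C U (fst d)" "in_W F (restr F G d u)" "invertible_data (restr F G d u)"
    using assms(4) unfolding locally_invertible_def by blast
  have p: "d \<in> pre_data F G" "d' \<in> pre_data F G" using z(1,2) by (auto simp: frac_data_iff)
  obtain E a b \<mu> where e: "a \<in> hom C E Z" "a \<in> W" "b \<in> hom C E U" "\<mu> \<in> icells C (z \<odot> a) (u \<odot> b)"
    by (rule ore_data[OF s z(1) u(1,2) z(3)])
  note za = comp1_hom[OF e(1) z(3)] and z'a = comp1_hom[OF e(1) z(4)] and ub = comp1_hom[OF e(3) u(1)]
  have b: "b \<in> hom C E (fst (restr F G d u))" using e(3) restr_fst[OF u(1)] by simp
  note pu = restr_pre_data[OF s p(1) u(1)]
  note q = restr_pre_data[OF s pu b] restr_pre_data[OF s p(1) ub] restr_pre_data[OF s p(1) za]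
    restr_pre_data[OF s p(2) z'a]
  note i1 = data_iso_restr_restr[OF s p(1) u(1) e(3)]
    and i2 = data_iso_sym[OF s q(3,2) data_iso_cong[OF s p(1) za e(4)]]
    and i3 = data_iso_restr_comp[OF s p z(3,4,6) e(1)]
  have "invertible_data (restr F G d' (z' \<odot> a))"
    by (rule data_iso_invertible[OF s q(3,4) i3 data_iso_invertible[OF s q(2,3) i2
            data_iso_invertible[OF s q(1,2) i1 invertible_restr[OF s pu b u(3)]]]])
  moreover have "in_W F (restr F G d' (z' \<odot> a))"
    using in_W_iso[OF s q(3,4) i3] in_W_restr_comp[OF s p(1) z(3,5) e(1,2)] by simp
  ultimately show ?thesis unfolding locally_invertible_def using z'a by blast
qed

text \<open>
  A cell \<open>\<kappa> : y \<odot> q \<Rightarrow> y \<odot> p\<close> becomes of the form \<open>y \<triangleright> \<mu>\<close> after restriction, although \<open>y\<close> need not be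
  in \<open>W\<close>: (BF4b) lifts \<open>w \<triangleright> \<kappa>\<close> along \<open>w \<odot> y\<close>, and the two lifts \<open>\<kappa>\<close> and \<open>y \<triangleright> \<mu>\<close> of the same cell
  along \<open>w\<close> agree after a further restriction by \<open>whisker_cancel\<close>.
\<close>

lemma lift_cell:
  assumes "y \<in> hom C X A'" "w \<in> hom C A' A" "w \<in> W" "w \<odot> y \<in> W" "q \<in> hom C E X" "p \<in> hom C E X"
    and "\<kappa> \<in> icells C (y \<odot> q) (y \<odot> p)"
  obtains Y r \<mu> T t \<kappa>' where "r \<in> hom C Y E" "r \<in> W" "\<mu> \<in> icells C (q \<odot> r) (p \<odot> r)"
    "t \<in> hom C T Y" "t \<in> W" "\<kappa>' \<in> icells C (y \<odot> (q \<odot> r)) (y \<odot> (p \<odot> r))"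
    "\<kappa>' \<bullet> assoc C y q r = assoc C y p r \<bullet> (\<kappa> \<triangleleft> r)" "\<kappa>' \<triangleleft> t = (y \<triangleright> \<mu>) \<triangleleft> t"
proof -
  note wy = comp1_hom[OF assms(1,2)]
  note yq = comp1_hom[OF assms(5,1)] and yp = comp1_hom[OF assms(6,1)]
  note aq = assoc_icells[OF assms(5,1,2)] and ap = assoc_icells[OF assms(6,1,2)]
  note wk = lwhisker_icells(1)[OF assms(7) yq assms(2)]
  note wka = vcomp_icells[OF aq wk]
  \<comment> \<open>\<open>w \<triangleright> \<kappa>\<close> rebracketed so that
    \<open>w \<odot> y\<close>, which is in \<open>W\<close>, stands in front and (BF4b)
    applies.\<close>
  let ?\<theta> = "inv2 C (assoc C w y p) \<bullet> ((w \<triangleright> \<kappa>) \<bullet> assoc C w y q)"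
  have \<theta>: "?\<theta> \<in> icells C ((w \<odot> y) \<odot> q) ((w \<odot> y) \<odot> p)" by (rule vcomp_icells[OF wka icells_inv2(1)[OF ap]])
  have a\<theta>: "assoc C w y p \<bullet> ?\<theta> = (w \<triangleright> \<kappa>) \<bullet> assoc C w y q"
    by (rule vcomp_inv2_left'[OF ap icells_cells[OF wka]])
  obtain Y r \<mu> where r: "r \<in> hom C Y E" "r \<in> W" "\<mu> \<in> icells C (q \<odot> r) (p \<odot> r)"
      "awhisker C (w \<odot> y) q (w \<odot> y) p ?\<theta> r = (w \<odot> y) \<triangleright> \<mu>"
    using BF4b[OF wy assms(4,5,6) \<theta>] unfolding bf4_triples_def icells_def by blast
  note qr = comp1_hom[OF r(1) assms(5)] and pr = comp1_hom[OF r(1) assms(6)]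
  note yqr = assoc_icells[OF r(1) assms(5,1)] and ypr = assoc_icells[OF r(1) assms(6,1)]
  note kr = rwhisker_icells[OF assms(7) yq r(1)]
  let ?\<kappa> = "(assoc C y p r \<bullet> (\<kappa> \<triangleleft> r)) \<bullet> inv2 C (assoc C y q r)"
  note m = vcomp_icells[OF kr ypr]
  have k: "?\<kappa> \<in> icells C (y \<odot> (q \<odot> r)) (y \<odot> (p \<odot> r))" by (rule vcomp_icells[OF icells_inv2(1)[OF yqr] m])
  have keq: "?\<kappa> \<bullet> assoc C y q r = assoc C y p r \<bullet> (\<kappa> \<triangleleft> r)"
    by (rule vcomp_inv2_right'[OF yqr icells_cells[OF m]])
  note ym = lwhisker_icells(1)[OF r(3) qr assms(1)]
  let ?Wk = "w \<triangleright> ?\<kappa>" and ?Wm = "w \<triangleright> (y \<triangleright> \<mu>)"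
  let ?a1 = "assoc C w y (q \<odot> r)" and ?a2 = "assoc C w y (p \<odot> r)"
  let ?b1 = "assoc C (w \<odot> y) q r" and ?b2 = "assoc C (w \<odot> y) p r"
  let ?c1 = "w \<triangleright> assoc C y q r" and ?c2 = "w \<triangleright> assoc C y p r"
  let ?d1 = "assoc C w (y \<odot> q) r" and ?d2 = "assoc C w (y \<odot> p) r"
  let ?e1 = "assoc C w y q \<triangleleft> r" and ?e2 = "assoc C w y p \<triangleleft> r"
  note Wk = icells_cells[OF lwhisker_icells(1)[OF k comp1_hom[OF qr assms(1)] assms(2)]]
    and Wm = icells_cells[OF lwhisker_icells(1)[OF ym comp1_hom[OF qr assms(1)] assms(2)]]
    and a1i = assoc_icells[OF qr assms(1,2)] and a2 = icells_cells[OF assoc_icells[OF pr assms(1,2)]]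
    and b1i = assoc_icells[OF r(1) assms(5) wy] and b2 = icells_cells[OF assoc_icells[OF r(1) assms(6) wy]]
    and c1 = icells_cells[OF lwhisker_icells(1)[OF yqr comp1_hom[OF r(1) yq] assms(2)]]
    and c2 = icells_cells[OF lwhisker_icells(1)[OF ypr comp1_hom[OF r(1) yp] assms(2)]]
    and d1 = icells_cells[OF assoc_icells[OF r(1) yq assms(2)]]
    and d2 = icells_cells[OF assoc_icells[OF r(1) yp assms(2)]]
    and e1 = icells_cells[OF rwhisker_icells[OF aq comp1_hom[OF assms(5) wy] r(1)]]
    and e2 = icells_cells[OF rwhisker_icells[OF ap comp1_hom[OF assms(6) wy] r(1)]]
  note a1 = icells_cells[OF a1i] and b1 = icells_cells[OF b1i]
  note gm = icells_cells[OF lwhisker_icells(1)[OF r(3) qr wy]]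
  note tr = icells_cells[OF rwhisker_icells[OF \<theta> comp1_hom[OF assms(5) wy] r(1)]]
  note wkr = icells_cells[OF rwhisker_icells[OF wk comp1_hom[OF yq assms(2)] r(1)]]
  note wkr' = icells_cells[OF lwhisker_icells(1)[OF kr comp1_hom[OF r(1) yq] assms(2)]]
  \<comment> \<open>The two lifts are compared after composing with the invertible
    \<open>?a1 \<bullet> ?b1\<close>. The pentagon for \<open>p\<close> leads to the bracketing in
    which \<theta> unfolds to \<open>w \<triangleright> \<kappa>\<close>; the pentagon for
    \<open>q\<close> leads back.\<close>
  have "?Wm \<bullet> (?a1 \<bullet> ?b1) = (?a2 \<bullet> ((w \<odot> y) \<triangleright> \<mu>)) \<bullet> ?b1"
    using vcomp_assoc[OF b1 a1 Wm] assoc_lwhisker[OF assms(1,2) qr icells_cells[OF r(3)]] by simp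
  also have "\<dots> = ?a2 \<bullet> (?b2 \<bullet> (?\<theta> \<triangleleft> r))"
    using vcomp_assoc[OF b1 gm a2] awhisker_assoc(2)[OF assms(5) wy assms(6) wy icells_cells[OF \<theta>] r(1)] r(4)
    by simp
  also have "\<dots> = (?a2 \<bullet> ?b2) \<bullet> (?\<theta> \<triangleleft> r)" using vcomp_assoc[OF tr b2 a2] by simp
  also have "\<dots> = ?c2 \<bullet> (?d2 \<bullet> (?e2 \<bullet> (?\<theta> \<triangleleft> r)))"
    unfolding pentagon[OF r(1) assms(6,1,2)]
    using vcomp_assoc[OF tr vcomp_cells[OF e2 d2] c2] vcomp_assoc[OF tr e2 d2] by simp
  also have "?e2 \<bullet> (?\<theta> \<triangleleft> r) = ((w \<triangleright> \<kappa>) \<triangleleft> r) \<bullet> ?e1"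
    using rwhisker_vcomp[OF icells_cells[OF \<theta>] icells_cells[OF ap] comp1_hom[OF assms(5) wy] r(1)]
      rwhisker_vcomp[OF icells_cells[OF aq] icells_cells[OF wk] comp1_hom[OF assms(5) wy] r(1)] a\<theta> by simp
  also have "?d2 \<bullet> (((w \<triangleright> \<kappa>) \<triangleleft> r) \<bullet> ?e1) = (w \<triangleright> (\<kappa> \<triangleleft> r)) \<bullet> (?d1 \<bullet> ?e1)"
    using vcomp_assoc[OF e1 wkr d2] vcomp_assoc[OF e1 d1 wkr'] assoc_mid[OF yq assms(2) r(1) icells_cells[OF assms(7)]]
    by simp
  also have "?c2 \<bullet> ((w \<triangleright> (\<kappa> \<triangleleft> r)) \<bullet> (?d1 \<bullet> ?e1)) = (?c2 \<bullet> (w \<triangleright> (\<kappa> \<triangleleft> r))) \<bullet> (?d1 \<bullet> ?e1)"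
    using vcomp_assoc[OF vcomp_cells[OF e1 d1] wkr' c2] by simp
  also have "?c2 \<bullet> (w \<triangleright> (\<kappa> \<triangleleft> r)) = ?Wk \<bullet> ?c1"
    using lwhisker_vcomp[OF icells_cells[OF kr] icells_cells[OF ypr] comp1_hom[OF r(1) yq] assms(2)]
      lwhisker_vcomp[OF icells_cells[OF yqr] icells_cells[OF k] comp1_hom[OF r(1) yq] assms(2)] keq by simp
  also have "(?Wk \<bullet> ?c1) \<bullet> (?d1 \<bullet> ?e1) = ?Wk \<bullet> (?a1 \<bullet> ?b1)"
    using vcomp_assoc[OF vcomp_cells[OF e1 d1] c1 Wk] pentagon[OF r(1) assms(5,1,2)] by simp
  finally have "?Wm = ?Wk"
    by (rule vcomp_cancel_right[OF vcomp_icells[OF b1i a1i] Wm Wk])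
  then obtain T t where "t \<in> hom C T Y" "t \<in> W" "?\<kappa> \<triangleleft> t = (y \<triangleright> \<mu>) \<triangleleft> t"
    using whisker_cancel[OF assms(2,3) comp1_hom[OF qr assms(1)] icells_cells[OF k] icells_cells[OF ym]] by metis
  then show ?thesis using that[OF r(1,2,3) _ _ k keq] by blast
qed

subsection \<open>Inverses and identities in the bicategory of fractions\<close>

fun inv_data :: "('o, 'm, 't) fdata \<Rightarrow> ('o, 'm, 't) fdata" where
  "inv_data (X, x, y, \<alpha>, \<beta>) = (X, y, x, inv2 C \<alpha>, inv2 C \<beta>)"

fun id_data :: "('o, 'm) fmor \<Rightarrow> ('o, 'm, 't) fdata" where
  "id_data (A', w, f) = (A', id1 C A', id1 C A', id2 C (w \<odot> id1 C A'), id2 C (f \<odot> id1 C A'))"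

lemma inv_data_pre_data:
  assumes "d \<in> pre_data F G" "invertible_data d"
  shows "inv_data d \<in> pre_data G F" "invertible_data (inv_data d)" "inv_data (inv_data d) = d"
proof -
  obtain A1 w1 f1 A2 w2 f2 X x y \<alpha> \<beta> where
    [simp]: "F = (A1, w1, f1)" "G = (A2, w2, f2)" "d = (X, x, y, \<alpha>, \<beta>)"
    by (cases F; cases G; cases d)
  have a: "\<alpha> \<in> icells C (w1 \<odot> x) (w2 \<odot> y)" and b: "\<beta> \<in> icells C (f1 \<odot> x) (f2 \<odot> y)"
    using assms by (auto simp: icells_def)
  show "inv_data d \<in> pre_data G F" "invertible_data (inv_data d)" "inv_data (inv_data d) = d"
    using assms(1) icells_inv2[OF a] icells_inv2[OF b] by (auto simp: icells_def)
qed

lemma inv_data_frac_data: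
  assumes "d \<in> frac_data C W F G" "invertible_data d"
  shows "inv_data d \<in> frac_data C W G F"
  using assms inv_data_pre_data(1)[of d F G] in_W_snd_leg[of d F G]
  by (cases F; cases G; cases d) (auto simp: frac_data_iff)

lemma id_data_frac_data:
  assumes "F \<in> frac_hom C W A B"
  shows "id_data F \<in> frac_data C W F F"
proof -
  obtain A' w f where [simp]: "F = (A', w, f)" by (cases F)
  have h: "A' \<in> Obj C" "w \<in> hom C A' A" "w \<in> W" "f \<in> hom C A' B" using assms by (auto simp: frac_hom_def)
  have "w \<odot> id1 C A' \<in> Mor C" "f \<odot> id1 C A' \<in> Mor C"
    using comp1_hom[OF id1_hom[OF h(1)] h(2)] comp1_hom[OF id1_hom[OF h(1)] h(4)] by (auto simp: hom_def)
  then show ?thesis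
    using h id1_hom[OF h(1)] id2_icells id2_cells BF2[OF id1_hom[OF h(1)] h(2) BF1[OF h(1)] h(3)] by simp
qed

lemma id_data_invertible:
  assumes "span A B F"
  shows "invertible_data (id_data F)"
proof -
  obtain A' w f where [simp]: "F = (A', w, f)" by (cases F)
  have f: "f \<in> hom C A' B" using assms by simp
  then have "f \<odot> id1 C A' \<in> Mor C" using comp1_hom[OF id1_hom f] hom_Obj[OF f] by (auto simp: hom_def)
  then show ?thesis using id2_icells by (auto simp: icells_def)
qed

text \<open>With a connecting cell of the form \<open>y \<triangleright> \<mu>\<close>, naturality
  turns it into \<open>x \<triangleright> \<mu>\<close> on the other side of \<alpha> and \<beta>,
  which then meet their inverses. Only whiskerings of one cell between legs remain.\<close>

lemma compose_inv_data:
  assumes "span A B F" "span A B G" "d \<in> pre_data F G" "invertible_data d"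
    and "q \<in> hom C E (fst d)" "\<mu> \<in> icells C q p"
  shows "compose_data G (restr G F (inv_data d) p) (snd_leg d \<triangleright> \<mu>) (restr F G d q) =
    (E, fst_leg d \<odot> q, fst_leg d \<odot> p, fst (snd F) \<triangleright> (fst_leg d \<triangleright> \<mu>), snd (snd F) \<triangleright> (fst_leg d \<triangleright> \<mu>))"
proof -
  obtain A1 w1 f1 A2 w2 f2 X x y \<alpha> \<beta> where
    [simp]: "F = (A1, w1, f1)" "G = (A2, w2, f2)" "d = (X, x, y, \<alpha>, \<beta>)"
    by (cases F; cases G; cases d)
  have h: "x \<in> hom C X A1" "y \<in> hom C X A2" "q \<in> hom C E X"
    "\<alpha> \<in> icells C (w1 \<odot> x) (w2 \<odot> y)" "\<beta> \<in> icells C (f1 \<odot> x) (f2 \<odot> y)"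
    using assms by (auto simp: icells_def)
  note m = icells_cells[OF assms(6)]
  have p: "p \<in> hom C E X" using cells_hom[OF m] h(3) by simp
  have *: "awhisker C g2 y g1 x (inv2 C \<theta>) p \<bullet> ((g2 \<triangleright> (y \<triangleright> \<mu>)) \<bullet> awhisker C g1 x g2 y \<theta> q) = g1 \<triangleright> (x \<triangleright> \<mu>)"
    if g: "g1 \<in> hom C A1 D" "g2 \<in> hom C A2 D" "\<theta> \<in> icells C (g1 \<odot> x) (g2 \<odot> y)" for g1 g2 D \<theta>
  proof -
    note t = icells_cells[OF g(3)] and t' = inv2_cells[OF g(3)]
    note l = lwhisker_cells[OF lwhisker_cells[OF m h(3,1)] comp1_hom[OF h(3,1)] g(1)]
    note aw = awhisker_assoc(1)[OF h(1) g(1) h(2) g(2) t p] and aw' = awhisker_assoc(1)[OF h(2) g(2) h(1) g(1) t' p]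
    have "awhisker C g2 y g1 x (inv2 C \<theta>) p \<bullet> ((g2 \<triangleright> (y \<triangleright> \<mu>)) \<bullet> awhisker C g1 x g2 y \<theta> q) =
        (awhisker C g2 y g1 x (inv2 C \<theta>) p \<bullet> awhisker C g1 x g2 y \<theta> p) \<bullet> (g1 \<triangleright> (x \<triangleright> \<mu>))"
      using awhisker_natural[OF h(1) g(1) h(2) g(2) t h(3) m] vcomp_assoc[OF l aw aw'] by simp
    also have "\<dots> = g1 \<triangleright> (x \<triangleright> \<mu>)"
      using awhisker_vcomp[OF h(1) g(1) h(2) g(2) h(1) g(1) p t t'] icells_inv2(2)[OF g(3)]
        awhisker_id[OF h(1) g(1) p] vcomp_id_left[OF l] by simp
    finally show ?thesis .
  qed
  have "src C q = E" using h(3) by (simp add: hom_def)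
  moreover have "w1 \<in> hom C A1 A" "w2 \<in> hom C A2 A" "f1 \<in> hom C A1 B" "f2 \<in> hom C A2 B"
    using assms(1,2) by auto
  ultimately show ?thesis using *[OF _ _ h(4), of A] *[OF _ _ h(5), of B] by simp
qed

text \<open>This recognises the outcome of cancelling a datum against its inverse as a restriction
  of the identity.\<close>

lemma whisker_iso_id_data:
  assumes "span A B (A', w, f)" "s \<in> hom C E A'" "\<nu> \<in> icells C s s'"
  shows "data_iso (A', w, f) (A', w, f) (E, s, s', w \<triangleright> \<nu>, f \<triangleright> \<nu>) (restr (A', w, f) (A', w, f) (id_data (A', w, f)) s)"
proof -
  have A': "A' \<in> Obj C" using hom_Obj[OF assms(2)] by blast
  note i = id1_hom[OF A'] and ids = comp1_hom[OF assms(2) id1_hom[OF A']]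
  note l = icells_inv2(1)[OF lunit_icells[OF assms(2)]]
  \<comment> \<open>On the second leg \<nu> is undone before the unitor is inserted, so that the
    pair carries \<nu> to an identity cell.\<close>
  let ?l = "inv2 C (lunit C s)" and ?l' = "inv2 C (lunit C s) \<bullet> inv2 C \<nu>"
  have l': "?l' \<in> icells C s' (id1 C A' \<odot> s)" by (rule vcomp_icells[OF icells_inv2(1)[OF assms(3)] l])
  have eq: "id2 C (id1 C A' \<odot> s) \<bullet> ?l = ?l' \<bullet> \<nu>"
    using vcomp_inv2_right'[OF assms(3) icells_cells[OF l]] vcomp_id_left[OF icells_cells[OF l]] by simp
  have ii: "id2 C (id1 C A' \<odot> s) \<in> cells C (id1 C A' \<odot> s) (id1 C A' \<odot> s)"
    using id2_cells ids by (simp add: hom_def)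
  have sq: "square g g ?l ?l' (g \<triangleright> \<nu>) (awhisker C g (id1 C A') g (id1 C A') (id2 C (g \<odot> id1 C A')) s)"
    if "g \<in> hom C A' D" for g D
    using square_lwhisker[OF assms(2) that icells_cells[OF assms(3)] icells_cells[OF l] icells_cells[OF l'] ii eq]
      awhisker_id[OF i that assms(2)] lwhisker_id[OF ids that] by simp
  have "src C s = E" using assms(2) by (simp add: hom_def)
  then show ?thesis using assms(1) l l' sq by auto
qed

section \<open>Composites of representatives\<close>

lemma frac_composites_iff:
  "e \<in> frac_composites C W F G H d2 d1 \<longleftrightarrow> (\<exists>X t1 t2 \<rho>. t1 \<in> hom C X (fst d1) \<and> t1 \<in> W \<and>
     t2 \<in> hom C X (fst d2) \<and> \<rho> \<in> icells C (snd_leg d1 \<odot> t1) (fst_leg d2 \<odot> t2) \<and>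
     e = compose_data G (restr G H d2 t2) \<rho> (restr F G d1 t1))"
proof -
  obtain A1 w1 f1 A2 w2 f2 A3 w3 f3 where
    [simp]: "F = (A1, w1, f1)" "G = (A2, w2, f2)" "H = (A3, w3, f3)"
    by (cases F; cases G; cases H)
  obtain X x y \<alpha> \<beta> X' y' k \<phi> \<psi> where
    [simp]: "d1 = (X, x, y, \<alpha>, \<beta>)" "d2 = (X', y', k, \<phi>, \<psi>)"
    by (cases d1; cases d2)
  show ?thesis
  proof
    assume "e \<in> frac_composites C W F G H d2 d1"
    then obtain Y t1 t2 \<rho> where *: "t1 \<in> hom C Y X" "t1 \<in> W" "t2 \<in> hom C Y X'" "\<rho> \<in> icells C (y \<odot> t1) (y' \<odot> t2)"
      "e = (Y, x \<odot> t1, k \<odot> t2,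
        awhisker C w2 y' w3 k \<phi> t2 \<bullet> ((w2 \<triangleright> \<rho>) \<bullet> awhisker C w1 x w2 y \<alpha> t1),
        awhisker C f2 y' f3 k \<psi> t2 \<bullet> ((f2 \<triangleright> \<rho>) \<bullet> awhisker C f1 x f2 y \<beta> t1))" by auto
    have "src C t1 = Y" using *(1) by (simp add: hom_def)
    then have "e = compose_data G (restr G H d2 t2) \<rho> (restr F G d1 t1)" using *(5) by simp
    then show "\<exists>Y t1 t2 \<rho>. t1 \<in> hom C Y (fst d1) \<and> t1 \<in> W \<and>
     t2 \<in> hom C Y (fst d2) \<and> \<rho> \<in> icells C (snd_leg d1 \<odot> t1) (fst_leg d2 \<odot> t2) \<and>
     e = compose_data G (restr G H d2 t2) \<rho> (restr F G d1 t1)" using *(1-4) by (simp, blast)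
  next
    assume "\<exists>Y t1 t2 \<rho>. t1 \<in> hom C Y (fst d1) \<and> t1 \<in> W \<and>
     t2 \<in> hom C Y (fst d2) \<and> \<rho> \<in> icells C (snd_leg d1 \<odot> t1) (fst_leg d2 \<odot> t2) \<and>
     e = compose_data G (restr G H d2 t2) \<rho> (restr F G d1 t1)"
    then obtain Y t1 t2 \<rho> where *: "t1 \<in> hom C Y X" "t1 \<in> W" "t2 \<in> hom C Y X'" "\<rho> \<in> icells C (y \<odot> t1) (y' \<odot> t2)"
      "e = compose_data G (restr G H d2 t2) \<rho> (restr F G d1 t1)" by auto
    have "src C t1 = Y" "Y \<in> Obj C" using *(1) hom_Obj by (auto simp: hom_def)
    then show "e \<in> frac_composites C W F G H d2 d1" using * by (simp, blast)
  qed
qed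

lemma frac_composites_frac_data:
  assumes "span A B F" "span A B G" "span A B H" "d1 \<in> frac_data C W F G" "d2 \<in> frac_data C W G H"
    and "e \<in> frac_composites C W F G H d2 d1"
  shows "e \<in> frac_data C W F H"
proof -
  obtain X t1 t2 \<rho> where t: "t1 \<in> hom C X (fst d1)" "t1 \<in> W" "t2 \<in> hom C X (fst d2)"
      "\<rho> \<in> icells C (snd_leg d1 \<odot> t1) (fst_leg d2 \<odot> t2)"
      "e = compose_data G (restr G H d2 t2) \<rho> (restr F G d1 t1)"
    using assms(6) unfolding frac_composites_iff by blast
  have d: "d1 \<in> pre_data F G" "in_W F d1" "d2 \<in> pre_data G H" using assms(4,5) by (auto simp: frac_data_iff)
  have l: "snd_leg (restr F G d1 t1) = snd_leg d1 \<odot> t1" "fst_leg (restr G H d2 t2) = fst_leg d2 \<odot> t2"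
      "fst_leg e = fst_leg (restr F G d1 t1)"
    unfolding t(5) by (cases F; cases G; cases H; cases d1; cases d2; simp)+
  have "e \<in> pre_data F H" unfolding t(5)
    by (rule compose_data_pre_data[OF assms(1-3) restr_pre_data[OF assms(1,2) d(1) t(1)] restr_pre_data[OF assms(2,3) d(3) t(3)]])
      (simp_all add: restr_fst[OF t(1)] restr_fst[OF t(3)] l t(4))
  moreover have "in_W F e"
    using in_W_restr[OF assms(1,2) d(1) t(1,2) d(2)] l(3) by (cases F) simp
  ultimately show ?thesis by (simp add: frac_data_iff)
qed

text \<open>Composition of classes is a union over composites, so an inhabitant is needed before it
  can equal a class. The Ore square is formed over \<open>w2\<close>, with
  \<open>w2 \<odot> y'\<close> in \<open>W\<close>.\<close>

lemma frac_composites_nonempty: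
  assumes "F \<in> frac_hom C W A B" "G \<in> frac_hom C W A B" "H \<in> frac_hom C W A B"
    and "d1 \<in> frac_data C W F G" "d2 \<in> frac_data C W G H"
  shows "frac_composites C W F G H d2 d1 \<noteq> {}"
proof -
  obtain A1 w1 f1 A2 w2 f2 A3 w3 f3 where
    [simp]: "F = (A1, w1, f1)" "G = (A2, w2, f2)" "H = (A3, w3, f3)"
    by (cases F; cases G; cases H)
  obtain X x y \<alpha> \<beta> X' y' k \<phi> \<psi> where
    [simp]: "d1 = (X, x, y, \<alpha>, \<beta>)" "d2 = (X', y', k, \<phi>, \<psi>)"
    by (cases d1; cases d2)
  have h: "w2 \<in> hom C A2 A" "w2 \<in> W" "y' \<in> hom C X' A2" "w2 \<odot> y' \<in> W" "y \<in> hom C X A2"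
    using assms by (auto simp: frac_hom_def)
  obtain E a b \<mu> where "a \<in> hom C E X" "a \<in> W" "b \<in> hom C E X'" "\<mu> \<in> icells C (y \<odot> a) (y' \<odot> b)"
    by (rule ore_square[OF h])
  then have "compose_data G (restr G H d2 b) \<mu> (restr F G d1 a) \<in> frac_composites C W F G H d2 d1"
    unfolding frac_composites_iff by (simp, blast)
  then show ?thesis by blast
qed

text \<open>
  If \<open>d|z \<cong> d1|z'\<close> and \<open>d'|y \<cong> d2|y'\<close>, the auxiliary morphisms of the composite are restricted along
  an \<open>a\<close> in \<open>W\<close> until they factor through \<open>z'\<close> and \<open>y'\<close>.
\<close>

lemma composite_refine:
  assumes "span A B F" "span A B G" "span A B H"
    and "(d, d1) \<in> frac_rel C W F G" "(d', d2) \<in> frac_rel C W G H"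
    and "e \<in> frac_composites C W F G H d2 d1"
  obtains E a q p \<kappa> where "a \<in> hom C E (fst e)" "a \<in> W" "q \<in> hom C E (fst d)" "p \<in> hom C E (fst d')"
    "\<kappa> \<in> icells C (snd_leg d \<odot> q) (fst_leg d' \<odot> p)"
    "data_iso F H (restr F H e a) (compose_data G (restr G H d' p) \<kappa> (restr F G d q))"
proof -
  note s1 = assms(1,2) and s2 = assms(2,3) and s3 = assms(1,3)
  obtain Z z z' where z: "d \<in> frac_data C W F G" "d1 \<in> frac_data C W F G" "z \<in> hom C Z (fst d)"
      "z' \<in> hom C Z (fst d1)" "in_W F (restr F G d z)" "data_iso F G (restr F G d z) (restr F G d1 z')"
    using assms(4) unfolding frac_rel_iff[OF s1] by blast
  obtain Y y y' where y: "d' \<in> frac_data C W G H" "d2 \<in> frac_data C W G H" "y \<in> hom C Y (fst d')"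
      "y' \<in> hom C Y (fst d2)" "in_W G (restr G H d' y)" "data_iso G H (restr G H d' y) (restr G H d2 y')"
    using assms(5) unfolding frac_rel_iff[OF s2] by blast
  have P: "d \<in> pre_data F G" "d1 \<in> pre_data F G" "d' \<in> pre_data G H" "d2 \<in> pre_data G H"
    using z(1,2) y(1,2) by (auto simp: frac_data_iff)
  obtain X t1 t2 \<rho> where t: "t1 \<in> hom C X (fst d1)" "t1 \<in> W" "t2 \<in> hom C X (fst d2)"
      "\<rho> \<in> icells C (snd_leg d1 \<odot> t1) (fst_leg d2 \<odot> t2)"
      "e = compose_data G (restr G H d2 t2) \<rho> (restr F G d1 t1)"
    using assms(6) unfolding frac_composites_iff by blast
  have w: "in_W F (restr F G d1 z')" "in_W G (restr G H d2 y')"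
    using in_W_iso[OF s1 restr_pre_data[OF s1 P(1) z(3)] restr_pre_data[OF s1 P(2) z(4)] z(6)] z(5)
      in_W_iso[OF s2 restr_pre_data[OF s2 P(3) y(3)] restr_pre_data[OF s2 P(4) y(4)] y(6)] y(5) by simp_all
  obtain E1 a1 b1 \<mu>1 where e1: "a1 \<in> hom C E1 X" "a1 \<in> W" "b1 \<in> hom C E1 Z" "\<mu>1 \<in> icells C (t1 \<odot> a1) (z' \<odot> b1)"
    by (rule ore_data[OF s1 z(2,4) w(1) t(1)])
  note t2a1 = comp1_hom[OF e1(1) t(3)]
  obtain E a2 b2 \<mu>2 where e2: "a2 \<in> hom C E E1" "a2 \<in> W" "b2 \<in> hom C E Y"
      "\<mu>2 \<in> icells C ((t2 \<odot> a1) \<odot> a2) (y' \<odot> b2)"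
    by (rule ore_data[OF s2 y(2,4) w(2) t2a1])
  let ?a = "a1 \<odot> a2" and ?b = "b1 \<odot> a2"
  note a = comp1_hom[OF e2(1) e1(1)] and b = comp1_hom[OF e2(1) e1(3)]
  have aW: "?a \<in> W" by (rule BF2[OF e2(1) e1(1) e2(2) e1(2)])
  note t1a1 = comp1_hom[OF e1(1) t(1)] and t1a = comp1_hom[OF a t(1)] and t2a = comp1_hom[OF a t(3)]
  note z'b1 = comp1_hom[OF e1(3) z(4)] and z'b = comp1_hom[OF b z(4)] and zb = comp1_hom[OF b z(3)]
  note y'b = comp1_hom[OF e2(3) y(4)] and yb = comp1_hom[OF e2(3) y(3)]
  \<comment> \<open>The factorisation through \<open>z'\<close> survives the second restriction by
    whiskering \<open>\<mu>1\<close> with \<open>a2\<close>; the one through \<open>y'\<close> only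
    has to be rebracketed.\<close>
  have m1: "assoc C z' b1 a2 \<bullet> ((\<mu>1 \<triangleleft> a2) \<bullet> inv2 C (assoc C t1 a1 a2)) \<in> icells C (t1 \<odot> ?a) (z' \<odot> ?b)"
    by (rule vcomp_icells[OF vcomp_icells[OF icells_inv2(1)[OF assoc_icells[OF e2(1) e1(1) t(1)]]
            rwhisker_icells[OF e1(4) t1a1 e2(1)]] assoc_icells[OF e2(1) e1(3) z(4)]])
  have m2: "\<mu>2 \<bullet> inv2 C (assoc C t2 a1 a2) \<in> icells C (t2 \<odot> ?a) (y' \<odot> b2)"
    by (rule vcomp_icells[OF icells_inv2(1)[OF assoc_icells[OF e2(1) e1(1) t(3)]] e2(4)])
  have f: "fst (restr F G d1 t1) = X" "fst (restr G H d2 t2) = X" using restr_fst[OF t(1)] restr_fst[OF t(3)] by simp_all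
  have l: "snd_leg (restr F G d1 t1) = snd_leg d1 \<odot> t1" "fst_leg (restr G H d2 t2) = fst_leg d2 \<odot> t2"
      "snd_leg (restr F G (restr F G d1 t1) ?a) = (snd_leg d1 \<odot> t1) \<odot> ?a"
      "fst_leg (restr G H (restr G H d2 t2) ?a) = (fst_leg d2 \<odot> t2) \<odot> ?a"
      "snd_leg (restr F G d (z \<odot> ?b)) = snd_leg d \<odot> (z \<odot> ?b)"
      "fst_leg (restr G H d' (y \<odot> b2)) = fst_leg d' \<odot> (y \<odot> b2)"
      "fst e = X"
    using f(1) unfolding t(5) by (cases F; cases G; cases H; cases d; cases d'; cases d1; cases d2; simp)+
  have af: "?a \<in> hom C E (fst (restr F G d1 t1))" "?a \<in> hom C E (fst (restr G H d2 t2))" using a f by simp_all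
  note p1 = restr_pre_data[OF s1 P(2) t(1)] and p2 = restr_pre_data[OF s2 P(4) t(3)]
  note p1a = restr_pre_data[OF s1 p1 af(1)] and p2a = restr_pre_data[OF s2 p2 af(2)]
  note q1 = restr_pre_data[OF s1 P(2) t1a] restr_pre_data[OF s1 P(2) z'b] restr_pre_data[OF s1 P(1) zb]
  note q2 = restr_pre_data[OF s2 P(4) t2a] restr_pre_data[OF s2 P(4) y'b] restr_pre_data[OF s2 P(3) yb]
  have i1: "data_iso F G (restr F G (restr F G d1 t1) ?a) (restr F G d (z \<odot> ?b))"
    by (rule data_iso_trans[OF s1 p1a q1(1,3) data_iso_restr_restr[OF s1 P(2) t(1) a]
          data_iso_trans[OF s1 q1 data_iso_cong[OF s1 P(2) t1a m1]
            data_iso_sym[OF s1 q1(3,2) data_iso_restr_comp[OF s1 P(1,2) z(3,4,6) b]]]])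
  have i2: "data_iso G H (restr G H (restr G H d2 t2) ?a) (restr G H d' (y \<odot> b2))"
    by (rule data_iso_trans[OF s2 p2a q2(1,3) data_iso_restr_restr[OF s2 P(4) t(3) a]
          data_iso_trans[OF s2 q2 data_iso_cong[OF s2 P(4) t2a m2]
            data_iso_sym[OF s2 q2(3,2) data_iso_restr_comp[OF s2 P(3,4) y(3,4,6) e2(3)]]]])
  have r: "\<rho> \<in> icells C (snd_leg (restr F G d1 t1)) (fst_leg (restr G H d2 t2))" using t(4) l by simp
  have eq: "restr F H e ?a = compose_data G (restr G H (restr G H d2 t2) ?a) (\<rho> \<triangleleft> ?a) (restr F G (restr F G d1 t1) ?a)"
    unfolding t(5) by (rule restr_compose_data[OF assms(1-3) p1 p2 _ r af(1)]) (simp add: f)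
  have "snd_leg d1 \<in> hom C (fst d1) (fst G)" using P(2) by (cases F; cases G; cases d1) auto
  then have rk: "\<rho> \<triangleleft> ?a \<in> icells C (snd_leg (restr F G (restr F G d1 t1) ?a)) (fst_leg (restr G H (restr G H d2 t2) ?a))"
    using rwhisker_icells[OF t(4) comp1_hom[OF t(1)] a] l by simp
  have fa: "fst (restr F G (restr F G d1 t1) ?a) = fst (restr G H (restr G H d2 t2) ?a)"
    using restr_fst[OF af(1)] restr_fst[OF af(2)] by simp
  obtain \<kappa> where k: "\<kappa> \<in> icells C (snd_leg (restr F G d (z \<odot> ?b))) (fst_leg (restr G H d' (y \<odot> b2)))"
      "data_iso F H (compose_data G (restr G H (restr G H d2 t2) ?a) (\<rho> \<triangleleft> ?a) (restr F G (restr F G d1 t1) ?a))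
        (compose_data G (restr G H d' (y \<odot> b2)) \<kappa> (restr F G d (z \<odot> ?b)))"
    by (rule compose_data_cong[OF assms(1-3) p1a p2a q1(3) q2(3) i1 i2 fa rk])
  show ?thesis
    by (rule that[of ?a E "z \<odot> ?b" "y \<odot> b2" \<kappa>]) (use a aW zb yb k l eq in simp_all)
qed

text \<open>The factors are arbitrary members \<open>d1\<close> and \<open>d2\<close> of the two
  classes, as the union in \<open>frac_vcomp\<close> demands. \<open>composite_refine\<close> brings
  the composite back to \<open>d\<close> and \<open>inv_data d\<close>, where cancellation is
  possible.\<close>

lemma inverse_composite:
  assumes "F \<in> frac_hom C W A B" "G \<in> frac_hom C W A B" "d \<in> frac_data C W F G" "invertible_data d"
    and "(d, d1) \<in> frac_rel C W F G" "(inv_data d, d2) \<in> frac_rel C W G F"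
    and "e \<in> frac_composites C W F G F d2 d1"
  shows "(id_data F, e) \<in> frac_rel C W F F"
proof -
  have F: "span A B F" and G: "span A B G" using assms(1,2) frac_hom_span by auto
  have P: "d \<in> pre_data F G" "in_W F d" using assms(3) by (auto simp: frac_data_iff)
  note inv = inv_data_pre_data[OF P(1) assms(4)]
  have inv_leg: "fst_leg (inv_data d) = snd_leg d" "fst (inv_data d) = fst d" by (cases d; simp)+
  have "d1 \<in> frac_data C W F G" "d2 \<in> frac_data C W G F"
    using assms(5,6) frac_rel_iff[OF F G] frac_rel_iff[OF G F] by blast+
  note ed = frac_composites_frac_data[OF F G F this assms(7)]
  then have e: "e \<in> pre_data F F" "in_W F e" by (auto simp: frac_data_iff)
  obtain E a q p \<kappa> where r: "a \<in> hom C E (fst e)" "a \<in> W" "q \<in> hom C E (fst d)" "p \<in> hom C E (fst d)"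
    "\<kappa> \<in> icells C (snd_leg d \<odot> q) (snd_leg d \<odot> p)"
    "data_iso F F (restr F F e a) (compose_data G (restr G F (inv_data d) p) \<kappa> (restr F G d q))"
    using composite_refine[OF F G F assms(5-7)] unfolding inv_leg by metis
  have legs: "fst (snd G) \<in> hom C (fst G) A" "fst (snd G) \<in> W" "snd_leg d \<in> hom C (fst d) (fst G)"
      "fst_leg d \<in> hom C (fst d) (fst F)" "fst (snd G) \<odot> snd_leg d \<in> W"
    using assms(2) P in_W_snd_leg[OF P(1)] by (cases F; cases G; cases d; auto simp: frac_hom_def)+
  obtain Y r' \<mu> T t \<kappa>' where l: "r' \<in> hom C Y E" "r' \<in> W" "\<mu> \<in> icells C (q \<odot> r') (p \<odot> r')"
      "t \<in> hom C T Y" "t \<in> W" "\<kappa>' \<in> icells C (snd_leg d \<odot> (q \<odot> r')) (snd_leg d \<odot> (p \<odot> r'))"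
      "\<kappa>' \<bullet> assoc C (snd_leg d) q r' = assoc C (snd_leg d) p r' \<bullet> (\<kappa> \<triangleleft> r')"
      "\<kappa>' \<triangleleft> t = (snd_leg d \<triangleright> \<mu>) \<triangleleft> t"
    by (rule lift_cell[OF legs(3,1,2,5) r(3,4,5)])
  let ?q = "q \<odot> r'" and ?p = "p \<odot> r'" and ?s = "fst_leg d \<odot> (q \<odot> r')"
  note qr = comp1_hom[OF l(1) r(3)] and pr = comp1_hom[OF l(1) r(4)]
  have p': "p \<in> hom C E (fst (inv_data d))" "?p \<in> hom C Y (fst (inv_data d))" using r(4) pr inv_leg by simp_all
  let ?c = "compose_data G (restr G F (inv_data d) p) \<kappa> (restr F G d q)"
  let ?c' = "compose_data G (restr G F (inv_data d) ?p) \<kappa>' (restr F G d ?q)"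
  let ?c'' = "compose_data G (restr G F (inv_data d) ?p) (snd_leg d \<triangleright> \<mu>) (restr F G d ?q)"
  note dq = restr_pre_data[OF F G P(1) r(3)] and dp = restr_pre_data[OF G F inv(1) p'(1)]
  note dqr = restr_pre_data[OF F G P(1) qr] and dpr = restr_pre_data[OF G F inv(1) p'(2)]
  have leg: "snd_leg (restr F G d k) = snd_leg d \<odot> k" "fst_leg (restr G F (inv_data d) k) = snd_leg d \<odot> k" for k
    by (cases F; cases G; cases d; simp)+
  note f = restr_fst[OF r(3), of F G d] restr_fst[OF p'(1), of G F "inv_data d"]
    restr_fst[OF qr, of F G d] restr_fst[OF p'(2), of G F "inv_data d"]
  have sm: "snd_leg d \<triangleright> \<mu> \<in> icells C (snd_leg d \<odot> ?q) (snd_leg d \<odot> ?p)"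
    by (rule lwhisker_icells(1)[OF l(3) qr legs(3)])
  have c: "?c \<in> pre_data F F" by (rule compose_data_pre_data[OF F G F dq dp]) (simp_all add: f leg r(5))
  have c': "?c' \<in> pre_data F F" by (rule compose_data_pre_data[OF F G F dqr dpr]) (simp_all add: f leg l(6))
  have c'': "?c'' \<in> pre_data F F" by (rule compose_data_pre_data[OF F G F dqr dpr]) (simp_all add: f leg sm)
  have fc: "fst ?c = E" "fst ?c' = Y" "fst ?c'' = Y"
    using f by (cases F; cases G; cases d; simp)+
  have i2: "data_iso F F (restr F F ?c r') ?c'"
    by (rule compose_data_restr_restr[OF F G F P(1) inv(1) r(3) p'(1) l(1)]) (simp_all add: inv_leg r(5) l(6,7))
  \<comment> \<open>The connecting cells \<kappa>' and
    \<open>snd_leg d \<triangleright> \<mu>\<close> agree only after whiskering with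
    \<open>t\<close>, but the restriction along \<open>t\<close> involves nothing else of
    them.\<close>
  have i3: "restr F F ?c' t = restr F F ?c'' t"
    using restr_compose_data[OF F G F dqr dpr _ _ , of \<kappa>' t T] restr_compose_data[OF F G F dqr dpr _ _ , of "snd_leg d \<triangleright> \<mu>" t T]
      l(4,6,8) sm f leg by simp
  have s: "?s \<in> hom C Y (fst F)" by (rule comp1_hom[OF qr legs(4)])
  have i4: "data_iso F F ?c'' (restr F F (id_data F) ?s)"
    using compose_inv_data[OF F G P(1) assms(4) qr l(3)] whisker_iso_id_data[of A B "fst F" "fst (snd F)" "snd (snd F)"]
      F s lwhisker_icells(1)[OF l(3) qr legs(4)] by simp
  have id: "id_data F \<in> pre_data F F" using id_data_frac_data[OF assms(1)] by (simp add: frac_data_iff)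
  have fid: "fst (id_data F) = fst F" by (cases F) simp
  have s': "?s \<in> hom C Y (fst (id_data F))" using s fid by simp
  note ids = restr_pre_data[OF F F id s']
  have tc: "t \<in> hom C T (fst ?c')" "t \<in> hom C T (fst ?c'')" "r' \<in> hom C Y (fst ?c)" using l fc by simp_all
  note ea = restr_pre_data[OF F F e(1) r(1)]
  have fea: "fst (restr F F e a) = E" by (rule restr_fst[OF r(1)])
  have r'e: "r' \<in> hom C Y (fst (restr F F e a))" using l(1) fea by simp
  note ear = restr_pre_data[OF F F ea r'e]
  have te: "t \<in> hom C T (fst (restr F F (restr F F e a) r'))" using l(4) restr_fst[OF r'e] by simp
  note cr = restr_pre_data[OF F F c tc(3)] and ct = restr_pre_data[OF F F c' tc(1)]
  note ar = comp1_hom[OF l(1) r(1)] and art = comp1_hom[OF l(4) comp1_hom[OF l(1) r(1)]]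
  note st = comp1_hom[OF l(4) s']
  have ta: "t \<in> hom C T (fst (restr F F e (a \<odot> r')))" using l(4) restr_fst[OF ar] by simp
  have j1: "data_iso F F (restr F F e (a \<odot> r')) ?c'"
    by (rule data_iso_trans[OF F F restr_pre_data[OF F F e(1) ar] ear c'
          data_iso_sym[OF F F ear restr_pre_data[OF F F e(1) ar] data_iso_restr_restr[OF F F e(1) r(1) l(1)]]
          data_iso_trans[OF F F ear cr c' data_iso_restr[OF F F ea c r(6) r'e] i2]])
  have ts: "t \<in> hom C T (fst (restr F F (id_data F) ?s))" using l(4) restr_fst[OF s'] by simp
  note k1 = restr_pre_data[OF F F restr_pre_data[OF F F e(1) ar] ta] and k2 = restr_pre_data[OF F F e(1) art]
  note k3 = restr_pre_data[OF F F id st] and k4 = restr_pre_data[OF F F ids ts]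
  have j2: "data_iso F F (restr F F e ((a \<odot> r') \<odot> t)) (restr F F ?c' t)"
    by (rule data_iso_trans[OF F F k2 k1 ct
          data_iso_sym[OF F F k1 k2 data_iso_restr_restr[OF F F e(1) ar l(4)]]
          data_iso_restr[OF F F restr_pre_data[OF F F e(1) ar] c' j1 ta]])
  have j3: "data_iso F F (restr F F ?c' t) (restr F F (id_data F) (?s \<odot> t))"
    unfolding i3
    by (rule data_iso_trans[OF F F restr_pre_data[OF F F c'' tc(2)] k4 k3
          data_iso_restr[OF F F c'' ids i4 tc(2)] data_iso_restr_restr[OF F F id s' l(4)]])
  note j = data_iso_trans[OF F F k2 ct k3 j2 j3]
  have "(a \<odot> r') \<odot> t \<in> W"
    by (rule BF2[OF l(4) ar l(5) BF2[OF l(1) r(1) l(2) r(2)]])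
  then have "in_W F (restr F F e ((a \<odot> r') \<odot> t))" by (rule in_W_restr[OF F F e(1) art _ e(2)])
  then have "(e, id_data F) \<in> frac_rel C W F F"
    unfolding frac_rel_iff[OF F F] using ed id_data_frac_data[OF assms(1)] art st j by blast
  then show ?thesis by (rule frac_rel_sym[OF F F])
qed

text \<open>Each class in the union is the identity class by \<open>inverse_composite\<close>;
  existence of one composite gives the remaining inclusion.\<close>

lemma frac_vcomp_inv_data:
  assumes "F \<in> frac_hom C W A B" "G \<in> frac_hom C W A B" "d \<in> frac_data C W F G" "invertible_data d"
  shows "frac_vcomp C W F G F (frac_class C W G F (inv_data d)) (frac_class C W F G d) = frac_id C W F"
proof -
  have F: "span A B F" and G: "span A B G" using assms(1,2) frac_hom_span by auto
  note inv = inv_data_frac_data[OF assms(3,4)]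
  have id: "frac_id C W F = frac_class C W F F (id_data F)" by (cases F) simp
  have *: "frac_class C W F F e = frac_id C W F"
    if "d1 \<in> frac_class C W F G d" "d2 \<in> frac_class C W G F (inv_data d)" "e \<in> frac_composites C W F G F d2 d1"
    for d1 d2 e
    unfolding id
    by (rule frac_class_eq[OF F F inverse_composite[OF assms _ _ that(3)], symmetric])
      (use that in \<open>auto simp: frac_class_def\<close>)
  have d: "d \<in> frac_class C W F G d" "inv_data d \<in> frac_class C W G F (inv_data d)"
    using frac_rel_refl[OF F G assms(3)] frac_rel_refl[OF G F inv] by (auto simp: frac_class_def)
  obtain e where e: "e \<in> frac_composites C W F G F (inv_data d) d"
    using frac_composites_nonempty[OF assms(1,2,1,3) inv] by blast
  show ?thesis
    unfolding frac_vcomp_def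
  proof (intro equalityI UN_least)
    fix d1 d2 e
    assume "d1 \<in> frac_class C W F G d" "d2 \<in> frac_class C W G F (inv_data d)"
      "e \<in> frac_composites C W F G F d2 d1"
    then show "frac_class C W F F e \<subseteq> frac_id C W F" using * by simp
  next
    show "frac_id C W F \<subseteq> (\<Union>d1\<in>frac_class C W F G d. \<Union>d2\<in>frac_class C W G F (inv_data d).
        \<Union>e\<in>frac_composites C W F G F d2 d1. frac_class C W F F e)"
      by (intro subsetI UN_I[OF d(1)] UN_I[OF d(2)] UN_I[OF e]) (simp only: *[OF d e])
  qed
qed

lemma frac_class_cells: "d \<in> frac_data C W F G \<Longrightarrow> frac_class C W F G d \<in> frac_cells C W F G"
  by (auto simp: frac_class_def frac_cells_def intro: quotientI)

text \<open>Passing to the restriction along \<open>u\<close> changes the representative but not the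
  class. The second composite is the first with the spans exchanged, since \<open>inv_data\<close>
  is an involution.\<close>

lemma locally_invertible_imp_frac_invertible:
  assumes "F \<in> frac_hom C W A B" "G \<in> frac_hom C W A B" "d \<in> frac_data C W F G" "locally_invertible F G d"
  shows "frac_invertible C W F G (frac_class C W F G d)"
proof -
  have F: "span A B F" and G: "span A B G" using assms(1,2) frac_hom_span by auto
  obtain U u where u: "u \<in> hom C U (fst d)" "in_W F (restr F G d u)" "invertible_data (restr F G d u)"
    using assms(4) unfolding locally_invertible_def by blast
  let ?d = "restr F G d u"
  have r: "(d, ?d) \<in> frac_rel C W F G" by (rule frac_rel_restr[OF F G assms(3) u(1,2)])
  have d: "?d \<in> frac_data C W F G" using r unfolding frac_rel_iff[OF F G] by blast
  have p: "?d \<in> pre_data F G" using d by (simp add: frac_data_iff)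
  note inv = inv_data_frac_data[OF d u(3)] and inv' = inv_data_pre_data[OF p u(3)]
  show ?thesis
    unfolding frac_invertible_def frac_class_eq[OF F G r]
    using frac_class_cells[OF d] frac_class_cells[OF inv] frac_vcomp_inv_data[OF assms(1,2) d u(3)]
      frac_vcomp_inv_data[OF assms(2,1) inv inv'(2)] inv'(3) by auto
qed

text \<open>Some restriction of a composite is isomorphic to a restriction of identity data, so its
  second cell is invertible. One-sided inverses for the two factors follow.\<close>

lemma composite_id:
  assumes "F \<in> frac_hom C W A B" "G \<in> frac_hom C W A B" "d1 \<in> frac_data C W F G" "d2 \<in> frac_data C W G F"
    and "frac_vcomp C W F G F (frac_class C W G F d2) (frac_class C W F G d1) = frac_id C W F"
  obtains Z p q where "p \<in> hom C Z (fst d1)" "in_W F (restr F G d1 p)" "linv_data (restr F G d1 p)"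
    "q \<in> hom C Z (fst d2)" "in_W G (restr G F d2 q)" "rinv_data (restr G F d2 q)"
proof -
  have F: "span A B F" and G: "span A B G" using assms(1,2) frac_hom_span by auto
  obtain e where e: "e \<in> frac_composites C W F G F d2 d1"
    using frac_composites_nonempty[OF assms(1,2,1,3,4)] by blast
  note ed = frac_composites_frac_data[OF F G F assms(3,4) e]
  have P: "d1 \<in> pre_data F G" "d2 \<in> pre_data G F" "e \<in> pre_data F F"
    using assms(3,4) ed by (auto simp: frac_data_iff)
  have "d1 \<in> frac_class C W F G d1" "d2 \<in> frac_class C W G F d2" "e \<in> frac_class C W F F e"
    using frac_rel_refl[OF F G assms(3)] frac_rel_refl[OF G F assms(4)] frac_rel_refl[OF F F ed]
    by (auto simp: frac_class_def)
  then have "e \<in> frac_id C W F" unfolding assms(5)[symmetric] frac_vcomp_def using e by blast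
  then have "(id_data F, e) \<in> frac_rel C W F F" by (cases F) (simp add: frac_class_def)
  then obtain Z z z' where z: "z \<in> hom C Z (fst (id_data F))" "z' \<in> hom C Z (fst e)" "in_W F (restr F F (id_data F) z)"
      "data_iso F F (restr F F (id_data F) z) (restr F F e z')"
    unfolding frac_rel_iff[OF F F] by blast
  have id: "id_data F \<in> pre_data F F" using id_data_frac_data[OF assms(1)] by (simp add: frac_data_iff)
  note idz = restr_pre_data[OF F F id z(1)] and ez = restr_pre_data[OF F F P(3) z(2)]
  have inv: "invertible_data (restr F F e z')"
    by (rule data_iso_invertible[OF F F idz ez z(4) invertible_restr[OF F F id z(1) id_data_invertible[OF F]]])
  have eW: "in_W F (restr F F e z')" using in_W_iso[OF F F idz ez z(4)] z(3) by simp
  obtain X t1 t2 \<rho> where t: "t1 \<in> hom C X (fst d1)" "t1 \<in> W" "t2 \<in> hom C X (fst d2)"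
      "\<rho> \<in> icells C (snd_leg d1 \<odot> t1) (fst_leg d2 \<odot> t2)"
      "e = compose_data G (restr G F d2 t2) \<rho> (restr F G d1 t1)"
    using e unfolding frac_composites_iff by blast
  have f: "fst (restr F G d1 t1) = X" "fst (restr G F d2 t2) = X" using restr_fst[OF t(1)] restr_fst[OF t(3)] by simp_all
  have l: "snd_leg (restr F G d1 t1) = snd_leg d1 \<odot> t1" "fst_leg (restr G F d2 t2) = fst_leg d2 \<odot> t2" "fst e = X"
      "snd_leg (restr F G (restr F G d1 t1) z') = (snd_leg d1 \<odot> t1) \<odot> z'"
      "fst_leg (restr G F (restr G F d2 t2) z') = (fst_leg d2 \<odot> t2) \<odot> z'"
      "fst_leg (restr F F e z') = fst_leg (restr F G (restr F G d1 t1) z')"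
      "snd_leg (restr F F e z') = snd_leg (restr G F (restr G F d2 t2) z')"
    using f(1) unfolding t(5) by (cases F; cases G; cases d1; cases d2; simp)+
  have zf: "z' \<in> hom C Z X" "z' \<in> hom C Z (fst (restr F G d1 t1))" "z' \<in> hom C Z (fst (restr G F d2 t2))"
    using z(2) l(3) f by simp_all
  note p1 = restr_pre_data[OF F G P(1) t(1)] and p2 = restr_pre_data[OF G F P(2) t(3)]
  note p1z = restr_pre_data[OF F G p1 zf(2)] and p2z = restr_pre_data[OF G F p2 zf(3)]
  note q1 = restr_pre_data[OF F G P(1) comp1_hom[OF zf(1) t(1)]]
    and q2 = restr_pre_data[OF G F P(2) comp1_hom[OF zf(1) t(3)]]
  have r: "\<rho> \<in> icells C (snd_leg (restr F G d1 t1)) (fst_leg (restr G F d2 t2))" using t(4) l by simp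
  have eq: "restr F F e z' = compose_data G (restr G F (restr G F d2 t2) z') (\<rho> \<triangleleft> z') (restr F G (restr F G d1 t1) z')"
    unfolding t(5) by (rule restr_compose_data[OF F G F p1 p2 _ r zf(2)]) (simp add: f)
  have "snd_leg d1 \<in> hom C (fst d1) (fst G)" using P(1) by (cases F; cases G; cases d1) auto
  then have rz: "\<rho> \<triangleleft> z' \<in> icells C (snd_leg (restr F G (restr F G d1 t1) z')) (fst_leg (restr G F (restr G F d2 t2) z'))"
    using rwhisker_icells[OF t(4) comp1_hom[OF t(1)] zf(1)] l by simp
  have fz: "fst (restr F G (restr F G d1 t1) z') = fst (restr G F (restr G F d2 t2) z')"
    using restr_fst[OF zf(2)] restr_fst[OF zf(3)] by simp
  note lr = linv_compose[OF F G F p1z p2z fz rz inv[unfolded eq]]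
  note i1 = data_iso_restr_restr[OF F G P(1) t(1) zf(1)] and i2 = data_iso_restr_restr[OF G F P(2) t(3) zf(1)]
  have w1: "in_W F (restr F G (restr F G d1 t1) z')" using eW l(6) by (cases F) simp
  \<comment> \<open>The composite and its last factor share their second leg and both end at
    \<open>F\<close>, so the denominator of \<open>d2\<close> can be read there.\<close>
  have w2: "in_W G (restr G F (restr G F d2 t2) z')"
    using eW in_W_snd_leg[OF ez] in_W_snd_leg[OF p2z] l(7) by simp
  show ?thesis
    by (rule that[OF comp1_hom[OF zf(1) t(1)] _ linv_rinv_iso(1)[OF F G p1z q1 i1 lr(1)]
          comp1_hom[OF zf(1) t(3)] _ linv_rinv_iso(2)[OF G F p2z q2 i2 lr(2)]])
      (use in_W_iso[OF F G p1z q1 i1] in_W_iso[OF G F p2z q2 i2] w1 w2 in simp_all)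
qed

lemma frac_invertible_imp_locally_invertible:
  assumes "F \<in> frac_hom C W A B" "G \<in> frac_hom C W A B" "d \<in> frac_data C W F G"
    and "frac_invertible C W F G (frac_class C W F G d)"
  shows "locally_invertible F G d"
proof -
  have F: "span A B F" and G: "span A B G" using assms(1,2) frac_hom_span by auto
  have P: "d \<in> pre_data F G" using assms(3) by (simp add: frac_data_iff)
  obtain \<Delta> where D: "\<Delta> \<in> frac_cells C W G F" "frac_vcomp C W F G F \<Delta> (frac_class C W F G d) = frac_id C W F"
      "frac_vcomp C W G F G (frac_class C W F G d) \<Delta> = frac_id C W G"
    using assms(4) unfolding frac_invertible_def by blast
  obtain d' where d': "d' \<in> frac_data C W G F" "\<Delta> = frac_class C W G F d'"
    using D(1) unfolding frac_cells_def frac_class_def by (auto elim: quotientE)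
  obtain Z p where p: "p \<in> hom C Z (fst d)" "in_W F (restr F G d p)" "linv_data (restr F G d p)"
    by (rule composite_id[OF assms(1,2,3) d'(1) D(2)[unfolded d'(2)]])
  obtain Y q where q: "q \<in> hom C Y (fst d)" "in_W F (restr F G d q)" "rinv_data (restr F G d q)"
    \<comment> \<open>In this composite \<open>d\<close> is the last factor, whence a right
      inverse.\<close>
    by (rule composite_id[OF assms(2,1) d'(1) assms(3) D(3)[unfolded d'(2)]])
  obtain E a b \<mu> where e: "a \<in> hom C E Y" "a \<in> W" "b \<in> hom C E Z" "\<mu> \<in> icells C (q \<odot> a) (p \<odot> b)"
    by (rule ore_data[OF F G assms(3) p(1,2) q(1)])
  note qa = comp1_hom[OF e(1) q(1)] and pb = comp1_hom[OF e(3) p(1)]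
  have a: "a \<in> hom C E (fst (restr F G d q))" using e(1) restr_fst[OF q(1)] by simp
  have b: "b \<in> hom C E (fst (restr F G d p))" using e(3) restr_fst[OF p(1)] by simp
  note dq = restr_pre_data[OF F G P q(1)] and dp = restr_pre_data[OF F G P p(1)]
  note dqa = restr_pre_data[OF F G P qa] and dpb = restr_pre_data[OF F G P pb]
  have "rinv_data (restr F G d (q \<odot> a))"
    by (rule linv_rinv_iso(2)[OF F G restr_pre_data[OF F G dq a] dqa data_iso_restr_restr[OF F G P q(1) e(1)]
          linv_rinv_restr(2)[OF F G dq a q(3)]])
  moreover have "linv_data (restr F G d (q \<odot> a))"
    by (rule linv_rinv_iso(1)[OF F G dpb dqa data_iso_sym[OF F G dqa dpb data_iso_cong[OF F G P qa e(4)]]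
          linv_rinv_iso(1)[OF F G restr_pre_data[OF F G dp b] dpb data_iso_restr_restr[OF F G P p(1) e(3)]
            linv_rinv_restr(1)[OF F G dp b p(3)]]])
  ultimately show ?thesis
    unfolding locally_invertible_def
    using linv_rinv_data[OF dqa] qa in_W_restr_comp[OF F G P q(1,2) e(1,2)] by blast
qed

section \<open>From local invertibility to the stated conditions\<close>

lemma invertible_restr_iff:
  assumes "span A B F" "span A B G" "d \<in> pre_data F G" "d = (X, x, y, \<alpha>, \<beta>)" "z \<in> hom C Z X"
  shows "invertible_data (restr F G d z) \<longleftrightarrow> invertible2 C (\<beta> \<triangleleft> z)"
proof -
  obtain A1 w1 f1 A2 w2 f2 where [simp]: "F = (A1, w1, f1)" "G = (A2, w2, f2)" by (cases F; cases G)
  have h: "x \<in> hom C X A1" "f1 \<in> hom C A1 B" "y \<in> hom C X A2" "f2 \<in> hom C A2 B"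
    "\<beta> \<in> cells C (f1 \<odot> x) (f2 \<odot> y)" "z \<in> hom C Z X"
    using assms by auto
  note a1 = assoc_icells[OF h(6,1,2)] and a2 = assoc_icells[OF h(6,3,4)]
  note w = awhisker_assoc[OF h] and bz = rwhisker_cells[OF h(5) comp1_hom[OF h(1,2)] h(6)]
  let ?w = "awhisker C f1 x f2 y \<beta> z"
  have "\<beta> \<triangleleft> z = inv2 C (assoc C f2 y z) \<bullet> (?w \<bullet> assoc C f1 x z)"
    using vcomp_inv2_left[OF a2 bz] w(2) by simp
  then have "?w \<in> icells C (f1 \<odot> (x \<odot> z)) (f2 \<odot> (y \<odot> z)) \<Longrightarrow> \<beta> \<triangleleft> z \<in> icells C ((f1 \<odot> x) \<odot> z) ((f2 \<odot> y) \<odot> z)"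
    using vcomp_icells[OF vcomp_icells[OF a1] icells_inv2(1)[OF a2]] by simp
  moreover have "\<beta> \<triangleleft> z \<in> icells C ((f1 \<odot> x) \<odot> z) ((f2 \<odot> y) \<odot> z) \<Longrightarrow> ?w \<in> icells C (f1 \<odot> (x \<odot> z)) (f2 \<odot> (y \<odot> z))"
    unfolding awhisker_def using vcomp_icells[OF vcomp_icells[OF icells_inv2(1)[OF a1]] a2] by simp
  ultimately show ?thesis
    using assms(4) invertible_iff[OF w(1)] invertible_iff[OF bz] by auto
qed

lemma locally_invertible_iff:
  assumes "F \<in> frac_hom C W A B" "G \<in> frac_hom C W A B" "d \<in> frac_data C W F G" "d = (X, x, y, \<alpha>, \<beta>)"
  shows "locally_invertible F G d \<longleftrightarrow> (\<exists>Z\<in>Obj C. \<exists>u\<in>hom C Z X. u \<in> W \<and> invertible2 C (\<beta> \<triangleleft> u))"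
    and "locally_invertible F G d \<longleftrightarrow> (\<exists>Z\<in>Obj C. \<exists>u\<in>hom C Z X. x \<odot> u \<in> W \<and> invertible2 C (\<beta> \<triangleleft> u))"
proof -
  have F: "span A B F" and G: "span A B G" using assms(1,2) frac_hom_span by auto
  have P: "d \<in> pre_data F G" "in_W F d" "fst d = X" using assms(3,4) by (auto simp: frac_data_iff)
  obtain A1 w1 f1 where F': "F = (A1, w1, f1)" by (cases F)
  have h: "w1 \<in> hom C A1 A" "w1 \<in> W" "x \<in> hom C X A1" "w1 \<odot> x \<in> W"
    using assms(1,4) P F' by (cases G; auto simp: frac_hom_def)+
  have in_W: "in_W F (restr F G d z) \<longleftrightarrow> w1 \<odot> (x \<odot> z) \<in> W" for z
    using F' assms(4) by (cases G) simp
  have inv: "invertible2 C (\<beta> \<triangleleft> (u \<odot> b))" "u \<odot> b \<in> hom C Y X"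
    if "u \<in> hom C U X" "b \<in> hom C Y U" "invertible_data (restr F G d u)" for u b U Y
  proof -
    have u: "u \<in> hom C U (fst d)" using that P(3) by simp
    have b: "b \<in> hom C Y (fst (restr F G d u))" using that(2) restr_fst[OF u] by simp
    note p = restr_pre_data[OF F G P(1) u] and ub = comp1_hom[OF that(2) u]
    have "invertible_data (restr F G d (u \<odot> b))"
      by (rule data_iso_invertible[OF F G restr_pre_data[OF F G p b] restr_pre_data[OF F G P(1) ub]
            data_iso_restr_restr[OF F G P(1) u that(2)] invertible_restr[OF F G p b that(3)]])
    then show "invertible2 C (\<beta> \<triangleleft> (u \<odot> b))" "u \<odot> b \<in> hom C Y X"
      using invertible_restr_iff[OF F G P(1) assms(4)] ub P(3) by auto
  qed
  have intro: "locally_invertible F G d" if "u \<in> hom C U X" "x \<odot> u \<in> W \<or> u \<in> W" "invertible2 C (\<beta> \<triangleleft> u)" for U u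
  proof -
    have u: "u \<in> hom C U (fst d)" using that P(3) by simp
    have "in_W F (restr F G d u)"
      using that(2)
    proof
      assume "x \<odot> u \<in> W"
      then show ?thesis using in_W BF2[OF comp1_hom[OF that(1) h(3)] h(1) _ h(2)] by simp
    next
      assume "u \<in> W"
      then show ?thesis using in_W_restr[OF F G P(1) u _ P(2)] by simp
    qed
    then show ?thesis
      unfolding locally_invertible_def using u invertible_restr_iff[OF F G P(1) assms(4) that(1)] that(3) by blast
  qed
  {
    assume "locally_invertible F G d"
    then obtain U u where u: "u \<in> hom C U X" "in_W F (restr F G d u)" "invertible_data (restr F G d u)"
      unfolding locally_invertible_def P(3) by blast
    have wxu: "w1 \<odot> (x \<odot> u) \<in> W" "(w1 \<odot> x) \<odot> u \<in> W"
      using u(2) in_W W_iso[OF assoc_icells[OF u(1) h(3,1)]] by simp_all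
    \<comment> \<open>The same denominator is cut at two places: after \<open>w1 \<odot> x\<close>,
      which puts \<open>u \<odot> b\<close> in \<open>W\<close>, and after \<open>w1\<close>, which
      puts \<open>(x \<odot> u) \<odot> b'\<close> in \<open>W\<close>.\<close>
    obtain Y b where b: "b \<in> hom C Y U" "u \<odot> b \<in> W"
      by (rule W_shrink[OF comp1_hom[OF h(3,1)] h(4) u(1) wxu(2)])
    obtain Y' b' where b': "b' \<in> hom C Y' U" "(x \<odot> u) \<odot> b' \<in> W"
      by (rule W_shrink[OF h(1,2) comp1_hom[OF u(1) h(3)] wxu(1)])
    have "x \<odot> (u \<odot> b') \<in> W" using W_iso[OF assoc_icells[OF b'(1) u(1) h(3)]] b'(2) by simp
    then have "(\<exists>Z\<in>Obj C. \<exists>u\<in>hom C Z X. u \<in> W \<and> invertible2 C (\<beta> \<triangleleft> u)) \<and>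
        (\<exists>Z\<in>Obj C. \<exists>u\<in>hom C Z X. x \<odot> u \<in> W \<and> invertible2 C (\<beta> \<triangleleft> u))"
      using inv[OF u(1) b(1) u(3)] inv[OF u(1) b'(1) u(3)] b(2) hom_Obj[OF b(1)] hom_Obj[OF b'(1)] by blast
  }
  then show "locally_invertible F G d \<longleftrightarrow> (\<exists>Z\<in>Obj C. \<exists>u\<in>hom C Z X. u \<in> W \<and> invertible2 C (\<beta> \<triangleleft> u))"
    and "locally_invertible F G d \<longleftrightarrow> (\<exists>Z\<in>Obj C. \<exists>u\<in>hom C Z X. x \<odot> u \<in> W \<and> invertible2 C (\<beta> \<triangleleft> u))"
    using intro by blast+
qed

lemma invertible_imp_locally_invertible:
  assumes "span A B F" "span A B G" "d \<in> frac_data C W F G" "invertible_data d"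
  shows "locally_invertible F G d"
proof -
  have P: "d \<in> pre_data F G" "in_W F d" using assms(3) by (auto simp: frac_data_iff)
  have X: "fst d \<in> Obj C" using P(1) hom_Obj by (cases F; cases G; cases d) auto
  note i = id1_hom[OF X]
  show ?thesis
    unfolding locally_invertible_def
    using i in_W_restr[OF assms(1,2) P(1) i BF1[OF X] P(2)] invertible_restr[OF assms(1,2) P(1) i assms(4)] by blast
qed

end

theorem proposition1p4:
  fixes C :: "('o, 'm, 't) bicat" and W :: "'m set"
    and A B A1 A2 :: 'o and w1 f1 w2 f2 :: 'm
    and \<Gamma> :: "('o, 'm, 't) fdata set"
  assumes "bf_bicategory C W"
    and "(A1, w1, f1) \<in> frac_hom C W A B"
    and "(A2, w2, f2) \<in> frac_hom C W A B"
    and "\<Gamma> \<in> frac_cells C W (A1, w1, f1) (A2, w2, f2)"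
  shows "(frac_invertible C W (A1, w1, f1) (A2, w2, f2) \<Gamma> \<longleftrightarrow>
          (\<exists>A3 v1 v2 \<alpha> \<beta>. (A3, v1, v2, \<alpha>, \<beta>) \<in> \<Gamma> \<and> invertible2 C \<beta>)) \<and>
         (frac_invertible C W (A1, w1, f1) (A2, w2, f2) \<Gamma> \<longleftrightarrow>
          (\<forall>A3 v1 v2 \<alpha> \<beta>. (A3, v1, v2, \<alpha>, \<beta>) \<in> \<Gamma> \<longrightarrow>
             (\<exists>A4\<in>Obj C. \<exists>u\<in>hom C A4 A3. u \<in> W \<and> invertible2 C (\<beta> \<triangleleft>\<^bsub>C\<^esub> u)))) \<and>
         (frac_invertible C W (A1, w1, f1) (A2, w2, f2) \<Gamma> \<longleftrightarrow>
          (\<forall>A3 v1 v2 \<alpha> \<beta>. (A3, v1, v2, \<alpha>, \<beta>) \<in> \<Gamma> \<longrightarrow>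
             (\<exists>A4\<in>Obj C. \<exists>u\<in>hom C A4 A3. v1 \<odot>\<^bsub>C\<^esub> u \<in> W \<and> invertible2 C (\<beta> \<triangleleft>\<^bsub>C\<^esub> u))))"
proof -
  interpret bf_bicategory C W by (rule assms(1))
  let ?F = "(A1, w1, f1)" and ?G = "(A2, w2, f2)"
  have F: "span A B ?F" and G: "span A B ?G" using assms(2,3) frac_hom_span by auto
  obtain d where d: "d \<in> frac_data C W ?F ?G" "\<Gamma> = frac_class C W ?F ?G d"
    using assms(4) unfolding frac_cells_def frac_class_def by (auto elim: quotientE)
  have in_class: "(d, d') \<in> frac_rel C W ?F ?G" if "d' \<in> \<Gamma>" for d'
    using that d(2) by (simp add: frac_class_def)
  have dG: "d \<in> \<Gamma>" using frac_rel_refl[OF F G d(1)] d(2) by (simp add: frac_class_def)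
  have inv_iff: "frac_invertible C W ?F ?G \<Gamma> \<longleftrightarrow> locally_invertible ?F ?G d"
    unfolding d(2) using locally_invertible_imp_frac_invertible[OF assms(2,3) d(1)]
      frac_invertible_imp_locally_invertible[OF assms(2,3) d(1)] by blast
  have li_iff: "locally_invertible ?F ?G d' \<longleftrightarrow> locally_invertible ?F ?G d" "d' \<in> frac_data C W ?F ?G" if "d' \<in> \<Gamma>" for d'
    using locally_invertible_rel[OF F G in_class[OF that]]
      locally_invertible_rel[OF F G frac_rel_sym[OF F G in_class[OF that]]] in_class[OF that]
    unfolding frac_rel_iff[OF F G] by blast+
  have "locally_invertible ?F ?G d \<longleftrightarrow> (\<exists>d'\<in>\<Gamma>. invertible_data d')"
  proof
    assume "locally_invertible ?F ?G d"
    then obtain U u where u: "u \<in> hom C U (fst d)" "in_W ?F (restr ?F ?G d u)" "invertible_data (restr ?F ?G d u)"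
      unfolding locally_invertible_def by blast
    then have "restr ?F ?G d u \<in> \<Gamma>" using frac_rel_restr[OF F G d(1) u(1,2)] d(2) by (simp add: frac_class_def)
    then show "\<exists>d'\<in>\<Gamma>. invertible_data d'" using u(3) by blast
  next
    assume "\<exists>d'\<in>\<Gamma>. invertible_data d'"
    then show "locally_invertible ?F ?G d" using invertible_imp_locally_invertible[OF F G] li_iff by blast
  qed
  also have "\<dots> \<longleftrightarrow> (\<exists>A3 v1 v2 \<alpha> \<beta>. (A3, v1, v2, \<alpha>, \<beta>) \<in> \<Gamma> \<and> invertible2 C \<beta>)"
    by (auto simp: Bex_def)
  finally have ii: "locally_invertible ?F ?G d \<longleftrightarrow>
      (\<exists>A3 v1 v2 \<alpha> \<beta>. (A3, v1, v2, \<alpha>, \<beta>) \<in> \<Gamma> \<and> invertible2 C \<beta>)" .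
  \<comment> \<open>Local invertibility is constant on the nonempty class, so asking it of one
    representative or of all amounts to the same. The remaining conditions are then compared
    representative by representative.\<close>
  have iii: "locally_invertible ?F ?G d \<longleftrightarrow> (\<forall>d'\<in>\<Gamma>. locally_invertible ?F ?G d')"
    using li_iff(1) dG by blast
  show ?thesis
    unfolding inv_iff
  proof (intro conjI)
    show "locally_invertible ?F ?G d \<longleftrightarrow> (\<exists>A3 v1 v2 \<alpha> \<beta>. (A3, v1, v2, \<alpha>, \<beta>) \<in> \<Gamma> \<and> invertible2 C \<beta>)" by (rule ii)
    show "locally_invertible ?F ?G d \<longleftrightarrow> (\<forall>A3 v1 v2 \<alpha> \<beta>. (A3, v1, v2, \<alpha>, \<beta>) \<in> \<Gamma> \<longrightarrow>
             (\<exists>A4\<in>Obj C. \<exists>u\<in>hom C A4 A3. u \<in> W \<and> invertible2 C (\<beta> \<triangleleft>\<^bsub>C\<^esub> u)))"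
      unfolding iii using locally_invertible_iff(1)[OF assms(2,3) li_iff(2) refl] by fastforce
    show "locally_invertible ?F ?G d \<longleftrightarrow> (\<forall>A3 v1 v2 \<alpha> \<beta>. (A3, v1, v2, \<alpha>, \<beta>) \<in> \<Gamma> \<longrightarrow>
             (\<exists>A4\<in>Obj C. \<exists>u\<in>hom C A4 A3. v1 \<odot>\<^bsub>C\<^esub> u \<in> W \<and> invertible2 C (\<beta> \<triangleleft>\<^bsub>C\<^esub> u)))"
      unfolding iii using locally_invertible_iff(2)[OF assms(2,3) li_iff(2) refl] by fastforce
  qed
qed

end
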